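(* Let $(M,\omega,J)$ be a Stein manifold of complex dimension $n$ with complex structure $J$ and a symplectic form $\omega$ taming $J$. Let $L_1$ and $L_2$ be smooth Lagrangian submanifolds of $M$ intersecting transversely at a point $p$. Then the union $L_1\cup L_2$ is locally p.s.h. convex near $p$.
   Context: A Stein manifold is a complex manifold admitting a smooth strictly plurisubharmonic (p.s.h.) exhaustion function. The symplectic form $\omega$ tames $J$ if $\omega(v,Jv)>0$ for every nonzero tangent vector $v$. A submanifold $L\subset M$ is Lagrangian if $\omega|_L=0$ and $\dim_{\mathbb{R}}L=n$. Distances on $M$ are those of the Riemannian metric $h(u,v)=\frac12(\omega(u,Jv)+\omega(v,Ju))$, and $\mathbb{B}(p,\varepsilon)$ is the corresponding open ball. For a compact subset $K$ of a complex manifold $U$, its p.s.h. convex hull is $\widehat{K}^{psh}_U=\{q\in U: u(q)\le\sup_K u$ for all continuous p.s.h. functions $u:U\to\mathbb{R}\}$, and $K$ is p.s.h. convex in $U$ if $\widehat{K}^{psh}_U=K$. A closed subset $S$ of a complex manifold $M$ is locally p.s.h. convex near a point $p\in M$ if there exists a Stein neighbourhood $U$ of $p$ such that for every sufficiently small $\varepsilon>0$ the set $S\cap\overline{\mathbb{B}(p,\varepsilon)}$ is p.s.h. convex in $U$. This depends only on $S$ near $p$, so it is applied equally to sets that are closed in a neighbourhood of $p$ (submanifolds being embedded). *)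

theory Defs
  imports "HOL-Analysis.Analysis"
begin

section \<open>Smooth and holomorphic maps between open sets of Euclidean spaces\<close>

primrec Ck_on :: "nat \<Rightarrow> ('a::euclidean_space \<Rightarrow> 'b::real_normed_vector) \<Rightarrow> 'a set \<Rightarrow> bool" where
  "Ck_on 0 f S \<longleftrightarrow> continuous_on S f"
| "Ck_on (Suc k) f S \<longleftrightarrow>
     (\<forall>x\<in>S. f differentiable (at x)) \<and>
     (\<forall>v. Ck_on k (\<lambda>x. frechet_derivative f (at x) v) S)"

text \<open>Only used for open \<open>S\<close>.\<close>

definition smooth_on :: "('a::euclidean_space \<Rightarrow> 'b::real_normed_vector) \<Rightarrow> 'a set \<Rightarrow> bool" where
  "smooth_on f S \<longleftrightarrow> (\<forall>k. Ck_on k f S)"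

definition holo_map_on :: "(complex^'n \<Rightarrow> complex^'n) \<Rightarrow> (complex^'n::finite) set \<Rightarrow> bool" where
  "holo_map_on f S \<longleftrightarrow>
     (\<forall>z\<in>S. \<exists>f'. (f has_derivative f') (at z) \<and> (\<forall>c v. f' (c *s v) = c *s f' v))"


section \<open>Complex manifolds\<close>

text \<open>
  The manifold is the whole type \<open>'m\<close>; its complex structure is given by an atlas of charts with
  values in \<open>complex^'n\<close>, so the complex dimension is \<open>CARD('n)\<close>. A chart is a pair of its
  domain and its coordinate map (whose values outside the domain are irrelevant).
\<close>

type_synonym ('m, 'n) chart = "'m set \<times> ('m \<Rightarrow> complex^'n)"

definition chart_inv :: "('m, 'n::finite) chart \<Rightarrow> complex^'n \<Rightarrow> 'm" where
  "chart_inv \<phi> = inv_into (fst \<phi>) (snd \<phi>)"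

definition complex_atlas ::
    "('m::{t2_space, second_countable_topology}, 'n::finite) chart set \<Rightarrow> bool" where
  "complex_atlas A \<longleftrightarrow>
     (\<Union>\<phi>\<in>A. fst \<phi>) = UNIV \<and>
     (\<forall>\<phi>\<in>A. open (fst \<phi>) \<and> open (snd \<phi> ` fst \<phi>) \<and>
        homeomorphism (fst \<phi>) (snd \<phi> ` fst \<phi>) (snd \<phi>) (chart_inv \<phi>)) \<and>
     (\<forall>\<phi>\<in>A. \<forall>\<psi>\<in>A. holo_map_on (snd \<psi> \<circ> chart_inv \<phi>) (snd \<phi> ` (fst \<phi> \<inter> fst \<psi>)))"

definition smooth_fun_on ::
    "('m::topological_space, 'n::finite) chart set \<Rightarrow> 'm set \<Rightarrow> ('m \<Rightarrow> real) \<Rightarrow> bool" where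
  "smooth_fun_on A U u \<longleftrightarrow> (\<forall>\<phi>\<in>A. smooth_on (u \<circ> chart_inv \<phi>) (snd \<phi> ` (fst \<phi> \<inter> U)))"


section \<open>Plurisubharmonic functions and Stein manifolds\<close>

text \<open>Submean value property on every closed complex disc contained in the open set \<open>V\<close>.\<close>

definition cont_psh :: "(complex^'n::finite) set \<Rightarrow> (complex^'n \<Rightarrow> real) \<Rightarrow> bool" where
  "cont_psh V u \<longleftrightarrow> continuous_on V u \<and>
     (\<forall>z w. (\<forall>\<zeta>. cmod \<zeta> \<le> 1 \<longrightarrow> z + \<zeta> *s w \<in> V) \<longrightarrow>
        u z \<le> (1 / (2 * pi)) * integral {0..2 * pi} (\<lambda>\<theta>. u (z + cis \<theta> *s w)))"

text \<open>
  The Levi form \<open>\<Sum>\<^sub>j\<^sub>k (\<partial>\<^sup>2u / \<partial>z\<^sub>j \<partial>\<bar>z\<^sub>k) w\<^sub>j \<bar>w\<^sub>k\<close>: one quarter of the Laplacian at 0 of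
  \<open>\<zeta> \<mapsto> u (z + \<zeta> w)\<close>.
\<close>

definition levi_form :: "(complex^'n::finite \<Rightarrow> real) \<Rightarrow> complex^'n \<Rightarrow> complex^'n \<Rightarrow> real" where
  "levi_form u z w =
     (frechet_derivative (\<lambda>x. frechet_derivative u (at x) w) (at z) w +
      frechet_derivative (\<lambda>x. frechet_derivative u (at x) (\<i> *s w)) (at z) (\<i> *s w)) / 4"

definition cont_psh_on ::
    "('m::topological_space, 'n::finite) chart set \<Rightarrow> 'm set \<Rightarrow> ('m \<Rightarrow> real) \<Rightarrow> bool" where
  "cont_psh_on A U u \<longleftrightarrow> (\<forall>\<phi>\<in>A. cont_psh (snd \<phi> ` (fst \<phi> \<inter> U)) (u \<circ> chart_inv \<phi>))"

definition smooth_strictly_psh_on ::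
    "('m::topological_space, 'n::finite) chart set \<Rightarrow> 'm set \<Rightarrow> ('m \<Rightarrow> real) \<Rightarrow> bool" where
  "smooth_strictly_psh_on A U u \<longleftrightarrow> smooth_fun_on A U u \<and>
     (\<forall>\<phi>\<in>A. \<forall>z\<in>snd \<phi> ` (fst \<phi> \<inter> U). \<forall>w. w \<noteq> 0 \<longrightarrow> levi_form (u \<circ> chart_inv \<phi>) z w > 0)"

text \<open>An open subset \<open>U\<close>, with the complex structure induced by \<open>A\<close>, is Stein.\<close>

definition stein_on :: "('m::topological_space, 'n::finite) chart set \<Rightarrow> 'm set \<Rightarrow> bool" where
  "stein_on A U \<longleftrightarrow> open U \<and>
     (\<exists>\<rho>. smooth_strictly_psh_on A U \<rho> \<and> (\<forall>c. compact {q \<in> U. \<rho> q \<le> c}))"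

definition psh_hull ::
    "('m::topological_space, 'n::finite) chart set \<Rightarrow> 'm set \<Rightarrow> 'm set \<Rightarrow> 'm set" where
  "psh_hull A U K = {q \<in> U. \<forall>u. cont_psh_on A U u \<longrightarrow> u q \<le> (SUP x\<in>K. u x)}"

definition psh_convex_in ::
    "('m::topological_space, 'n::finite) chart set \<Rightarrow> 'm set \<Rightarrow> 'm set \<Rightarrow> bool" where
  "psh_convex_in A U K \<longleftrightarrow> compact K \<and> K \<subseteq> U \<and> psh_hull A U K = K"


section \<open>Tangent vectors and the complex structure\<close>

text \<open>
  A tangent vector at \<open>p\<close> is the family of its coordinate representations in all charts around
  \<open>p\<close>, extended by 0 to all other charts.
\<close>

type_synonym ('m, 'n) tvec = "('m, 'n) chart \<Rightarrow> complex^'n"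

definition tangent_space ::
    "('m::topological_space, 'n::finite) chart set \<Rightarrow> 'm \<Rightarrow> ('m, 'n) tvec set" where
  "tangent_space A p =
     {v. (\<forall>\<phi>\<in>A. \<forall>\<psi>\<in>A. p \<in> fst \<phi> \<inter> fst \<psi> \<longrightarrow>
            v \<psi> = frechet_derivative (snd \<psi> \<circ> chart_inv \<phi>) (at (snd \<phi> p)) (v \<phi>)) \<and>
         (\<forall>\<phi>. \<not> (\<phi> \<in> A \<and> p \<in> fst \<phi>) \<longrightarrow> v \<phi> = 0)}"

definition tv_zero :: "('m, 'n::finite) tvec" where
  "tv_zero = (\<lambda>\<phi>. 0)"

definition tv_add :: "('m, 'n::finite) tvec \<Rightarrow> ('m, 'n) tvec \<Rightarrow> ('m, 'n) tvec" where
  "tv_add v w = (\<lambda>\<phi>. v \<phi> + w \<phi>)"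

definition tv_scale :: "real \<Rightarrow> ('m, 'n::finite) tvec \<Rightarrow> ('m, 'n) tvec" where
  "tv_scale r v = (\<lambda>\<phi>. r *\<^sub>R v \<phi>)"

definition Jop :: "('m, 'n::finite) tvec \<Rightarrow> ('m, 'n) tvec" where
  "Jop v = (\<lambda>\<phi>. \<i> *s v \<phi>)"

text \<open>The tangent vector at \<open>p\<close> whose representation in the chart \<open>\<phi>\<close> is \<open>a\<close>.\<close>

definition coord_vec ::
    "('m::topological_space, 'n::finite) chart set \<Rightarrow> ('m, 'n) chart \<Rightarrow> 'm \<Rightarrow> complex^'n \<Rightarrow> ('m, 'n) tvec"
  where
  "coord_vec A \<phi> p a = (\<lambda>\<psi>. if \<psi> \<in> A \<and> p \<in> fst \<psi>
     then frechet_derivative (snd \<psi> \<circ> chart_inv \<phi>) (at (snd \<phi> p)) a else 0)"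


section \<open>Symplectic forms\<close>

type_synonym ('m, 'n) two_form = "'m \<Rightarrow> ('m, 'n) tvec \<Rightarrow> ('m, 'n) tvec \<Rightarrow> real"

definition alternating_bilinear_on ::
    "('m, 'n::finite) tvec set \<Rightarrow> (('m, 'n) tvec \<Rightarrow> ('m, 'n) tvec \<Rightarrow> real) \<Rightarrow> bool" where
  "alternating_bilinear_on T b \<longleftrightarrow>
     (\<forall>u\<in>T. \<forall>v\<in>T. \<forall>w\<in>T. b (tv_add u v) w = b u w + b v w) \<and>
     (\<forall>r. \<forall>u\<in>T. \<forall>w\<in>T. b (tv_scale r u) w = r * b u w) \<and>
     (\<forall>u\<in>T. \<forall>v\<in>T. b u v = - b v u)"

definition form_coeff ::
    "('m::topological_space, 'n::finite) chart set \<Rightarrow> ('m, 'n) two_form \<Rightarrow> ('m, 'n) chart \<Rightarrow>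
     complex^'n \<Rightarrow> complex^'n \<Rightarrow> complex^'n \<Rightarrow> real" where
  "form_coeff A \<omega> \<phi> a b = (\<lambda>z. \<omega> (chart_inv \<phi> z)
     (coord_vec A \<phi> (chart_inv \<phi> z) a) (coord_vec A \<phi> (chart_inv \<phi> z) b))"

definition smooth_two_form ::
    "('m::topological_space, 'n::finite) chart set \<Rightarrow> ('m, 'n) two_form \<Rightarrow> bool" where
  "smooth_two_form A \<omega> \<longleftrightarrow>
     (\<forall>p. alternating_bilinear_on (tangent_space A p) (\<omega> p)) \<and>
     (\<forall>\<phi>\<in>A. \<forall>a b. smooth_on (form_coeff A \<omega> \<phi> a b) (snd \<phi> ` fst \<phi>))"

text \<open>\<open>d\<omega> = 0\<close>, evaluated on constant coordinate vector fields (whose Lie brackets vanish).\<close>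

definition closed_two_form ::
    "('m::topological_space, 'n::finite) chart set \<Rightarrow> ('m, 'n) two_form \<Rightarrow> bool" where
  "closed_two_form A \<omega> \<longleftrightarrow>
     (\<forall>\<phi>\<in>A. \<forall>z\<in>snd \<phi> ` fst \<phi>. \<forall>a b c.
        frechet_derivative (form_coeff A \<omega> \<phi> b c) (at z) a +
        frechet_derivative (form_coeff A \<omega> \<phi> c a) (at z) b +
        frechet_derivative (form_coeff A \<omega> \<phi> a b) (at z) c = 0)"

definition symplectic_form ::
    "('m::topological_space, 'n::finite) chart set \<Rightarrow> ('m, 'n) two_form \<Rightarrow> bool" where
  "symplectic_form A \<omega> \<longleftrightarrow> smooth_two_form A \<omega> \<and> closed_two_form A \<omega> \<and>
     (\<forall>p. \<forall>u\<in>tangent_space A p. (\<forall>v\<in>tangent_space A p. \<omega> p u v = 0) \<longrightarrow> u = tv_zero)"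

definition tames_J ::
    "('m::topological_space, 'n::finite) chart set \<Rightarrow> ('m, 'n) two_form \<Rightarrow> bool" where
  "tames_J A \<omega> \<longleftrightarrow> (\<forall>p. \<forall>v\<in>tangent_space A p. v \<noteq> tv_zero \<longrightarrow> \<omega> p v (Jop v) > 0)"


section \<open>Curves, Riemannian distance and balls\<close>

definition smooth_curve_on ::
    "('m::topological_space, 'n::finite) chart set \<Rightarrow> real set \<Rightarrow> (real \<Rightarrow> 'm) \<Rightarrow> bool" where
  "smooth_curve_on A I \<gamma> \<longleftrightarrow> open I \<and> continuous_on I \<gamma> \<and>
     (\<forall>\<phi>\<in>A. smooth_on (snd \<phi> \<circ> \<gamma>) {t \<in> I. \<gamma> t \<in> fst \<phi>})"

definition velocity ::
    "('m::topological_space, 'n::finite) chart set \<Rightarrow> (real \<Rightarrow> 'm) \<Rightarrow> real \<Rightarrow> ('m, 'n) tvec" where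
  "velocity A \<gamma> t = (\<lambda>\<phi>. if \<phi> \<in> A \<and> \<gamma> t \<in> fst \<phi>
     then vector_derivative (snd \<phi> \<circ> \<gamma>) (at t) else 0)"

definition piecewise_smooth_curve ::
    "('m::topological_space, 'n::finite) chart set \<Rightarrow> (real \<Rightarrow> 'm) \<Rightarrow> bool" where
  "piecewise_smooth_curve A \<gamma> \<longleftrightarrow> continuous_on {0..1} \<gamma> \<and>
     (\<exists>(m::nat) t. t 0 = 0 \<and> t m = 1 \<and>
        (\<forall>i<m. t i < t (Suc i) \<and>
           (\<exists>I g. {t i..t (Suc i)} \<subseteq> I \<and> smooth_curve_on A I g \<and>
              (\<forall>s\<in>{t i..t (Suc i)}. \<gamma> s = g s))))"

definition riem_metric ::
    "('m, 'n::finite) two_form \<Rightarrow> 'm \<Rightarrow> ('m, 'n) tvec \<Rightarrow> ('m, 'n) tvec \<Rightarrow> real" where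
  "riem_metric \<omega> p u v = (\<omega> p u (Jop v) + \<omega> p v (Jop u)) / 2"

definition curve_length ::
    "('m::topological_space, 'n::finite) chart set \<Rightarrow> ('m, 'n) two_form \<Rightarrow> (real \<Rightarrow> 'm) \<Rightarrow> real" where
  "curve_length A \<omega> \<gamma> =
     integral {0..1} (\<lambda>t. sqrt (riem_metric \<omega> (\<gamma> t) (velocity A \<gamma> t) (velocity A \<gamma> t)))"

text \<open>Infinite if \<open>p\<close> and \<open>q\<close> lie in different components.\<close>

definition riem_dist ::
    "('m::topological_space, 'n::finite) chart set \<Rightarrow> ('m, 'n) two_form \<Rightarrow> 'm \<Rightarrow> 'm \<Rightarrow> ereal" where
  "riem_dist A \<omega> p q =
     (INF \<gamma>\<in>{\<gamma>. piecewise_smooth_curve A \<gamma> \<and> \<gamma> 0 = p \<and> \<gamma> 1 = q}. ereal (curve_length A \<omega> \<gamma>))"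

definition riem_ball ::
    "('m::topological_space, 'n::finite) chart set \<Rightarrow> ('m, 'n) two_form \<Rightarrow> 'm \<Rightarrow> real \<Rightarrow> 'm set" where
  "riem_ball A \<omega> p \<epsilon> = {q. riem_dist A \<omega> p q < ereal \<epsilon>}"


section \<open>Lagrangian submanifolds\<close>

text \<open>Embedded submanifolds of real dimension \<open>k\<close>, by slice charts: \<open>dim\<close> is the real dimension.\<close>

definition embedded_submanifold ::
    "('m::topological_space, 'n::finite) chart set \<Rightarrow> nat \<Rightarrow> 'm set \<Rightarrow> bool" where
  "embedded_submanifold A k L \<longleftrightarrow>
     (\<forall>q\<in>L. \<exists>\<phi>\<in>A. \<exists>V W F G E.
        q \<in> fst \<phi> \<and> snd \<phi> q \<in> V \<and> V \<subseteq> snd \<phi> ` fst \<phi> \<and> open V \<and> open W \<and>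
        homeomorphism V W F G \<and> smooth_on F V \<and> smooth_on G W \<and>
        subspace (E :: (complex^'n) set) \<and> dim E = k \<and>
        F ` (V \<inter> snd \<phi> ` (fst \<phi> \<inter> L)) = W \<inter> E)"

definition submanifold_tangent_space ::
    "('m::topological_space, 'n::finite) chart set \<Rightarrow> 'm set \<Rightarrow> 'm \<Rightarrow> ('m, 'n) tvec set" where
  "submanifold_tangent_space A L q =
     {velocity A \<gamma> 0 | \<gamma>. \<exists>I. 0 \<in> I \<and> smooth_curve_on A I \<gamma> \<and> \<gamma> ` I \<subseteq> L \<and> \<gamma> 0 = q}"

definition lagrangian_submanifold ::
    "('m::topological_space, 'n::finite) chart set \<Rightarrow> ('m, 'n) two_form \<Rightarrow> 'm set \<Rightarrow> bool" where
  "lagrangian_submanifold A \<omega> L \<longleftrightarrow> embedded_submanifold A CARD('n) L \<and>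
     (\<forall>q\<in>L. \<forall>u\<in>submanifold_tangent_space A L q. \<forall>v\<in>submanifold_tangent_space A L q. \<omega> q u v = 0)"

definition transverse_at ::
    "('m::topological_space, 'n::finite) chart set \<Rightarrow> 'm set \<Rightarrow> 'm set \<Rightarrow> 'm \<Rightarrow> bool" where
  "transverse_at A L1 L2 p \<longleftrightarrow> p \<in> L1 \<and> p \<in> L2 \<and>
     tangent_space A p =
       {tv_add u v | u v. u \<in> submanifold_tangent_space A L1 p \<and> v \<in> submanifold_tangent_space A L2 p}"


section \<open>Local p.s.h. convexity\<close>

definition locally_psh_convex ::
    "('m::topological_space, 'n::finite) chart set \<Rightarrow> ('m, 'n) two_form \<Rightarrow> 'm set \<Rightarrow> 'm \<Rightarrow> bool" where
  "locally_psh_convex A \<omega> S p \<longleftrightarrow>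
     (\<exists>U. p \<in> U \<and> stein_on A U \<and>
        (\<exists>\<epsilon>0>0. \<forall>\<epsilon>. 0 < \<epsilon> \<and> \<epsilon> < \<epsilon>0 \<longrightarrow> psh_convex_in A U (S \<inter> closure (riem_ball A \<omega> p \<epsilon>))))"

end

theory Submission
  imports Defs "HOL-Complex_Analysis.Cauchy_Integral_Formula"
begin

text \<open>
  Let \<open>T1\<close>, \<open>T2\<close> be the tangent spaces at \<open>p\<close> in a chart, \<open>\<Omega>\<close> the symplectic form at \<open>p\<close>, and
  let \<open>\<sigma>\<close> be \<open>1\<close> on \<open>T1\<close> and \<open>-1\<close> on \<open>T2\<close>. Since \<open>T1\<close> and \<open>T2\<close> are Lagrangian, \<open>\<sigma>\<close> is skew for \<open>\<Omega>\<close>, so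
  \<open>h v = \<Omega> (\<sigma> v) (\<i> v)\<close> satisfies \<open>h (\<i> v) = - h v\<close> and is the real part of a holomorphic quadratic
  form \<open>P\<close>; by taming it is positive on \<open>T1\<close> and negative on \<open>T2\<close>. Hence near \<open>p\<close> the form \<open>P\<close> maps \<open>L1\<close>
  and \<open>L2\<close> into opposite sectors of the plane, and the hull of a compact \<open>K\<close> in \<open>L1 \<union> L2\<close> containing \<open>p\<close> is
  controlled as in Kallin's lemma: the functions \<open>- ln \<bar>P - \<i> t\<bar>\<close> show that the hull meets
  \<open>Re P = 0\<close> only at \<open>p\<close>, which decouples the two sides. On each side \<open>L\<close> is totally real, and
  if \<open>g\<close> is a defining map of \<open>L\<close>, the function \<open>\<parallel>g\<parallel>\<^sup>2 - \<kappa> \<parallel>z - q\<parallel>\<^sup>2\<close> is plurisubharmonic and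
  separates \<open>q\<close> from \<open>K\<close>.
\<close>

section \<open>Harmonic minorants and the submean inequality\<close>

text \<open>The functions -ln |P - it| are p.s.h. only off the fibre P = it, and the functions that
  separate q are used only where Re P > 0. Neither kind lives on the whole ball, so the argument
  rests on localisation: a function that is p.s.h. merely near the hull of K still obeys the hull
  inequality. To make the necessary gluing cheap, plurisubharmonicity is handled through holomorphic
  support functions at single points, and the submean inequality of the definition is recovered by a
  maximum principle in one variable. The delicate place is the origin, where the two sectors touch.
  Points of the hull with Re P = 0 and P not 0 are excluded by a pole just beyond the outermost of
  them. The fibre P = 0 has no such room: there a pole extremely close to 0 is combined with a large
  multiple of the squared norm. Taming acts in several places: it gives the signs of P on T1 and T2,
  it makes both spaces totally real and their intersection trivial, and it compares Riemannian with
  coordinate balls.\<close>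

lemma holomorphic_mean_value:
  assumes "f holomorphic_on ball c e" and "0 < r" and "r < e"
  shows "((\<lambda>t. f (c + of_real r * cis t)) has_integral (2 * of_real pi * f c)) {0..2*pi}"
proof -
  have "f holomorphic_on cball c r"
    using assms by (auto intro: holomorphic_on_subset)
  then have "((\<lambda>u. f u / (u - c)) has_contour_integral (2 * of_real pi * \<i> * f c)) (circlepath c r)"
    using Cauchy_integral_circlepath_simple[of f c r c] assms(2) by simp
  then have "((\<lambda>t. f (c + r * cis t) / (c + r * cis t - c) * r * \<i> * cis t)
      has_integral (2 * of_real pi * \<i> * f c)) {0..2*pi}"
    unfolding circlepath_def
    by (subst (asm) has_contour_integral_part_circlepath_iff) auto
  moreover have "(\<lambda>t. f (c + r * cis t) / (c + r * cis t - c) * r * \<i> * cis t)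
      = (\<lambda>t. \<i> * f (c + r * cis t))"
    using assms(2) by (auto simp: field_simps)
  ultimately have "((\<lambda>t. \<i> * f (c + r * cis t)) has_integral (\<i> * (2 * of_real pi * f c))) {0..2*pi}"
    by (simp add: mult_ac)
  from has_integral_mult_right[OF this, of "-\<i>"] show ?thesis
    by (simp flip: mult.assoc)
qed

lemma Re_holomorphic_mean_value:
  assumes "f holomorphic_on ball c e" and "0 < r" and "r < e"
  shows "((\<lambda>t. Re (f (c + of_real r * cis t))) has_integral (2 * pi * Re (f c))) {0..2*pi}"
  using has_integral_linear[OF holomorphic_mean_value[OF assms] bounded_linear_Re]
  by (simp add: o_def)

text \<open>On the circle z * cnj z = 1, so the product of the two tails loses its factors z and
  recursion applies. The remaining terms each involve a constant coefficient; they are polynomials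
  or conjugates of polynomials, and conjugation does not change a real part.\<close>

lemma Re_times_cnj_poly_on_circle:
  "\<exists>s. \<forall>z. cmod z = 1 \<longrightarrow> Re (poly p z * cnj (poly q z)) = Re (poly s z)"
proof (induction p arbitrary: q)
  case 0
  show ?case by (rule exI[of _ 0]) simp
next
  case (pCons a p)
  obtain b q' where q: "q = pCons b q'" by (cases q)
  obtain s' where s': "\<And>z. cmod z = 1 \<Longrightarrow> Re (poly p z * cnj (poly q' z)) = Re (poly s' z)"
    using pCons.IH by blast
  show ?case
  proof (intro exI allI impI)
    fix z assume z: "cmod z = 1"
    have zz: "z * cnj z = 1" using z by (simp add: complex_norm_square[symmetric])
    have "poly (pCons a p) z * cnj (poly q z) =
        cnj b * poly (pCons a p) z + cnj (cnj a * (z * poly q' z)) + (z * cnj z) * (poly p z * cnj (poly q' z))"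
      by (simp add: q algebra_simps)
    then show "Re (poly (pCons a p) z * cnj (poly q z)) =
        Re (poly (smult (cnj b) (pCons a p) + smult (cnj a) (pCons 0 q') + s') z)"
      unfolding zz using s'[OF z] by (simp add: algebra_simps)
  qed
qed

text \<open>Re a * Re b is half the real part of a * b + a * cnj b.\<close>

lemma Re_times_Re_poly_on_circle:
  "\<exists>s. \<forall>z. cmod z = 1 \<longrightarrow> Re (poly p z) * Re (poly q z) = Re (poly s z)"
proof -
  obtain s where s: "\<And>z. cmod z = 1 \<Longrightarrow> Re (poly p z * cnj (poly q z)) = Re (poly s z)"
    using Re_times_cnj_poly_on_circle by blast
  show ?thesis
    by (rule exI[of _ "smult (1/2) (p * q + s)"]) (auto simp flip: s simp: field_simps)
qed

text \<open>By the product formula the real parts of polynomials form an algebra on the circle, so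
  Stone-Weierstrass applies. This takes the place of solving the Dirichlet problem: boundary values
  are approximated by functions whose harmonic extension is explicit.\<close>

lemma approx_on_circle_by_Re_poly:
  assumes "continuous_on (sphere (0::complex) 1) v" and "e > 0"
  shows "\<exists>p. \<forall>z. cmod z = 1 \<longrightarrow> \<bar>v z - Re (poly p z)\<bar> < e"
proof -
  define R where "R = {f :: complex \<Rightarrow> real. \<exists>p. \<forall>z. cmod z = 1 \<longrightarrow> f z = Re (poly p z)}"
  have "function_ring_on R (sphere (0::complex) 1)"
  proof
    fix f assume "f \<in> R"
    then obtain p where p: "\<And>z. cmod z = 1 \<Longrightarrow> f z = Re (poly p z)"
      unfolding R_def by blast
    have "continuous_on (sphere 0 1) (\<lambda>z. Re (poly p z))"
      by (intro continuous_intros)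
    then show "continuous_on (sphere 0 1) f"
      by (rule continuous_on_eq) (simp add: p)
  next
    fix f g assume "f \<in> R" "g \<in> R"
    then obtain p q where pq: "\<And>z. cmod z = 1 \<Longrightarrow> f z = Re (poly p z)"
        "\<And>z. cmod z = 1 \<Longrightarrow> g z = Re (poly q z)"
      unfolding R_def by blast
    show "(\<lambda>x. f x + g x) \<in> R"
      unfolding R_def by (rule CollectI, rule exI[of _ "p + q"]) (simp add: pq)
    obtain s where s: "\<And>z. cmod z = 1 \<Longrightarrow> Re (poly p z) * Re (poly q z) = Re (poly s z)"
      using Re_times_Re_poly_on_circle by blast
    show "(\<lambda>x. f x * g x) \<in> R"
      unfolding R_def by (rule CollectI, rule exI[of _ s]) (simp add: pq s)
  next
    fix c show "(\<lambda>_. c) \<in> R"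
      unfolding R_def by (rule CollectI, rule exI[of _ "[:of_real c:]"]) simp
  next
    fix x y :: complex assume "x \<noteq> y"
    have 1: "Re \<in> R" unfolding R_def by (rule CollectI, rule exI[of _ "[:0,1:]"]) simp
    have 2: "(\<lambda>z. Im z) \<in> R" unfolding R_def by (rule CollectI, rule exI[of _ "[:0,-\<i>:]"]) simp
    from \<open>x \<noteq> y\<close> have "Re x \<noteq> Re y \<or> Im x \<noteq> Im y" by (simp add: complex_eq_iff)
    then show "\<exists>f\<in>R. f x \<noteq> f y" using 1 2 by blast
  qed simp
  from function_ring_on.Stone_Weierstrass_basic[OF this assms] obtain g where
    "g \<in> R" "\<forall>x\<in>sphere 0 1. \<bar>v x - g x\<bar> < e" by blast
  then obtain p where p: "\<forall>z. cmod z = 1 \<longrightarrow> g z = Re (poly p z)"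
    unfolding R_def by blast
  have "\<bar>v z - Re (poly p z)\<bar> < e" if "cmod z = 1" for z
    using that p \<open>\<forall>x\<in>sphere 0 1. \<bar>v x - g x\<bar> < e\<close>[rule_format, of z] by simp
  then show ?thesis by (intro exI[of _ p]) auto
qed

text \<open>A harmonic function, written as the real part of a holomorphic one, that touches v from
  below at c.\<close>

definition harmonic_minorant_at :: "(complex \<Rightarrow> real) \<Rightarrow> complex \<Rightarrow> bool" where
  "harmonic_minorant_at v c \<longleftrightarrow> (\<exists>f e. 0 < e \<and> f holomorphic_on ball c e \<and> Re (f c) = v c \<and>
     (\<forall>\<zeta>\<in>ball c e. Re (f \<zeta>) \<le> v \<zeta>))"

text \<open>Adding \<epsilon> |z|^2 makes an interior maximum impossible: there the harmonic
  minorant, corrected by a linear term, would lie strictly below its central value on a whole small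
  circle, against the mean value property.\<close>

lemma harmonic_minorant_max_principle:
  assumes cont: "continuous_on (cball 0 1) v"
    and minor: "\<And>c. c \<in> ball 0 1 \<Longrightarrow> harmonic_minorant_at v c"
    and bound: "\<And>z. cmod z = 1 \<Longrightarrow> v z - Re (poly p z) \<le> M"
  shows "v 0 - Re (poly p 0) \<le> M"
proof (rule field_le_epsilon)
  fix \<epsilon> :: real assume "\<epsilon> > 0"
  define w where "w z = v z - Re (poly p z) + \<epsilon> * (cmod z)\<^sup>2" for z
  have "continuous_on (cball 0 1) w"
    unfolding w_def by (intro continuous_intros cont)
  then obtain c where c: "c \<in> cball 0 1" "\<And>z. z \<in> cball 0 1 \<Longrightarrow> w z \<le> w c"
    using continuous_attains_sup[of "cball 0 1" w] by auto
  have "cmod c = 1"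
  proof (rule ccontr)
    assume "cmod c \<noteq> 1"
    with c(1) have cb: "c \<in> ball 0 1" by simp
    obtain f e where f: "0 < e" "f holomorphic_on ball c e" "Re (f c) = v c"
        "\<And>\<zeta>. \<zeta> \<in> ball c e \<Longrightarrow> Re (f \<zeta>) \<le> v \<zeta>"
      using minor[OF cb] unfolding harmonic_minorant_at_def by blast
    define r where "r = min (e/2) ((1 - cmod c)/2)"
    have r: "0 < r" "r < e" "r < 1 - cmod c" using f(1) cb by (auto simp: r_def min_def)
    \<comment> \<open>The last term carries the linear part of \<epsilon> |z|^2 at c; the rest of
      its increment is \<epsilon> |z - c|^2, which equals \<epsilon> r^2 on the circle.\<close>
    define g where "g z = f z - poly p z + 2 * of_real \<epsilon> * cnj c * (z - c)" for z
    have g: "g holomorphic_on ball c e"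
      unfolding g_def by (intro holomorphic_intros f)
    have le: "Re (g (c + r * cis t)) \<le> Re (g c) - \<epsilon> * r\<^sup>2" for t
    proof -
      define z where "z = c + r * cis t"
      have dz: "cmod (z - c) = r" using r by (simp add: z_def norm_mult)
      have zb: "z \<in> ball c e" using dz r by (simp add: dist_norm norm_minus_commute)
      have "cmod z \<le> cmod c + cmod (z - c)" using norm_triangle_ineq[of c "z-c"] by simp
      then have "z \<in> cball 0 1" using dz r by simp
      then have "w z \<le> w c" by (rule c)
      moreover have "Re (f z) \<le> v z" by (rule f(4)[OF zb])
      moreover have "(cmod z)\<^sup>2 = (cmod c)\<^sup>2 + 2 * Re (cnj c * (z - c)) + r\<^sup>2"
        unfolding dz[symmetric] by (simp add: cmod_power2) (simp add: power2_eq_square algebra_simps)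
      then have "\<epsilon> * (cmod z)\<^sup>2 = \<epsilon> * (cmod c)\<^sup>2 + 2 * \<epsilon> * Re (cnj c * (z - c)) + \<epsilon> * r\<^sup>2"
        by (simp only: distrib_left mult.assoc mult.left_commute)
      moreover have "Re (g z) = Re (f z) - Re (poly p z) + 2 * \<epsilon> * Re (cnj c * (z - c))"
        unfolding g_def by (simp add: algebra_simps)
      moreover have "Re (g c) = v c - Re (poly p c)" by (simp add: g_def f)
      ultimately show ?thesis unfolding w_def z_def[symmetric] by linarith
    qed
    have "2 * pi * Re (g c) \<le> (2 * pi) * (Re (g c) - \<epsilon> * r\<^sup>2)"
      using has_integral_le[OF Re_holomorphic_mean_value[OF g r(1,2)]
          has_integral_const_real[of "Re (g c) - \<epsilon> * r\<^sup>2" 0 "2*pi"]] le by simp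
    then have "\<epsilon> * r\<^sup>2 \<le> 0" by simp
    then show False using \<open>\<epsilon> > 0\<close> r(1) by (simp add: mult_le_0_iff)
  qed
  then have "w c \<le> M + \<epsilon>" using bound[of c] by (simp add: w_def)
  with c(2)[of 0] show "v 0 - Re (poly p 0) \<le> M + \<epsilon>" by (simp add: w_def)
qed

text \<open>If Re p is close to v on the circle, the maximum principle bounds v 0 by Re (p 0) up to
  the error, and Re (p 0) is the mean of Re p, hence close to the mean of v.\<close>

lemma harmonic_minorant_submean:
  assumes cont: "continuous_on (cball 0 1) v"
    and minor: "\<And>c. c \<in> ball 0 1 \<Longrightarrow> harmonic_minorant_at v c"
  shows "v 0 \<le> (1 / (2 * pi)) * integral {0..2*pi} (\<lambda>t. v (cis t))"
proof (rule field_le_epsilon)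
  fix e :: real assume "e > 0"
  have "continuous_on (sphere 0 1) v"
    by (rule continuous_on_subset[OF cont]) auto
  then obtain p where p: "\<And>z. cmod z = 1 \<Longrightarrow> \<bar>v z - Re (poly p z)\<bar> < e/2"
    using approx_on_circle_by_Re_poly[of v "e/2"] \<open>e > 0\<close> by auto
  have 1: "v 0 - Re (poly p 0) \<le> e/2"
  proof (rule harmonic_minorant_max_principle[OF cont minor])
    show "v z - Re (poly p z) \<le> e/2" if "cmod z = 1" for z
      using p[OF that] by linarith
  qed
  have int: "((\<lambda>t. Re (poly p (cis t))) has_integral (2 * pi * Re (poly p 0))) {0..2*pi}"
    using Re_holomorphic_mean_value[of "poly p" 0 2 1] holomorphic_on_subset[of "poly p" UNIV]
    by (simp add: holomorphic_on_def field_differentiable_def) (meson poly_DERIV)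
  have "continuous_on {0..2*pi} (\<lambda>t. v (cis t))"
    by (rule continuous_on_compose2[OF cont]) (auto intro!: continuous_intros)
  then have vi: "((\<lambda>t. v (cis t) + e/2) has_integral (integral {0..2*pi} (\<lambda>t. v (cis t)) + e/2 * (2*pi))) {0..2*pi}"
    using has_integral_const_real[of "e/2" 0 "2*pi"]
    by (intro has_integral_add integrable_integral integrable_continuous_real) (auto simp: mult_ac)
  have "2 * pi * Re (poly p 0) \<le> integral {0..2*pi} (\<lambda>t. v (cis t)) + e/2 * (2*pi)"
    by (rule has_integral_le[OF int vi]) (smt (verit) p norm_cis field_sum_of_halves)
  then have "Re (poly p 0) \<le> (1 / (2 * pi)) * integral {0..2*pi} (\<lambda>t. v (cis t)) + e/2"
    by (simp add: field_simps)
  with 1 show "v 0 \<le> (1 / (2 * pi)) * integral {0..2*pi} (\<lambda>t. v (cis t)) + e" by linarith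
qed

section \<open>Holomorphic functions and plurisubharmonic functions of several variables\<close>

definition holo_fun_on :: "(complex^'n::finite \<Rightarrow> complex) \<Rightarrow> (complex^'n) set \<Rightarrow> bool" where
  "holo_fun_on f S \<longleftrightarrow>
     (\<forall>z\<in>S. \<exists>f'. (f has_derivative f') (at z) \<and> (\<forall>c v. f' (c *s v) = c * f' v))"

lemma holo_fun_on_subset: "holo_fun_on f S \<Longrightarrow> T \<subseteq> S \<Longrightarrow> holo_fun_on f T"
  by (auto simp: holo_fun_on_def)

lemma holo_map_on_subset: "holo_map_on f S \<Longrightarrow> T \<subseteq> S \<Longrightarrow> holo_map_on f T"
  by (auto simp: holo_map_on_def)

lemma holo_fun_on_const: "holo_fun_on (\<lambda>z. c) S"
  unfolding holo_fun_on_def by (intro ballI exI[of _ "\<lambda>v. 0"]) auto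

lemma holo_fun_on_add:
  assumes "holo_fun_on f S" "holo_fun_on g S"
  shows "holo_fun_on (\<lambda>z. f z + g z) S"
  unfolding holo_fun_on_def
proof
  fix z assume "z \<in> S"
  then obtain f' g' where "(f has_derivative f') (at z)" "\<forall>c v. f' (c *s v) = c * f' v"
      "(g has_derivative g') (at z)" "\<forall>c v. g' (c *s v) = c * g' v"
    using assms unfolding holo_fun_on_def by meson
  then show "\<exists>h'. ((\<lambda>z. f z + g z) has_derivative h') (at z) \<and> (\<forall>c v. h' (c *s v) = c * h' v)"
    by (intro exI[of _ "\<lambda>v. f' v + g' v"] conjI has_derivative_add) (auto simp: algebra_simps)
qed

lemma holo_fun_on_compose_field:
  assumes f: "holo_fun_on f S" and g: "\<And>z. z \<in> S \<Longrightarrow> g field_differentiable (at (f z))"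
  shows "holo_fun_on (\<lambda>z. g (f z)) S"
  unfolding holo_fun_on_def
proof
  fix z assume z: "z \<in> S"
  obtain f' where f': "(f has_derivative f') (at z)" "\<forall>c v. f' (c *s v) = c * f' v"
    using f z unfolding holo_fun_on_def by meson
  obtain d where "(g has_field_derivative d) (at (f z))"
    using g[OF z] unfolding field_differentiable_def by blast
  then have "(g has_derivative (\<lambda>x. d * x)) (at (f z))" by (simp add: has_field_derivative_def)
  from has_derivative_compose[OF f'(1) this]
  show "\<exists>h'. ((\<lambda>z. g (f z)) has_derivative h') (at z) \<and> (\<forall>c v. h' (c *s v) = c * h' v)"
    using f'(2) by (intro exI[of _ "\<lambda>v. d * f' v"]) auto
qed

lemma holo_fun_on_cmult: "holo_fun_on f S \<Longrightarrow> holo_fun_on (\<lambda>z. c * f z) S"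
  by (rule holo_fun_on_compose_field[where g = "\<lambda>w. c * w"]) (auto intro!: derivative_intros)

lemma holo_fun_on_compose_map:
  assumes "holo_fun_on f T" and "holo_map_on g S" and "g ` S \<subseteq> T"
  shows "holo_fun_on (\<lambda>z. f (g z)) S"
  unfolding holo_fun_on_def
proof
  fix z assume z: "z \<in> S"
  obtain g' where g': "(g has_derivative g') (at z)" "\<forall>c v. g' (c *s v) = c *s g' v"
    using assms(2) z unfolding holo_map_on_def by meson
  obtain f' where f': "(f has_derivative f') (at (g z))" "\<forall>c v. f' (c *s v) = c * f' v"
    using assms(1,3) z unfolding holo_fun_on_def by blast
  from has_derivative_compose[OF g'(1) f'(1)]
  show "\<exists>h'. ((\<lambda>z. f (g z)) has_derivative h') (at z) \<and> (\<forall>c v. h' (c *s v) = c * h' v)"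
    using f'(2) g'(2) by (intro exI[of _ "\<lambda>v. f' (g' v)"]) auto
qed

lemma continuous_on_holo_map: "holo_map_on f S \<Longrightarrow> continuous_on S f"
  unfolding holo_map_on_def
  by (meson continuous_at_imp_continuous_on has_derivative_continuous)

lemma bounded_linear_scaled_vec: "bounded_linear (\<lambda>c::complex. c *s (w::complex^'n::finite))"
proof -
  have "linear (\<lambda>c::complex. c *s w)"
    by (rule linearI) (auto simp: vec_eq_iff algebra_simps)
  then show ?thesis by (simp add: linear_conv_bounded_linear)
qed

lemma holo_fun_on_line:
  assumes "holo_fun_on f S" and "c \<in> T" and "\<And>\<zeta>. \<zeta> \<in> T \<Longrightarrow> z + \<zeta> *s w \<in> S"
  shows "(\<lambda>\<zeta>. f (z + \<zeta> *s w)) field_differentiable (at c)"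
proof -
  obtain f' where f': "(f has_derivative f') (at (z + c *s w))" "\<forall>c v. f' (c *s v) = c * f' v"
    using assms unfolding holo_fun_on_def by meson
  have "((\<lambda>\<zeta>. z + \<zeta> *s w) has_derivative (\<lambda>\<zeta>. \<zeta> *s w)) (at c)"
    using has_derivative_add[OF has_derivative_const
        bounded_linear_imp_has_derivative[OF bounded_linear_scaled_vec[of w]]] by simp
  from has_derivative_compose[OF this f'(1)] f'(2)
  have "((\<lambda>\<zeta>. f (z + \<zeta> *s w)) has_derivative (\<lambda>\<zeta>. f' w * \<zeta>)) (at c)"
    by (simp add: mult.commute)
  then show ?thesis
    unfolding field_differentiable_def has_field_derivative_def by blast
qed

text \<open>A convenient strengthening of plurisubharmonicity: it is local, stable under maxima and
  holomorphic pull-back, and needs no integrals.\<close>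

definition psh :: "(complex^'n::finite) set \<Rightarrow> (complex^'n \<Rightarrow> real) \<Rightarrow> bool" where
  "psh S u \<longleftrightarrow> continuous_on S u \<and>
     (\<forall>z\<in>S. \<exists>F e. 0 < e \<and> holo_fun_on F (ball z e) \<and> Re (F z) = u z \<and>
        (\<forall>y\<in>ball z e. Re (F y) \<le> u y))"

lemma pshD: "psh S u \<Longrightarrow> z \<in> S \<Longrightarrow> \<exists>F e. 0 < e \<and> holo_fun_on F (ball z e) \<and> Re (F z) = u z \<and>
        (\<forall>y\<in>ball z e. Re (F y) \<le> u y)"
  by (auto simp: psh_def)

lemma psh_continuous: "psh S u \<Longrightarrow> continuous_on S u"
  by (auto simp: psh_def)

lemma psh_subset: "psh S u \<Longrightarrow> T \<subseteq> S \<Longrightarrow> psh T u"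
  unfolding psh_def by (meson continuous_on_subset subsetD)

lemma psh_const: "psh S (\<lambda>z. c)"
  unfolding psh_def
  by (auto intro!: exI[of _ "\<lambda>z. of_real c"] exI[of _ 1] holo_fun_on_const)

lemma psh_add:
  assumes "psh S u" "psh S v"
  shows "psh S (\<lambda>z. u z + v z)"
  unfolding psh_def
proof (intro conjI ballI)
  show "continuous_on S (\<lambda>z. u z + v z)"
    using assms by (auto intro: continuous_intros psh_continuous)
  fix z assume "z \<in> S"
  then obtain F e G d where *: "0 < e" "holo_fun_on F (ball z e)" "Re (F z) = u z"
     "\<forall>y\<in>ball z e. Re (F y) \<le> u y" "0 < d" "holo_fun_on G (ball z d)" "Re (G z) = v z"
     "\<forall>y\<in>ball z d. Re (G y) \<le> v y"
    using pshD[OF assms(1), of z] pshD[OF assms(2), of z] by blast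
  then show "\<exists>F e. 0 < e \<and> holo_fun_on F (ball z e) \<and> Re (F z) = u z + v z \<and>
        (\<forall>y\<in>ball z e. Re (F y) \<le> u y + v y)"
    by (intro exI[of _ "\<lambda>y. F y + G y"] exI[of _ "min e d"] conjI holo_fun_on_add)
       (auto intro: add_mono elim: holo_fun_on_subset)
qed

lemma psh_cmult:
  assumes "psh S u" "0 \<le> c"
  shows "psh S (\<lambda>z. c * u z)"
  unfolding psh_def
proof (intro conjI ballI)
  show "continuous_on S (\<lambda>z. c * u z)"
    using assms by (auto intro: continuous_intros psh_continuous)
  fix z assume "z \<in> S"
  then obtain F e where *: "0 < e" "holo_fun_on F (ball z e)" "Re (F z) = u z"
     "\<forall>y\<in>ball z e. Re (F y) \<le> u y"
    using pshD[OF assms(1), of z] by blast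
  then show "\<exists>F e. 0 < e \<and> holo_fun_on F (ball z e) \<and> Re (F z) = c * u z \<and>
        (\<forall>y\<in>ball z e. Re (F y) \<le> c * u y)"
    using assms(2) by (intro exI[of _ "\<lambda>y. of_real c * F y"] exI[of _ "e"] conjI holo_fun_on_cmult)
       (auto intro: mult_left_mono)
qed

text \<open>At each point one of the two functions attains the maximum, and its support function
  also stays below the maximum.\<close>

lemma psh_max:
  assumes "psh S u" "psh S v"
  shows "psh S (\<lambda>z. max (u z) (v z))"
  unfolding psh_def
proof (intro conjI ballI)
  show "continuous_on S (\<lambda>z. max (u z) (v z))"
    using assms by (auto intro: continuous_on_max psh_continuous)
  fix z assume z: "z \<in> S"
  obtain w where w: "psh S w" "max (u z) (v z) = w z" "\<And>y. w y \<le> max (u y) (v y)"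
    using assms by (cases "v z \<le> u z") (auto simp: max_def intro: that)
  obtain F e where "0 < e" "holo_fun_on F (ball z e)" "Re (F z) = w z"
     "\<forall>y\<in>ball z e. Re (F y) \<le> w y"
    using pshD[OF w(1) z] by blast
  then show "\<exists>F e. 0 < e \<and> holo_fun_on F (ball z e) \<and> Re (F z) = max (u z) (v z) \<and>
        (\<forall>y\<in>ball z e. Re (F y) \<le> max (u y) (v y))"
    using w(2) by (intro exI[of _ F] exI[of _ e] conjI ballI order_trans[OF _ w(3)]) auto
qed

lemma psh_local:
  assumes "\<And>z. z \<in> S \<Longrightarrow> \<exists>N w. open N \<and> z \<in> N \<and> psh N w \<and> (\<forall>y\<in>N. u y = w y)"
  shows "psh S u"
  unfolding psh_def
proof (intro conjI ballI)
  show "continuous_on S u"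
  proof (rule continuous_at_imp_continuous_on, rule ballI)
    fix z assume "z \<in> S"
    from assms[OF this] obtain N w where N: "open N" "z \<in> N" "psh N w" "\<forall>y\<in>N. u y = w y" by blast
    then have "continuous_on N u" by (metis continuous_on_eq psh_continuous)
    then show "isCont u z" using N(1,2) by (simp add: continuous_on_eq_continuous_at)
  qed
  fix z assume "z \<in> S"
  from assms[OF this] obtain N w where N: "open N" "z \<in> N" "psh N w" "\<forall>y\<in>N. u y = w y" by blast
  obtain F e where *: "0 < e" "holo_fun_on F (ball z e)" "Re (F z) = w z"
     "\<forall>y\<in>ball z e. Re (F y) \<le> w y"
    using pshD[OF N(3,2)] by blast
  obtain d where "d > 0" "ball z d \<subseteq> N" using N(1,2) open_contains_ball by metis
  then show "\<exists>F e. 0 < e \<and> holo_fun_on F (ball z e) \<and> Re (F z) = u z \<and>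
        (\<forall>y\<in>ball z e. Re (F y) \<le> u y)"
    using * N(2,4) by (intro exI[of _ F] exI[of _ "min e d"]) (auto elim: holo_fun_on_subset)
qed

lemma psh_compose_holo_map:
  assumes u: "psh T u" and g: "holo_map_on g S" "g ` S \<subseteq> T" "open S"
  shows "psh S (\<lambda>z. u (g z))"
  unfolding psh_def
proof (intro conjI ballI)
  have cg: "continuous_on S g" by (rule continuous_on_holo_map[OF g(1)])
  show "continuous_on S (\<lambda>z. u (g z))"
    by (rule continuous_on_compose2[OF psh_continuous[OF u] cg g(2)])
  fix z assume z: "z \<in> S"
  then have "g z \<in> T" using g by auto
  from pshD[OF u this] obtain F e where *: "0 < e" "holo_fun_on F (ball (g z) e)" "Re (F (g z)) = u (g z)"
     "\<forall>y\<in>ball (g z) e. Re (F y) \<le> u y" by blast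
  have "open (S \<inter> g -` ball (g z) e)" by (rule continuous_open_preimage[OF cg g(3)]) simp
  moreover have "z \<in> S \<inter> g -` ball (g z) e" using \<open>0 < e\<close> z by simp
  ultimately obtain d where d: "d > 0" "ball z d \<subseteq> S \<inter> g -` ball (g z) e"
    by (rule openE)
  have "holo_fun_on (\<lambda>y. F (g y)) (ball z d)"
    by (rule holo_fun_on_compose_map[OF *(2) holo_map_on_subset[OF g(1)]]) (use d in auto)
  then show "\<exists>F e. 0 < e \<and> holo_fun_on F (ball z e) \<and> Re (F z) = u (g z) \<and>
        (\<forall>y\<in>ball z e. Re (F y) \<le> u (g y))"
    using * d by (intro exI[of _ "\<lambda>y. F (g y)"] exI[of _ d]) auto
qed

text \<open>Restricted to a complex line, a holomorphic support function becomes a harmonic minorant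
  in one variable.\<close>

lemma psh_imp_cont_psh:
  fixes u :: "complex^'n::finite \<Rightarrow> real"
  assumes "psh V u"
  shows "cont_psh V u"
  unfolding cont_psh_def
proof (intro conjI allI impI)
  show cu: "continuous_on V u" by (rule psh_continuous[OF assms])
  fix z w :: "complex^'n" assume disc: "\<forall>\<zeta>. cmod \<zeta> \<le> 1 \<longrightarrow> z + \<zeta> *s w \<in> V"
  define v where "v = (\<lambda>\<zeta>. u (z + \<zeta> *s w))"
  have cl: "continuous_on A (\<lambda>\<zeta>. z + \<zeta> *s w)" for A
    by (intro continuous_on_add continuous_on_const linear_continuous_on bounded_linear_scaled_vec)
  have "v 0 \<le> (1 / (2 * pi)) * integral {0..2*pi} (\<lambda>t. v (cis t))"
  proof (rule harmonic_minorant_submean)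
    show "continuous_on (cball 0 1) v"
      unfolding v_def
    proof (rule continuous_on_compose2[OF cu cl], rule image_subsetI)
      show "z + \<zeta> *s w \<in> V" if "\<zeta> \<in> cball 0 1" for \<zeta> using disc that by simp
    qed
    fix c :: complex assume c: "c \<in> ball 0 1"
    then have zV: "z + c *s w \<in> V" using disc by simp
    from pshD[OF assms this] obtain F e where *: "0 < e" "holo_fun_on F (ball (z + c *s w) e)"
      "Re (F (z + c *s w)) = u (z + c *s w)" "\<forall>y\<in>ball (z + c *s w) e. Re (F y) \<le> u y" by blast
    have "open ((\<lambda>\<zeta>. z + \<zeta> *s w) -` ball (z + c *s w) e)"
      by (rule open_vimage[OF _ cl]) simp
    moreover have "c \<in> (\<lambda>\<zeta>. z + \<zeta> *s w) -` ball (z + c *s w) e" using \<open>0 < e\<close> by simp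
    ultimately obtain d where d: "d > 0" "ball c d \<subseteq> (\<lambda>\<zeta>. z + \<zeta> *s w) -` ball (z + c *s w) e"
      by (rule openE)
    have "(\<lambda>\<zeta>. F (z + \<zeta> *s w)) holomorphic_on ball c d"
      unfolding holomorphic_on_def
    proof (rule ballI, rule field_differentiable_at_within)
      fix x assume x: "x \<in> ball c d"
      show "(\<lambda>\<zeta>. F (z + \<zeta> *s w)) field_differentiable (at x)"
        by (rule holo_fun_on_line[OF *(2) x]) (use d(2) in blast)
    qed
    then show "harmonic_minorant_at v c"
      unfolding harmonic_minorant_at_def v_def
    proof (intro exI conjI ballI)
      show "Re (F (z + \<zeta> *s w)) \<le> u (z + \<zeta> *s w)" if "\<zeta> \<in> ball c d" for \<zeta>
        using *(4) d(2) that by blast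
    qed (use d(1) *(3) in simp_all)
  qed
  moreover have "v 0 = u z" by (simp add: v_def)
  ultimately show "u z \<le> 1 / (2 * pi) * integral {0..2 * pi} (\<lambda>\<theta>. u (z + cis \<theta> *s w))"
    unfolding v_def by (simp only:)
qed

section \<open>Holomorphic linear and quadratic forms, and the basic plurisubharmonic
  functions\<close>

lemma holo_fun_on_linear:
  assumes "bounded_linear f" "\<And>c v. f (c *s v) = c * f v"
  shows "holo_fun_on f S"
  unfolding holo_fun_on_def using bounded_linear_imp_has_derivative[OF assms(1)] assms(2) by blast

lemma bounded_linear_i_scale: "bounded_linear (\<lambda>v::complex^'n::finite. \<i> *s v)"
proof -
  have "linear (\<lambda>v::complex^'n. \<i> *s v)"
    by (rule linearI) (auto simp: vec_eq_iff algebra_simps)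
  then show ?thesis by (simp add: linear_conv_bounded_linear)
qed

lemma scale_Re_Im: "c *s v = Re c *\<^sub>R v + Im c *\<^sub>R (\<i> *s (v::complex^'n::finite))"
  by (auto simp: vec_eq_iff complex_eq_iff)

lemma norm_i_scale: "norm (\<i> *s (v::complex^'n::finite)) = norm v"
  by (simp add: norm_vec_def norm_mult)

lemma i_scale_i_scale: "\<i> *s (\<i> *s v) = - (v::complex^'n::finite)"
  by (simp add: vec_eq_iff flip: mult.assoc)

text \<open>A real linear l is the real part of the complex linear functional l v - i l (i v). In
  this way first-order Taylor polynomials of real functions become holomorphic support
  functions.\<close>

lemma linear_Re_holo:
  fixes l :: "complex^'n::finite \<Rightarrow> real"
  assumes "bounded_linear l"
  shows "holo_fun_on (\<lambda>v. Complex (l v) (- l (\<i> *s v))) S"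
proof (rule holo_fun_on_linear)
  interpret l: bounded_linear l by fact
  have 1: "bounded_linear (\<lambda>v. l (\<i> *s v))"
    using bounded_linear_compose[OF assms bounded_linear_i_scale] .
  have "(\<lambda>v. Complex (l v) (- l (\<i> *s v))) = (\<lambda>v. of_real (l v) + \<i> * of_real (- l (\<i> *s v)))"
    by (auto simp: complex_eq_iff)
  moreover have "bounded_linear (\<lambda>v. of_real (l v) + \<i> * of_real (- l (\<i> *s v)) :: complex)"
    using bounded_linear_compose[OF bounded_linear_of_real assms]
      bounded_linear_compose[OF bounded_linear_of_real 1]
    by (intro bounded_linear_add bounded_linear_const_mult) (auto intro: bounded_linear_minus)
  ultimately show "bounded_linear (\<lambda>v. Complex (l v) (- l (\<i> *s v)))" by simp
  show "Complex (l (c *s v)) (- l (\<i> *s (c *s v))) = c * Complex (l v) (- l (\<i> *s v))" for c v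
  proof -
    have "\<i> *s (c *s v) = Re c *\<^sub>R (\<i> *s v) - Im c *\<^sub>R v"
      by (auto simp: vec_eq_iff complex_eq_iff)
    then show ?thesis
      by (subst scale_Re_Im) (auto simp: complex_eq_iff l.add l.diff l.scaleR)
  qed
qed

text \<open>A real quadratic form \<open>h\<close> with \<open>h (\<i> v) = - h v\<close> is the real part of a complex quadratic form.\<close>

definition complexify :: "(complex^'n::finite \<Rightarrow> complex^'n \<Rightarrow> real) \<Rightarrow> complex^'n \<Rightarrow> complex" where
  "complexify H v = Complex (H v v) (- H v (\<i> *s v))"

text \<open>Invariance of H up to sign under J lets i move from one argument to the other
  (\<open>sJ\<close>). Hence H v w - i H v (i w) is symmetric and complex bilinear, and
  \<open>complexify H\<close> is its diagonal.\<close>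

lemma holo_fun_on_complexify:
  fixes H :: "complex^'n::finite \<Rightarrow> complex^'n \<Rightarrow> real"
  assumes H: "bounded_bilinear H" and sym: "\<And>v w. H v w = H w v"
    and J: "\<And>v w. H (\<i> *s v) (\<i> *s w) = - H v w"
  shows "holo_fun_on (complexify H) S"
  unfolding holo_fun_on_def
proof
  fix z :: "complex^'n"
  interpret H: bounded_bilinear H by fact
  have sJ: "H x (\<i> *s y) = H (\<i> *s x) y" for x y
    using J[of "\<i> *s x" y] by (simp add: i_scale_i_scale H.minus_left)
  define D where "D v = 2 * Complex (H z v) (- H z (\<i> *s v))" for v
  note Hd = bounded_bilinear.FDERIV[OF H]
  have d1: "((\<lambda>v. H v v) has_derivative (\<lambda>v. 2 * H z v)) (at z)"
    using Hd[OF has_derivative_ident has_derivative_ident, of z UNIV] sym[of _ z] by simp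
  have "((\<lambda>v. H v (\<i> *s v)) has_derivative (\<lambda>v. H z (\<i> *s v) + H v (\<i> *s z))) (at z)"
    by (rule Hd[OF has_derivative_ident bounded_linear_imp_has_derivative[OF bounded_linear_i_scale]])
  then have d2: "((\<lambda>v. H v (\<i> *s v)) has_derivative (\<lambda>v. 2 * H z (\<i> *s v))) (at z)"
    by (simp add: sJ sym[of _ z] sym[of _ "\<i> *s z"])
  have "((\<lambda>v. of_real (H v v) + \<i> * of_real (- H v (\<i> *s v)) :: complex) has_derivative
      (\<lambda>v. of_real (2 * H z v) + \<i> * of_real (- (2 * H z (\<i> *s v))))) (at z)"
    by (intro derivative_intros d1 d2)
  moreover have "(\<lambda>v. of_real (H v v) + \<i> * of_real (- H v (\<i> *s v)) :: complex) = complexify H"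
    by (auto simp: complex_eq_iff complexify_def)
  moreover have "(\<lambda>v. of_real (2 * H z v) + \<i> * of_real (- (2 * H z (\<i> *s v)))) = D"
    by (auto simp: complex_eq_iff D_def)
  ultimately have "(complexify H has_derivative D) (at z)" by simp
  moreover have "D (c *s v) = c * D v" for c v
  proof -
    have 1: "H z (c *s v) = Re c * H z v + Im c * H z (\<i> *s v)"
      by (subst scale_Re_Im) (simp add: H.add_right H.scaleR_right)
    have "\<i> *s (c *s v) = Re c *\<^sub>R (\<i> *s v) - Im c *\<^sub>R v"
      by (auto simp: vec_eq_iff complex_eq_iff)
    then have 2: "H z (\<i> *s (c *s v)) = Re c * H z (\<i> *s v) - Im c * H z v"
      by (simp only: H.diff_right H.scaleR_right real_scaleR_def)
    show ?thesis unfolding D_def 1 2 by (simp add: complex_eq_iff algebra_simps)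
  qed
  ultimately show "\<exists>f'. (complexify H has_derivative f') (at z) \<and> (\<forall>c v. f' (c *s v) = c * f' v)"
    by blast
qed

lemma holo_fun_on_translate:
  assumes "\<And>S. holo_fun_on f S"
  shows "holo_fun_on (\<lambda>y. f (y - z)) S"
proof (rule holo_fun_on_compose_map[OF assms[of UNIV]])
  show "holo_map_on (\<lambda>y. y - z) S"
    unfolding holo_map_on_def by (intro ballI exI[of _ "\<lambda>v. v"]) (auto intro!: derivative_eq_intros)
qed auto

text \<open>The support function is the first-order Taylor polynomial, since the remainder |y - z|^2
  is nonnegative.\<close>

lemma psh_norm_sq: "psh S (\<lambda>z. (norm (z - q))\<^sup>2)"
  unfolding psh_def
proof (intro conjI ballI)
  show "continuous_on S (\<lambda>z. (norm (z - q))\<^sup>2)" by (intro continuous_intros)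
  fix z assume "z \<in> S"
  define l where "l v = 2 * (v \<bullet> (z - q))" for v
  have "bounded_linear l" unfolding l_def
    by (intro bounded_linear_const_mult bounded_linear_inner_left)
  then have "holo_fun_on (\<lambda>y. Complex (l (y - z)) (- l (\<i> *s (y - z)))) (ball z 1)"
    by (intro holo_fun_on_translate linear_Re_holo)
  then have "holo_fun_on (\<lambda>y. of_real ((norm (z - q))\<^sup>2) + Complex (l (y - z)) (- l (\<i> *s (y - z)))) (ball z 1)"
    by (intro holo_fun_on_add holo_fun_on_const)
  moreover have "(norm (z - q))\<^sup>2 + l (y - z) \<le> (norm (y - q))\<^sup>2" for y
  proof -
    have "(norm (y - q))\<^sup>2 = (norm (z - q))\<^sup>2 + l (y - z) + (norm (y - z))\<^sup>2"
      unfolding l_def power2_norm_eq_inner by (simp add: algebra_simps inner_commute)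
    then show ?thesis by simp
  qed
  moreover have "l 0 = 0" by (simp add: l_def)
  ultimately show "\<exists>F e. 0 < e \<and> holo_fun_on F (ball z e) \<and> Re (F z) = (norm (z - q))\<^sup>2 \<and>
        (\<forall>y\<in>ball z e. Re (F y) \<le> (norm (y - q))\<^sup>2)"
    by (intro exI[of _ "\<lambda>y. of_real ((norm (z - q))\<^sup>2) + Complex (l (y - z)) (- l (\<i> *s (y - z)))"] exI[of _ 1]) auto
qed

lemma continuous_on_holo_fun: "holo_fun_on f S \<Longrightarrow> continuous_on S f"
  unfolding holo_fun_on_def
  by (meson continuous_at_imp_continuous_on has_derivative_continuous)

text \<open>Locally this is the real part of a branch of -log (P - a). Dividing by the value at z
  and shrinking the ball puts the quotient Q in the disc of radius 1 about 1, where the principal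
  branch is holomorphic.\<close>

lemma psh_minus_ln_cmod:
  assumes P: "holo_fun_on P S" and S: "open S" and nz: "\<And>z. z \<in> S \<Longrightarrow> P z \<noteq> a"
  shows "psh S (\<lambda>z. - ln (cmod (P z - a)))"
  unfolding psh_def
proof (intro conjI ballI)
  have cP: "continuous_on S P" by (rule continuous_on_holo_fun[OF P])
  show "continuous_on S (\<lambda>z. - ln (cmod (P z - a)))"
    using nz by (intro continuous_intros cP) auto
  fix z assume z: "z \<in> S"
  define Q where "Q y = (P y - a) / (P z - a)" for y
  have "open (S \<inter> P -` ball (P z) (cmod (P z - a)))"
    by (rule continuous_open_preimage[OF cP S]) simp
  moreover have "z \<in> S \<inter> P -` ball (P z) (cmod (P z - a))" using z nz[OF z] by simp
  ultimately obtain d where d: "d > 0" "ball z d \<subseteq> S \<inter> P -` ball (P z) (cmod (P z - a))"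
    by (rule openE)
  have Q1: "cmod (Q y - 1) < 1" if "y \<in> ball z d" for y
  proof -
    have "Q y - 1 = (P y - P z) / (P z - a)" using nz[OF z] by (simp add: Q_def field_simps)
    moreover have "cmod (P y - P z) < cmod (P z - a)"
      using subsetD[OF d(2) that] by (simp add: dist_norm norm_minus_commute)
    ultimately show ?thesis using nz[OF z] by (simp add: norm_divide)
  qed
  have Qpos: "Re (Q y) > 0" if "y \<in> ball z d" for y
    using Q1[OF that] abs_Re_le_cmod[of "Q y - 1"] by simp
  define F where "F y = of_real (- ln (cmod (P z - a))) + - 1 * Ln (Q y)" for y
  have "holo_fun_on Q (ball z d)"
    unfolding Q_def
    by (rule holo_fun_on_compose_field[where g = "\<lambda>w. (w - a) / (P z - a)", OF holo_fun_on_subset[OF P]])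
       (use d nz[OF z] in \<open>auto intro!: derivative_intros\<close>)
  then have "holo_fun_on (\<lambda>y. Ln (Q y)) (ball z d)"
    by (rule holo_fun_on_compose_field)
       (use Qpos in \<open>force intro!: field_differentiable_at_Ln simp: complex_nonpos_Reals_iff\<close>)
  then have "holo_fun_on F (ball z d)"
    unfolding F_def by (intro holo_fun_on_add holo_fun_on_const holo_fun_on_cmult)
  moreover have "Re (F y) = - ln (cmod (P y - a))" if y: "y \<in> ball z d" for y
  proof -
    have "Q y \<noteq> 0" using Qpos[OF y] by auto
    moreover have "P y \<noteq> a" using d y nz[of y] by blast
    ultimately show ?thesis using nz[OF z] by (simp add: F_def Q_def norm_divide ln_div)
  qed
  ultimately show "\<exists>F e. 0 < e \<and> holo_fun_on F (ball z e) \<and> Re (F z) = - ln (cmod (P z - a)) \<and>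
        (\<forall>y\<in>ball z e. Re (F y) \<le> - ln (cmod (P y - a)))"
    using d by (intro exI[of _ F] exI[of _ d]) auto
qed

section \<open>Hulls and Kallin's lemma\<close>

text \<open>The supremum over K is replaced by a value on K, which is the same for compact nonempty
  K in B because the functions are continuous. Testing only functions of the class
  \<open>psh\<close> makes this hull at least as large as the one with all continuous p.s.h.
  functions, so it suffices to show that this one is small.\<close>

definition hull_in :: "(complex^'n::finite) set \<Rightarrow> (complex^'n) set \<Rightarrow> (complex^'n) set" where
  "hull_in B K = {q \<in> B. \<forall>u. psh B u \<longrightarrow> (\<exists>x\<in>K. u q \<le> u x)}"

lemma hull_in_superset: "K \<subseteq> B \<Longrightarrow> K \<subseteq> hull_in B K"
  by (auto simp: hull_in_def)

lemma compact_max_point: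
  fixes u :: "'a::topological_space \<Rightarrow> real"
  assumes "compact K" "K \<noteq> {}" "continuous_on B u" "K \<subseteq> B"
  obtains x where "x \<in> K" "\<And>y. y \<in> K \<Longrightarrow> u y \<le> u x"
  using continuous_attains_sup[OF assms(1,2) continuous_on_subset[OF assms(3,4)]] that by blast

lemma psh_separating:
  assumes K: "compact K" "K \<noteq> {}" "K \<subseteq> B" and y: "y \<in> B" "y \<notin> hull_in B K"
  obtains v where "psh B v" "\<And>x. x \<in> K \<Longrightarrow> v x \<le> 0" "0 < v y"
proof -
  obtain u where u: "psh B u" "\<And>x. x \<in> K \<Longrightarrow> u x < u y"
    using y unfolding hull_in_def by force
  obtain m where m: "m \<in> K" "\<And>x. x \<in> K \<Longrightarrow> u x \<le> u m"
    using compact_max_point[OF K(1,2) psh_continuous[OF u(1)] K(3)] by blast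
  show thesis
    by (rule that[of "\<lambda>z. u z + - u m", OF psh_add[OF u(1) psh_const]]) (use u m in auto)
qed

text \<open>Each point of C has a separating function that is positive on an open neighbourhood;
  finitely many of these cover C, and their maximum with 0 is \<phi>.\<close>

lemma psh_separating_compact:
  assumes B: "open B" and K: "compact K" "K \<noteq> {}" "K \<subseteq> B"
    and C: "compact C" "C \<subseteq> B" "C \<inter> hull_in B K = {}"
  obtains \<phi> where "psh B \<phi>" "\<And>x. x \<in> K \<Longrightarrow> \<phi> x = 0" "\<And>z. 0 \<le> \<phi> z" "\<And>y. y \<in> C \<Longrightarrow> 0 < \<phi> y"
proof -
  define V where "V = {v. psh B v \<and> (\<forall>x\<in>K. v x \<le> 0)}"
  have opn: "open (B \<inter> v -` {0<..})" if "v \<in> V" for v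
    by (rule continuous_open_preimage) (use that B psh_continuous in \<open>auto simp: V_def\<close>)
  have cov: "C \<subseteq> (\<Union>v\<in>V. B \<inter> v -` {0<..})"
  proof
    fix y assume "y \<in> C"
    then have "y \<in> B" "y \<notin> hull_in B K" using C by auto
    from psh_separating[OF K this] obtain v where "psh B v" "\<And>x. x \<in> K \<Longrightarrow> v x \<le> 0" "0 < v y" by blast
    then show "y \<in> (\<Union>v\<in>V. B \<inter> v -` {0<..})" using \<open>y \<in> B\<close> by (auto simp: V_def)
  qed
  obtain F where F: "F \<subseteq> V" "finite F" "C \<subseteq> (\<Union>v\<in>F. B \<inter> v -` {0<..})"
    using compactE_image[OF C(1) opn cov] by blast
  have "\<exists>\<phi>. psh B \<phi> \<and> (\<forall>x\<in>K. \<phi> x = 0) \<and> (\<forall>z. 0 \<le> \<phi> z) \<and> (\<forall>v\<in>F. \<forall>z. v z \<le> \<phi> z)"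
    using F(2,1)
  proof (induction F rule: finite_induct)
    case empty
    show ?case by (rule exI[of _ "\<lambda>z. 0"]) (auto intro: psh_const)
  next
    case (insert v F)
    then obtain \<phi> where \<phi>: "psh B \<phi>" "\<forall>x\<in>K. \<phi> x = 0" "\<forall>z. 0 \<le> \<phi> z" "\<forall>v\<in>F. \<forall>z. v z \<le> \<phi> z" by blast
    have "psh B (\<lambda>z. max (\<phi> z) (v z))" using insert.prems \<phi>(1) by (auto intro: psh_max simp: V_def)
    moreover have "\<forall>x\<in>K. max (\<phi> x) (v x) = 0" using insert.prems \<phi>(2) by (auto simp: V_def)
    ultimately show ?case using \<phi>(3,4) by (intro exI[of _ "\<lambda>z. max (\<phi> z) (v z)"]) (auto simp: le_max_iff_disj)
  qed
  then obtain \<phi> where \<phi>: "psh B \<phi>" "\<forall>x\<in>K. \<phi> x = 0" "\<forall>z. 0 \<le> \<phi> z" "\<forall>v\<in>F. \<forall>z. v z \<le> \<phi> z" by blast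
  show thesis
  proof (rule that[OF \<phi>(1)])
    fix y assume "y \<in> C"
    then obtain v where "v \<in> F" "0 < v y" using F(3) by auto
    then show "0 < \<phi> y" using \<phi>(4) less_le_trans by blast
  qed (use \<phi> in auto)
qed

text \<open>Only the values near the hull matter: a function that is p.s.h. near the hull can be glued,
  by taking maxima, with a p.s.h. function on \<open>B\<close> that vanishes on \<open>K\<close> and is large away from
  the hull.\<close>

lemma psh_near_hull:
  assumes B: "open B" and K: "compact K" "K \<noteq> {}" "K \<subseteq> B" and X: "compact (hull_in B K)"
    and N: "open N" "hull_in B K \<subseteq> N" "N \<subseteq> B" and u: "psh N u" and q: "q \<in> hull_in B K"
  shows "\<exists>x\<in>K. u q \<le> u x"
proof (rule ccontr)
  assume "\<not> ?thesis"
  then have less: "\<And>x. x \<in> K \<Longrightarrow> u x < u q" by force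
  let ?X = "hull_in B K"
  have KX: "K \<subseteq> ?X" by (rule hull_in_superset[OF K(3)])
  have cu: "continuous_on N u" by (rule psh_continuous[OF u])
  obtain m where m: "m \<in> K" "\<And>x. x \<in> K \<Longrightarrow> u x \<le> u m"
    using compact_max_point[OF K(1,2) cu] KX N by blast
  define s where "s = u m"
  \<comment> \<open>After subtraction of the maximum s on K, the function \<open>u - s\<close> is at
    most 0 on K and positive at q, so the glued function will vanish on K.\<close>
  have sq: "s < u q" using less m by (simp add: s_def)
  have Xne: "?X \<noteq> {}" using q by blast
  obtain d where d: "d > 0" "(\<Union>x\<in>?X. cball x d) \<subseteq> N"
    using compact_subset_open_imp_cball_epsilon_subset[OF X N(1,2)] by auto
  have inN: "z \<in> N" if "infdist z ?X \<le> d" for z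
  proof -
    obtain x where "x \<in> ?X" "infdist z ?X = dist z x"
      using infdist_attains_inf[OF compact_imp_closed[OF X] Xne] by metis
    then have "z \<in> cball x d" using that by (simp add: dist_commute)
    then show ?thesis using d \<open>x \<in> ?X\<close> by blast
  qed
  define C where "C = {z. infdist z ?X = d}"
  have cinf: "continuous_on S (\<lambda>z. infdist z ?X)" for S by (intro continuous_intros)
  have "C \<subseteq> {z. infdist z ?X \<le> d}" by (auto simp: C_def)
  moreover have "compact {z. infdist z ?X \<le> d}"
    by (rule compact_infdist_le[OF Xne X d(1)])
  moreover have "closed C"
    unfolding C_def by (intro closed_Collect_eq cinf continuous_intros)
  ultimately have cC: "compact C" using compact_Int_closed[of "{z. infdist z ?X \<le> d}" C] by (simp add: inf.absorb2)
  have CN: "C \<subseteq> N" using inN by (auto simp: C_def)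
  have CX: "C \<inter> ?X = {}" using d by (auto simp: C_def)
  obtain \<phi> where \<phi>: "psh B \<phi>" "\<And>x. x \<in> K \<Longrightarrow> \<phi> x = 0" "\<And>z. 0 \<le> \<phi> z" "\<And>y. y \<in> C \<Longrightarrow> 0 < \<phi> y"
    using psh_separating_compact[OF B K cC _ CX] CN N(3) by blast
  have c\<phi>: "continuous_on N \<phi>" using psh_continuous[OF \<phi>(1)] N(3) continuous_on_subset by blast
  have "\<exists>M\<ge>0. \<forall>y\<in>C. u y - s < M * \<phi> y"
  proof (cases "C = {}")
    case False
    have "continuous_on C (\<lambda>y. (u y - s) / \<phi> y)"
      by (intro continuous_intros continuous_on_subset[OF cu CN] continuous_on_subset[OF c\<phi> CN])
         (use \<phi>(4) in force)
    then obtain y0 where y0: "y0 \<in> C" "\<And>y. y \<in> C \<Longrightarrow> (u y - s) / \<phi> y \<le> (u y0 - s) / \<phi> y0"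
      using continuous_attains_sup[OF cC False] by blast
    define M where "M = max 0 ((u y0 - s) / \<phi> y0) + 1"
    have "u y - s < M * \<phi> y" if "y \<in> C" for y
    proof -
      have "(u y - s) / \<phi> y < M" using y0(2)[OF that] by (simp add: M_def)
      then show ?thesis using \<phi>(4)[OF that] by (simp add: field_simps)
    qed
    moreover have "M \<ge> 0" by (simp add: M_def)
    ultimately show ?thesis by blast
  qed auto
  then obtain M where M: "M \<ge> 0" "\<And>y. y \<in> C \<Longrightarrow> u y - s < M * \<phi> y" by blast
  \<comment> \<open>On \<open>C\<close>, the set at distance exactly d from the hull,
    \<open>M * \<phi>\<close> strictly exceeds \<open>u - s\<close>. So near \<open>C\<close> the
    maximum already equals \<open>M * \<phi>\<close> and the two branches fit together.\<close>
  define w where "w z = (if infdist z ?X < d then max (u z - s) (M * \<phi> z) else M * \<phi> z)" for z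
  have pM: "psh B (\<lambda>z. M * \<phi> z)" by (rule psh_cmult[OF \<phi>(1) M(1)])
  have "psh B w"
  proof (rule psh_local)
    fix z assume z: "z \<in> B"
    consider "infdist z ?X < d" | "infdist z ?X > d" | "z \<in> C" by (force simp: C_def)
    then show "\<exists>N w'. open N \<and> z \<in> N \<and> psh N w' \<and> (\<forall>y\<in>N. w y = w' y)"
    proof cases
      case 1
      let ?N = "{z. infdist z ?X < d}"
      have sub: "?N \<subseteq> N" using inN by auto
      have "open ?N" by (intro open_Collect_less cinf continuous_intros)
      moreover have "psh ?N (\<lambda>z. max (u z + - s) (M * \<phi> z))"
        by (intro psh_max psh_add psh_const psh_subset[OF u sub] psh_subset[OF pM]) (use sub N in auto)
      ultimately show ?thesis using 1
        by (intro exI[of _ ?N] exI[of _ "\<lambda>z. max (u z + - s) (M * \<phi> z)"]) (auto simp: w_def)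
    next
      case 2
      let ?N = "{z. infdist z ?X > d} \<inter> B"
      have "open ?N" by (intro open_Int B open_Collect_less cinf continuous_intros)
      then show ?thesis using 2 z psh_subset[OF pM, of ?N]
        by (intro exI[of _ ?N] exI[of _ "\<lambda>z. M * \<phi> z"]) (auto simp: w_def)
    next
      case 3
      let ?N = "N \<inter> (\<lambda>y. M * \<phi> y - (u y - s)) -` {0<..}"
      have "open ?N"
        by (rule continuous_open_preimage) (auto intro!: continuous_intros c\<phi> cu N(1))
      then show ?thesis using 3 M(2)[OF 3] CN N(3) psh_subset[OF pM, of ?N]
        by (intro exI[of _ ?N] exI[of _ "\<lambda>z. M * \<phi> z"]) (auto simp: w_def)
    qed
  qed
  then obtain x where x: "x \<in> K" "w q \<le> w x" using q unfolding hull_in_def by blast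
  have inf0: "infdist y ?X < d" if "y \<in> ?X" for y using that d by simp
  have "w x = max (u x - s) 0" using x(1) KX inf0 \<phi>(2) by (auto simp: w_def)
  then have "w x = 0" using m(2)[OF x(1)] by (simp add: s_def)
  moreover have "w q \<ge> u q - s" using inf0[OF q] by (simp add: w_def)
  ultimately show False using x(2) sq by simp
qed

text \<open>The squared norm is p.s.h. and keeps the hull in a closed concentric ball of smaller
  radius; within the open ball the hull is closed by continuity of the test functions.\<close>

lemma compact_hull_in_ball:
  fixes K :: "(complex^'n::finite) set"
  assumes K: "compact K" "K \<noteq> {}" "K \<subseteq> ball 0 R"
  shows "compact (hull_in (ball 0 R) K)"
proof -
  obtain m where m: "m \<in> K" "\<And>x. x \<in> K \<Longrightarrow> norm x \<le> norm m"
    using continuous_attains_sup[OF K(1,2), of norm] continuous_on_norm_id by blast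
  define \<delta> where "\<delta> = norm m"
  have \<delta>: "\<delta> < R" using m K by (auto simp: \<delta>_def)
  have sub: "hull_in (ball 0 R) K \<subseteq> cball 0 \<delta>"
  proof
    fix q assume "q \<in> hull_in (ball 0 R) K"
    then obtain x where "x \<in> K" "(norm (q - 0))\<^sup>2 \<le> (norm (x - 0))\<^sup>2"
      using psh_norm_sq[of "ball 0 R" 0] unfolding hull_in_def by blast
    then show "q \<in> cball 0 \<delta>" using m(2)[of x] by (simp add: \<delta>_def)
  qed
  have "closed (hull_in (ball 0 R) K)"
  proof (subst closed_sequential_limits, intro allI impI)
    fix f q assume f: "(\<forall>n. f n \<in> hull_in (ball 0 R) K) \<and> f \<longlonglongrightarrow> q"
    then have "q \<in> cball 0 \<delta>"
      using closed_sequentially[OF closed_cball, of f 0 \<delta> q] sub by blast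
    then have qB: "q \<in> ball 0 R" using \<delta> by simp
    show "q \<in> hull_in (ball 0 R) K" unfolding hull_in_def
    proof (intro CollectI conjI qB allI impI)
      fix u :: "complex^'n \<Rightarrow> real" assume u: "psh (ball 0 R) u"
      obtain k where k: "k \<in> K" "\<And>x. x \<in> K \<Longrightarrow> u x \<le> u k"
        using compact_max_point[OF K(1,2) psh_continuous[OF u] K(3)] by blast
      have "isCont u q" using psh_continuous[OF u] qB by (simp add: continuous_on_eq_continuous_at)
      then have "(\<lambda>n. u (f n)) \<longlonglongrightarrow> u q" using f isCont_tendsto_compose by blast
      moreover have "u (f n) \<le> u k" for n
        using f u k(2) unfolding hull_in_def by (blast intro: order_trans)
      ultimately have "u q \<le> u k" by (intro LIMSEQ_le_const2) auto
      then show "\<exists>x\<in>K. u q \<le> u x" using k(1) by blast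
    qed
  qed
  then show ?thesis using sub compact_cball by (metis closed_Int_compact inf.absorb1)
qed

section \<open>Kallin's lemma by means of logarithmic poles on the imaginary axis\<close>

lemma sector_distance:
  fixes w :: complex
  assumes "c > 0" "c \<le> 1" "t \<noteq> 0" "c * cmod w \<le> \<bar>Re w\<bar>"
  shows "c / 2 * \<bar>t\<bar> \<le> cmod (w - Complex 0 t)"
\<comment> \<open>For large w the real part alone gives the distance from the axis, by the sector
  condition; for small w the point it is far away by the triangle inequality.\<close>
proof (cases "\<bar>t\<bar> / 2 \<le> cmod w")
  case True
  have "c / 2 * \<bar>t\<bar> \<le> c * cmod w" using True assms(1) by (simp add: field_simps)
  also have "\<dots> \<le> \<bar>Re (w - Complex 0 t)\<bar>" using assms(4) by simp
  also have "\<dots> \<le> cmod (w - Complex 0 t)" by (rule abs_Re_le_cmod)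
  finally show ?thesis .
next
  case False
  have "cmod (Complex 0 t) = \<bar>t\<bar>" by (simp add: cmod_def)
  then have "\<bar>t\<bar> / 2 \<le> cmod (w - Complex 0 t)"
    using False norm_triangle_ineq2[of "Complex 0 t" w] by (simp add: norm_minus_commute)
  moreover have "c / 2 * \<bar>t\<bar> \<le> \<bar>t\<bar> / 2" using assms by (simp add: mult_left_le_one_le)
  ultimately show ?thesis by linarith
qed

text \<open>The test function is singular on the fibre P = a, but that fibre misses the hull, so
  being p.s.h. near the hull is enough.\<close>

lemma hull_in_dist_image:
  assumes K: "compact K" "K \<noteq> {}" "K \<subseteq> ball 0 R" and P: "holo_fun_on P (ball 0 R)"
    and a: "a \<notin> P ` hull_in (ball 0 R) K" and q: "q \<in> hull_in (ball 0 R) K"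
    and M: "0 \<le> M"
  shows "\<exists>x\<in>K. M * (norm q)\<^sup>2 - ln (cmod (P q - a)) \<le> M * (norm x)\<^sup>2 - ln (cmod (P x - a))"
proof -
  define N where "N = ball 0 R \<inter> P -` (- {a})"
  have oN: "open N" unfolding N_def
    by (rule continuous_open_preimage[OF continuous_on_holo_fun[OF P]]) auto
  have psh: "psh N (\<lambda>z. M * (norm (z - 0))\<^sup>2 + - ln (cmod (P z - a)))"
    by (intro psh_add psh_cmult psh_norm_sq psh_minus_ln_cmod holo_fun_on_subset[OF P] oN M)
       (auto simp: N_def)
  have XN: "hull_in (ball 0 R) K \<subseteq> N" using a by (auto simp: N_def hull_in_def)
  have "N \<subseteq> ball 0 R" by (auto simp: N_def)
  from psh_near_hull[OF open_ball K compact_hull_in_ball[OF K] oN XN this psh q]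
  show ?thesis by simp
qed

lemma hull_in_avoids_axis:
  assumes K: "compact K" "K \<noteq> {}" "K \<subseteq> ball 0 R" and P: "holo_fun_on P (ball 0 R)"
    and c: "c > 0" "c \<le> 1" and sector: "\<And>x. x \<in> K \<Longrightarrow> c * cmod (P x) \<le> \<bar>Re (P x)\<bar>"
    and q: "q \<in> hull_in (ball 0 R) K" "Re (P q) = 0"
  shows "P q = 0"
proof (rule ccontr)
  assume nz: "P q \<noteq> 0"
  define t where "t = Im (P q)"
  have t: "t \<noteq> 0" using nz q(2) by (simp add: t_def complex_eq_iff)
  let ?X = "hull_in (ball 0 R) K"
  have "continuous_on ?X P"
    using continuous_on_holo_fun[OF P] by (rule continuous_on_subset) (auto simp: hull_in_def)
  then have cPX: "compact (P ` ?X)" by (rule compact_continuous_image) (rule compact_hull_in_ball[OF K])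
  \<comment> \<open>The sign condition on \<open>t * Im w\<close> selects the half-axis of P q
    without distinguishing the two signs.\<close>
  define C where "C = P ` ?X \<inter> {w. Re w = 0 \<and> 0 \<le> t * Im w}"
  have "closed {w. Re w = 0 \<and> 0 \<le> t * Im w}"
    by (intro closed_Collect_conj closed_Collect_eq closed_Collect_le continuous_intros)
  then have "compact C" unfolding C_def using cPX by (rule compact_Int_closed[rotated])
  moreover have "P q \<in> C" using q by (auto simp: C_def t_def)
  moreover have "continuous_on C (\<lambda>w. \<bar>Im w\<bar>)" by (intro continuous_intros)
  ultimately obtain w where w: "w \<in> C" "\<And>y. y \<in> C \<Longrightarrow> \<bar>Im y\<bar> \<le> \<bar>Im w\<bar>"
    using continuous_attains_sup[of C "\<lambda>w. \<bar>Im w\<bar>"] by blast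
  define t0 where "t0 = Im w"
  have t0: "\<bar>t\<bar> \<le> \<bar>t0\<bar>" using w(2)[OF \<open>P q \<in> C\<close>] by (simp add: t_def t0_def)
  have w0: "w = Complex 0 t0" using w(1) by (auto simp: C_def t0_def complex_eq_iff)
  have tt0: "0 \<le> t * t0" using w(1) by (auto simp: C_def t0_def)
  define t1 where "t1 = t0 * (1 + c/4)"
  have at1: "\<bar>t1\<bar> = \<bar>t0\<bar> * (1 + c/4)" using c by (simp add: t1_def abs_mult)
  have t0p: "\<bar>t0\<bar> > 0" using t0 t by linarith
  have t1g: "\<bar>t1\<bar> > \<bar>t0\<bar>" unfolding at1 using t0p c by (simp add: algebra_simps)
  have "0 \<le> t * t1" using mult_nonneg_nonneg[OF tt0, of "1 + c/4"] c by (simp add: t1_def mult.assoc)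
  then have nin: "Complex 0 t1 \<notin> P ` ?X" using w(2)[of "Complex 0 t1"] t1g by (auto simp: C_def t0_def)
  obtain q0 where q0: "q0 \<in> ?X" "P q0 = w" using w(1) by (auto simp: C_def)
  obtain x where x: "x \<in> K" "- ln (cmod (w - Complex 0 t1)) \<le> - ln (cmod (P x - Complex 0 t1))"
    using hull_in_dist_image[OF K P nin q0(1), of 0] q0(2) by auto
  have d0: "cmod (w - Complex 0 t1) = c/4 * \<bar>t0\<bar>"
  proof -
    have "w - Complex 0 t1 = Complex 0 (- (c/4 * t0))" by (simp add: w0 t1_def complex_eq_iff algebra_simps)
    then show ?thesis using c by (simp add: cmod_def abs_mult)
  qed
  have "c/2 * \<bar>t1\<bar> \<le> cmod (P x - Complex 0 t1)"
    by (rule sector_distance[OF c _ sector[OF x(1)]]) (use t1g in auto)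
  moreover have "c/2 * \<bar>t0\<bar> < c/2 * \<bar>t1\<bar>" using t1g c by simp
  moreover have "c/4 * \<bar>t0\<bar> < c/2 * \<bar>t0\<bar>" using t0p c by simp
  ultimately have "cmod (w - Complex 0 t1) < cmod (P x - Complex 0 t1)" unfolding d0 by linarith
  moreover have "0 < cmod (w - Complex 0 t1)" unfolding d0 using t0p c by simp
  ultimately have "ln (cmod (w - Complex 0 t1)) < ln (cmod (P x - Complex 0 t1))"
    by (intro ln_strict_mono) auto
  then show False using x(2) by linarith
qed

text \<open>The test function is M |z|^2 - ln |P - it| with small t > 0. Near 0 the squared norm is
  small and the pole is sector-separated from K; away from 0 the values of P on K keep away from 0,
  and a tiny t makes -ln t win.\<close>

lemma hull_in_zero_fibre:
  assumes K: "compact K" "K \<noteq> {}" "K \<subseteq> ball 0 R" and P: "holo_fun_on P (ball 0 R)"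
    and c: "c > 0" "c \<le> 1" and sector: "\<And>x. x \<in> K \<Longrightarrow> c * cmod (P x) \<le> \<bar>Re (P x)\<bar>"
    and K0: "\<And>x. x \<in> K \<Longrightarrow> P x = 0 \<Longrightarrow> x = 0"
    and q: "q \<in> hull_in (ball 0 R) K" "P q = 0"
  shows "q = 0"
proof (rule ccontr)
  assume qn: "q \<noteq> 0"
  let ?X = "hull_in (ball 0 R) K"
  \<comment> \<open>The excess over -ln t that the sector estimate |P x - it| \<ge> (c/2) t permits
    on K. M is then chosen so that the squared norm contributes 2 (\<Lambda> + 1) at q, more than
    the \<Lambda> + 1 possible at points of K with M |x|^2 < 1.\<close>
  define \<Lambda> where "\<Lambda> = ln (2/c)"
  have \<Lambda>: "\<Lambda> \<ge> 0" using c by (simp add: \<Lambda>_def)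
  define M where "M = 2 * (\<Lambda> + 1) / (norm q)\<^sup>2"
  have M: "M > 0" using \<Lambda> qn by (simp add: M_def)
  have Mq: "M * (norm q)\<^sup>2 = 2 * (\<Lambda> + 1)" using qn by (simp add: M_def)
  define K1 where "K1 = K \<inter> {x. M * (norm x)\<^sup>2 \<ge> 1}"
  have K1: "compact K1" unfolding K1_def
    by (intro compact_Int_closed K(1) closed_Collect_le continuous_intros)
  have "\<exists>\<eta>>0. \<forall>x\<in>K1. \<eta> \<le> cmod (P x)"
  proof (cases "K1 = {}")
    case False
    have "continuous_on K1 (\<lambda>x. cmod (P x))"
      using continuous_on_subset[OF continuous_on_holo_fun[OF P], of K1] K(3)
      by (auto intro!: continuous_intros simp: K1_def)
    then obtain y where y: "y \<in> K1" "\<And>x. x \<in> K1 \<Longrightarrow> cmod (P y) \<le> cmod (P x)"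
      using continuous_attains_inf[OF K1 False] by blast
    have "P y \<noteq> 0" using K0[of y] y(1) by (auto simp: K1_def)
    then show ?thesis using y(2) by (intro exI[of _ "cmod (P y)"]) auto
  qed (auto intro: exI[of _ 1])
  then obtain \<eta> where \<eta>: "\<eta> > 0" "\<And>x. x \<in> K1 \<Longrightarrow> \<eta> \<le> cmod (P x)" by blast
  \<comment> \<open>On \<open>K1\<close> one has |P x - it| \<ge> \<eta>/2, so the test function is
    at most M R^2 - ln (\<eta>/2); this choice makes that bound equal to -ln t, which is below the
    value at q.\<close>
  define t where "t = \<eta> / 2 * exp (- M * R\<^sup>2)"
  have t: "t > 0" using \<eta> by (simp add: t_def)
  have t2: "t \<le> \<eta> / 2" using \<eta>(1) M by (simp add: t_def)
  have nin: "Complex 0 t \<notin> P ` ?X"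
  proof
    assume "Complex 0 t \<in> P ` ?X"
    then obtain y where y: "y \<in> ?X" "P y = Complex 0 t" by (auto dest: sym)
    then show False using hull_in_avoids_axis[OF K P c sector y(1)] t by (simp add: complex_eq_iff)
  qed
  have ct: "cmod (Complex 0 t) = t" using t by (simp add: cmod_def)
  obtain x where x: "x \<in> K" "M * (norm q)\<^sup>2 - ln t \<le> M * (norm x)\<^sup>2 - ln (cmod (P x - Complex 0 t))"
    using hull_in_dist_image[OF K P nin q(1), of M] M q(2) ct by auto
  have "c/2 * t \<le> cmod (P x - Complex 0 t)"
    using sector_distance[OF c _ sector[OF x(1)], of t] t by simp
  then have "ln (c/2 * t) \<le> ln (cmod (P x - Complex 0 t))" using c t by (intro ln_mono) auto
  moreover have "ln (c/2 * t) = ln t - \<Lambda>" using c t by (simp add: \<Lambda>_def ln_mult ln_div)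
  ultimately have "M * (norm x)\<^sup>2 \<ge> \<Lambda> + 2" using x(2) unfolding Mq by argo
  then have "x \<in> K1" using x(1) \<Lambda> by (simp add: K1_def)
  then have "\<eta> / 2 \<le> cmod (P x - Complex 0 t)"
    using \<eta>(2)[of x] t2 norm_triangle_ineq2[of "P x" "Complex 0 t"] ct by linarith
  then have "ln (\<eta> / 2) \<le> ln (cmod (P x - Complex 0 t))" using \<eta>(1) by (subst ln_le_cancel_iff) auto
  moreover have "ln t = ln (\<eta> / 2) - M * R\<^sup>2" 
    unfolding t_def using \<eta>(1) by (subst ln_mult_pos) auto
  moreover have "M * (norm x)\<^sup>2 \<le> M * R\<^sup>2"
    using x(1) K(3) M by (intro mult_left_mono power_mono) auto
  ultimately show False using x(2) \<Lambda> unfolding Mq by argo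
qed

text \<open>The function v = \<rho> - \<kappa> |z - q|^2 is nonnegative at q and lies below -s on
  the part of K with Re P \<ge> 0. The hull meets Re P = 0 only at 0, where also v < -s, so
  truncating v at -s and continuing by the constant -s across Re P = 0 gives a function p.s.h. near
  the hull that separates q from K.\<close>

lemma hull_in_positive_side:
  assumes K: "compact K" "0 \<in> K" "K \<subseteq> ball 0 R" and P: "holo_fun_on P (ball 0 R)"
    and axis: "\<And>x. x \<in> hull_in (ball 0 R) K \<Longrightarrow> Re (P x) = 0 \<Longrightarrow> x = 0"
    and \<kappa>: "\<kappa> > 0" and \<rho>: "psh (ball 0 R) (\<lambda>z. \<rho> z - \<kappa> * (norm (z - q))\<^sup>2)" "0 \<le> \<rho> q"
    and \<rho>K: "\<And>x. x \<in> K \<Longrightarrow> 0 \<le> Re (P x) \<Longrightarrow> \<rho> x = 0" and P0: "P 0 = 0"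
    and q: "q \<in> hull_in (ball 0 R) K" "0 < Re (P q)"
  shows "q \<in> K"
proof (rule ccontr)
  assume qK: "q \<notin> K"
  let ?B = "ball 0 R" and ?X = "hull_in (ball 0 R) K"
  define v where "v = (\<lambda>z. \<rho> z - \<kappa> * (norm (z - q))\<^sup>2)"
  have v: "psh ?B v" using \<rho>(1) by (simp add: v_def)
  define d where "d = infdist q K"
  have ne: "K \<noteq> {}" using K(2) by blast
  have d: "d > 0" using infdist_pos_not_in_closed[OF compact_imp_closed[OF K(1)] ne qK] by (simp add: d_def)
  have dK: "d \<le> norm (x - q)" if "x \<in> K" for x
    using infdist_le[OF that, of q] by (simp add: d_def dist_norm norm_minus_commute)
  \<comment> \<open>Half of the available gap \<kappa> d^2, so that v < -s holds strictly and
    persists in the neighbourhood \<open>N0\<close> of 0.\<close>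
  define s where "s = \<kappa> * d\<^sup>2 / 2"
  have s: "s > 0" using \<kappa> d by (simp add: s_def)
  have vK: "v x < - s" if "x \<in> K" "0 \<le> Re (P x)" for x
  proof -
    have "d\<^sup>2 \<le> (norm (x - q))\<^sup>2" using dK[OF that(1)] d by (intro power_mono) auto
    then have "\<kappa> * d\<^sup>2 \<le> \<kappa> * (norm (x - q))\<^sup>2" using \<kappa> by simp
    then show ?thesis using \<rho>K[OF that] s by (simp add: v_def s_def)
  qed
  have cP: "continuous_on ?B P" by (rule continuous_on_holo_fun[OF P])
  define N0 where "N0 = ?B \<inter> v -` {..< - s}"
  define Np where "Np = ?B \<inter> P -` {w. Re w > 0}"
  define Nm where "Nm = ?B \<inter> P -` {w. Re w < 0}"
  have opn: "open N0" "open Np" "open Nm"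
    unfolding N0_def Np_def Nm_def
    by (rule continuous_open_preimage[OF psh_continuous[OF v]] continuous_open_preimage[OF cP];
        auto simp: open_halfspace_Re_gt open_halfspace_Re_lt)+
  define u where "u z = (if Re (P z) > 0 then max (v z) (- s) else - s)" for z
  have "psh (N0 \<union> Np \<union> Nm) u"
  proof (rule psh_local)
    fix z assume "z \<in> N0 \<union> Np \<union> Nm"
    then consider "z \<in> N0" | "z \<in> Np" | "z \<in> Nm" by blast
    then show "\<exists>N w. open N \<and> z \<in> N \<and> psh N w \<and> (\<forall>y\<in>N. u y = w y)"
    proof cases
      case 1 then show ?thesis using opn(1)
        by (intro exI[of _ N0] exI[of _ "\<lambda>z. - s"]) (auto simp: u_def N0_def intro: psh_const)
    next
      case 2
      have "psh Np (\<lambda>z. max (v z) (- s))"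
        by (intro psh_max psh_const psh_subset[OF v]) (auto simp: Np_def)
      then show ?thesis using opn(2) 2
        by (intro exI[of _ Np] exI[of _ "\<lambda>z. max (v z) (- s)"]) (auto simp: u_def Np_def)
    next
      case 3 then show ?thesis using opn(3)
        by (intro exI[of _ Nm] exI[of _ "\<lambda>z. - s"]) (auto simp: u_def Nm_def intro: psh_const)
    qed
  qed
  moreover have "?X \<subseteq> N0 \<union> Np \<union> Nm"
  proof
    fix x assume x: "x \<in> ?X"
    then have xB: "x \<in> ?B" by (simp add: hull_in_def)
    show "x \<in> N0 \<union> Np \<union> Nm"
    proof (cases "Re (P x) = 0")
      case True
      then have "x = 0" using axis[OF x] by simp
      then show ?thesis using vK[OF K(2)] P0 xB by (simp add: N0_def)
    next
      case False
      then show ?thesis using xB by (auto simp: Np_def Nm_def)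
    qed
  qed
  moreover have "N0 \<union> Np \<union> Nm \<subseteq> ?B" by (auto simp: N0_def Np_def Nm_def)
  moreover have "open (N0 \<union> Np \<union> Nm)" using opn by auto
  ultimately obtain x where x: "x \<in> K" "u q \<le> u x"
    using psh_near_hull[OF open_ball K(1) ne K(3) compact_hull_in_ball[OF K(1) ne K(3)], of "N0 \<union> Np \<union> Nm" u q] q(1)
    by blast
  have "u x = - s" using vK[OF x(1)] by (auto simp: u_def)
  moreover have "u q \<ge> 0" using q(2) \<rho>(2) by (simp add: u_def v_def)
  ultimately show False using x(2) s by simp
qed

text \<open>A version of Kallin's lemma: \<open>P\<close> maps the two parts of \<open>K\<close> to opposite sectors that
  meet only at the origin.\<close>

lemma hull_in_two_sectors:
  assumes K: "compact K" "0 \<in> K" "K \<subseteq> ball 0 R" and P: "holo_fun_on P (ball 0 R)" "P 0 = 0"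
    and c: "c > 0" "c \<le> 1" and \<kappa>: "\<kappa> > 0"
    and \<rho>1: "\<And>q. psh (ball 0 R) (\<lambda>z. \<rho>1 z - \<kappa> * (norm (z - q))\<^sup>2)" "\<And>z. 0 \<le> \<rho>1 z"
    and \<rho>2: "\<And>q. psh (ball 0 R) (\<lambda>z. \<rho>2 z - \<kappa> * (norm (z - q))\<^sup>2)" "\<And>z. 0 \<le> \<rho>2 z"
    and \<rho>0: "\<rho>1 0 = 0" "\<rho>2 0 = 0"
    and parts: "\<And>x. x \<in> K \<Longrightarrow> x \<noteq> 0 \<Longrightarrow>
      (c * cmod (P x) \<le> Re (P x) \<and> 0 < Re (P x) \<and> \<rho>1 x = 0) \<or>
      (c * cmod (P x) \<le> - Re (P x) \<and> Re (P x) < 0 \<and> \<rho>2 x = 0)"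
  shows "hull_in (ball 0 R) K \<subseteq> K"
proof
  fix q assume q: "q \<in> hull_in (ball 0 R) K"
  have ne: "K \<noteq> {}" using K by blast
  have sector: "c * cmod (P x) \<le> \<bar>Re (P x)\<bar>" if "x \<in> K" for x
    using parts[OF that] P(2) by (cases "x = 0") auto
  have K0: "x = 0" if "x \<in> K" "P x = 0" for x
    using parts[OF that(1)] that(2) by auto
  have axis: "x = 0" if "x \<in> hull_in (ball 0 R) K" "Re (P x) = 0" for x
    by (rule hull_in_zero_fibre[OF K(1) ne K(3) P(1) c sector K0 that(1)
          hull_in_avoids_axis[OF K(1) ne K(3) P(1) c sector that]]) auto
  consider "Re (P q) > 0" | "Re (P q) < 0" | "q = 0" using axis[OF q] by fastforce
  then show "q \<in> K"
  proof cases
    case 1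
    show ?thesis
    proof (rule hull_in_positive_side[OF K P(1) axis \<kappa> \<rho>1 _ P(2) q 1])
      show "\<rho>1 x = 0" if "x \<in> K" "0 \<le> Re (P x)" for x using parts[OF that(1)] that(2) \<rho>0 by force
    qed
  next
    case 2
    show ?thesis
    proof (rule hull_in_positive_side[of K R "\<lambda>z. - 1 * P z", OF K holo_fun_on_cmult[OF P(1)] _ \<kappa> \<rho>2 _ _ q])
      show "\<rho>2 x = 0" if "x \<in> K" "0 \<le> Re (- 1 * P x)" for x using parts[OF that(1)] that(2) \<rho>0 by force
    qed (use axis P(2) 2 in auto)
  qed (use K in simp)
qed

section \<open>Smoothness calculus\<close>

lemma Ck_on_SucD:
  assumes "Ck_on (Suc k) f S"
  shows "\<And>x. x \<in> S \<Longrightarrow> (f has_derivative frechet_derivative f (at x)) (at x)"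
    and "\<And>v. Ck_on k (\<lambda>x. frechet_derivative f (at x) v) S"
  using assms by (auto simp: frechet_derivative_works)

lemma Ck_on_cong:
  assumes "open S" "\<And>x. x \<in> S \<Longrightarrow> f x = g x" "Ck_on k f S"
  shows "Ck_on k g S"
  using assms(2,3)
proof (induction k arbitrary: f g)
  case 0
  then show ?case using continuous_on_eq by fastforce
next
  case (Suc k)
  have g: "(g has_derivative frechet_derivative f (at x)) (at x)" if "x \<in> S" for x
    by (rule has_derivative_transform_within_open[OF Ck_on_SucD(1)[OF Suc.prems(2) that] assms(1) that])
       (use Suc.prems(1) in auto)
  then have "frechet_derivative f (at x) = frechet_derivative g (at x)" if "x \<in> S" for x
    using that frechet_derivative_at by blast
  then have "Ck_on k (\<lambda>x. frechet_derivative g (at x) v) S" for v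
    using Suc.IH[OF _ Ck_on_SucD(2)[OF Suc.prems(2)]] by auto
  then show ?case using g by (auto simp: differentiable_def)
qed

lemma Ck_on_SucI:
  assumes "open S" "\<And>x. x \<in> S \<Longrightarrow> (f has_derivative D x) (at x)" "\<And>v. Ck_on k (\<lambda>x. D x v) S"
  shows "Ck_on (Suc k) f S"
proof -
  have "D x = frechet_derivative f (at x)" if "x \<in> S" for x
    using assms(2)[OF that] frechet_derivative_at by blast
  then have "Ck_on k (\<lambda>x. frechet_derivative f (at x) v) S" for v
    using Ck_on_cong[OF assms(1) _ assms(3)[of v]] by simp
  then show ?thesis using assms(2) by (auto simp: differentiable_def)
qed

lemma Ck_on_Suc_imp: "Ck_on (Suc k) f S \<Longrightarrow> Ck_on k f S"
proof (induction k arbitrary: f)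
  case 0
  then show ?case
    by (auto intro!: continuous_at_imp_continuous_on differentiable_imp_continuous_within)
next
  case (Suc k)
  then have "Ck_on k (\<lambda>x. frechet_derivative f (at x) v) S" for v
    by (metis Ck_on.simps(2))
  then show ?case using Suc.prems by simp
qed

lemma Ck_on_le: "Ck_on k f S \<Longrightarrow> j \<le> k \<Longrightarrow> Ck_on j f S"
proof (induction k arbitrary: j)
  case (Suc k)
  then show ?case using Ck_on_Suc_imp[OF Suc.prems(1)] by (cases "j = Suc k") auto
qed simp

lemma Ck_on_subset: "Ck_on k f S \<Longrightarrow> T \<subseteq> S \<Longrightarrow> Ck_on k f T"
  by (induction k arbitrary: f) (auto elim: continuous_on_subset)

lemma Ck_on_const: "Ck_on k (\<lambda>x. c) S"
  by (induction k arbitrary: c) auto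

lemma Ck_on_linear:
  assumes "bounded_linear L" "open S"
  shows "Ck_on k L S"
proof (cases k)
  case 0
  then show ?thesis using assms by (simp add: linear_continuous_on)
next
  case (Suc j)
  then show ?thesis
    using Ck_on_SucI[OF assms(2) bounded_linear_imp_has_derivative[OF assms(1)] Ck_on_const] by simp
qed

lemma Ck_on_linear_compose:
  assumes "bounded_linear L" "open S" "Ck_on k f S"
  shows "Ck_on k (\<lambda>x. L (f x)) S"
  using assms(3)
proof (induction k arbitrary: f)
  case 0
  then show ?case using continuous_on_compose2[OF linear_continuous_on[OF assms(1), of UNIV]] by auto
next
  case (Suc k)
  show ?case
  proof (rule Ck_on_SucI[OF assms(2)])
    show "((\<lambda>x. L (f x)) has_derivative (\<lambda>v. L (frechet_derivative f (at x) v))) (at x)" if "x \<in> S" for x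
      by (rule bounded_linear.has_derivative[OF assms(1) Ck_on_SucD(1)[OF Suc.prems that]])
    show "Ck_on k (\<lambda>x. L (frechet_derivative f (at x) v)) S" for v
      by (rule Suc.IH[OF Ck_on_SucD(2)[OF Suc.prems]])
  qed
qed

lemma Ck_on_add:
  assumes "open S" "Ck_on k f S" "Ck_on k g S"
  shows "Ck_on k (\<lambda>x. f x + g x) S"
  using assms(2,3)
proof (induction k arbitrary: f g)
  case 0
  then show ?case by (auto intro: continuous_intros)
next
  case (Suc k)
  show ?case
    by (rule Ck_on_SucI[OF assms(1) has_derivative_add[OF Ck_on_SucD(1)[OF Suc.prems(1)] Ck_on_SucD(1)[OF Suc.prems(2)]]
         Suc.IH[OF Ck_on_SucD(2)[OF Suc.prems(1)] Ck_on_SucD(2)[OF Suc.prems(2)]]])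
qed

lemma Ck_on_sum:
  assumes "open S" "\<And>i. i \<in> I \<Longrightarrow> Ck_on k (f i) S"
  shows "Ck_on k (\<lambda>x. \<Sum>i\<in>I. f i x) S"
  using assms(2)
  by (induction I rule: infinite_finite_induct) (auto intro: Ck_on_const Ck_on_add[OF assms(1)])

lemma Ck_on_bilinear:
  assumes "bounded_bilinear B" "open S" "Ck_on k f S" "Ck_on k g S"
  shows "Ck_on k (\<lambda>x. B (f x) (g x)) S"
  using assms(3,4)
proof (induction k arbitrary: f g)
  case 0
  then show ?case using bounded_bilinear.continuous_on[OF assms(1)] by auto
next
  case (Suc k)
  show ?case
  proof (rule Ck_on_SucI[OF assms(2)])
    show "((\<lambda>x. B (f x) (g x)) has_derivative
        (\<lambda>v. B (f x) (frechet_derivative g (at x) v) + B (frechet_derivative f (at x) v) (g x))) (at x)"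
      if "x \<in> S" for x
      by (rule bounded_bilinear.FDERIV[OF assms(1) Ck_on_SucD(1)[OF Suc.prems(1) that] Ck_on_SucD(1)[OF Suc.prems(2) that]])
    show "Ck_on k (\<lambda>x. B (f x) (frechet_derivative g (at x) v) + B (frechet_derivative f (at x) v) (g x)) S" for v
      by (intro Ck_on_add[OF assms(2)] Suc.IH Ck_on_SucD(2)[OF Suc.prems(1)] Ck_on_SucD(2)[OF Suc.prems(2)]
          Ck_on_Suc_imp[OF Suc.prems(1)] Ck_on_Suc_imp[OF Suc.prems(2)])
  qed
qed

lemma linear_sum_Basis:
  fixes L :: "'a::euclidean_space \<Rightarrow> 'b::real_vector"
  assumes "linear L"
  shows "L v = (\<Sum>b\<in>Basis. (v \<bullet> b) *\<^sub>R L b)"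
proof -
  have "L v = L (\<Sum>b\<in>Basis. (v \<bullet> b) *\<^sub>R b)" by (simp add: euclidean_representation)
  also have "\<dots> = (\<Sum>b\<in>Basis. (v \<bullet> b) *\<^sub>R L b)"
    by (simp add: linear_sum[OF assms] linear_cmul[OF assms])
  finally show ?thesis .
qed

lemma Ck_on_compose:
  fixes f :: "'a::euclidean_space \<Rightarrow> 'b::euclidean_space" and g :: "'b \<Rightarrow> 'c::real_normed_vector"
  assumes "open S" "open T" "f ` S \<subseteq> T" "Ck_on k f S" "Ck_on k g T"
  shows "Ck_on k (\<lambda>x. g (f x)) S"
  using assms(4,5)
proof (induction k arbitrary: g)
  case 0
  then show ?case using assms(3) by (auto intro: continuous_on_compose2)
next
  case (Suc k)
  let ?f' = "\<lambda>x. frechet_derivative f (at x)" and ?g' = "\<lambda>y. frechet_derivative g (at y)"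
  show ?case
  proof (rule Ck_on_SucI[OF assms(1)])
    show "((\<lambda>x. g (f x)) has_derivative (\<lambda>v. ?g' (f x) (?f' x v))) (at x)" if "x \<in> S" for x
      by (rule has_derivative_compose[OF Ck_on_SucD(1)[OF Suc.prems(1) that] Ck_on_SucD(1)[OF Suc.prems(2)]])
         (use assms(3) that in auto)
    fix v
    \<comment> \<open>In the chain rule the direction \<open>?f' x v\<close> varies with x.
      Expanding it in the basis leaves derivatives of g in fixed directions b, to which the
      induction hypothesis applies.\<close>
    have "Ck_on k (\<lambda>x. \<Sum>b\<in>Basis. (?f' x v \<bullet> b) *\<^sub>R ?g' (f x) b) S"
      by (intro Ck_on_sum[OF assms(1)] Ck_on_bilinear[OF bounded_bilinear_scaleR assms(1)]
            Ck_on_linear_compose[OF bounded_linear_inner_left assms(1)] Suc.IH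
            Ck_on_SucD(2)[OF Suc.prems(1)] Ck_on_SucD(2)[OF Suc.prems(2)] Ck_on_Suc_imp[OF Suc.prems(1)])
    moreover have "(\<Sum>b\<in>Basis. (?f' x v \<bullet> b) *\<^sub>R ?g' (f x) b) = ?g' (f x) (?f' x v)" if "x \<in> S" for x
      by (rule linear_sum_Basis[symmetric], rule has_derivative_linear, rule Ck_on_SucD(1)[OF Suc.prems(2)])
         (use assms(3) that in auto)
    ultimately show "Ck_on k (\<lambda>x. ?g' (f x) (?f' x v)) S"
      using Ck_on_cong[OF assms(1)] by (metis (no_types, lifting))
  qed
qed

lemma Ck_on_inverse:
  fixes f :: "'a::euclidean_space \<Rightarrow> real"
  assumes "open S" "\<And>x. x \<in> S \<Longrightarrow> f x \<noteq> 0" "Ck_on k f S"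
  shows "Ck_on k (\<lambda>x. 1 / f x) S"
  using assms(3)
proof (induction k)
  case 0
  then show ?case using assms(2) by (auto intro!: continuous_intros)
next
  case (Suc k)
  let ?f' = "\<lambda>x. frechet_derivative f (at x)"
  show ?case
  proof (rule Ck_on_SucI[OF assms(1)])
    show "((\<lambda>x. 1 / f x) has_derivative (\<lambda>v. - (?f' x v * ((1 / f x) * (1 / f x))))) (at x)" if "x \<in> S" for x
      using has_derivative_divide'[OF has_derivative_const Ck_on_SucD(1)[OF Suc.prems that], of 1] assms(2)[OF that]
      by (simp add: divide_inverse algebra_simps)
    show "Ck_on k (\<lambda>x. - (?f' x v * ((1 / f x) * (1 / f x)))) S" for v
      by (intro Ck_on_linear_compose[OF bounded_linear_minus[OF bounded_linear_ident] assms(1)]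
          Ck_on_bilinear[OF bounded_bilinear_mult assms(1)] 
          Ck_on_SucD(2)[OF Suc.prems] Suc.IH Ck_on_Suc_imp[OF Suc.prems])
  qed
qed

section \<open>Smoothness of holomorphic functions and maps of several variables\<close>

lemma bounded_linear_axis: "bounded_linear (axis j :: complex \<Rightarrow> complex^'n::finite)"
proof -
  have "linear (axis j :: complex \<Rightarrow> complex^'n)"
    by (rule linearI) (auto simp: vec_eq_iff axis_def)
  then show ?thesis by (simp add: linear_conv_bounded_linear)
qed

lemma sum_axis: "(\<Sum>j\<in>UNIV. axis j (g j :: complex)) = (\<chi> j. g j)"
  by (simp add: vec_eq_iff axis_def if_distrib cong: if_cong)

lemma holo_map_on_components: "holo_map_on f S \<longleftrightarrow> (\<forall>j. holo_fun_on (\<lambda>x. f x $ j) S)"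
proof
  assume f: "holo_map_on f S"
  show "\<forall>j. holo_fun_on (\<lambda>x. f x $ j) S"
    unfolding holo_fun_on_def
  proof (intro allI ballI)
    fix j z assume "z \<in> S"
    then obtain f' where "(f has_derivative f') (at z)" "\<forall>c v. f' (c *s v) = c *s f' v"
      using f unfolding holo_map_on_def by meson
    then show "\<exists>f'. ((\<lambda>x. f x $ j) has_derivative f') (at z) \<and> (\<forall>c v. f' (c *s v) = c * f' v)"
      using bounded_linear.has_derivative[OF bounded_linear_vec_nth]
      by (intro exI[of _ "\<lambda>v. f' v $ j"]) auto
  qed
next
  assume f: "\<forall>j. holo_fun_on (\<lambda>x. f x $ j) S"
  show "holo_map_on f S"
    unfolding holo_map_on_def
  proof
    fix z assume "z \<in> S"
    then have "\<forall>j. \<exists>f'. ((\<lambda>x. f x $ j) has_derivative f') (at z) \<and> (\<forall>c v. f' (c *s v) = c * f' v)"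
      using f unfolding holo_fun_on_def by blast
    then obtain f' where f': "\<And>j. ((\<lambda>x. f x $ j) has_derivative f' j) (at z)"
        "\<And>j c v. f' j (c *s v) = c * f' j v" by metis
    have "((\<lambda>x. \<Sum>j\<in>UNIV. axis j (f x $ j)) has_derivative (\<lambda>v. \<Sum>j\<in>UNIV. axis j (f' j v))) (at z)"
      by (intro has_derivative_sum bounded_linear.has_derivative[OF bounded_linear_axis] f')
    then have "(f has_derivative (\<lambda>v. \<chi> j. f' j v)) (at z)" by (simp add: sum_axis)
    then show "\<exists>f'. (f has_derivative f') (at z) \<and> (\<forall>c v. f' (c *s v) = c *s f' v)"
      by (intro exI[of _ "\<lambda>v. \<chi> j. f' j v"]) (auto simp: vec_eq_iff f')
  qed
qed

lemma holo_fun_on_frechet: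
  assumes "holo_fun_on f S" "z \<in> S"
  shows "(f has_derivative frechet_derivative f (at z)) (at z)"
    and "frechet_derivative f (at z) (c *s v) = c * frechet_derivative f (at z) v"
proof -
  obtain f' where f': "(f has_derivative f') (at z)" "\<forall>c v. f' (c *s v) = c * f' v"
    using assms unfolding holo_fun_on_def by meson
  then have "f' = frechet_derivative f (at z)" by (simp add: frechet_derivative_at)
  with f' show "(f has_derivative frechet_derivative f (at z)) (at z)"
    "frechet_derivative f (at z) (c *s v) = c * frechet_derivative f (at z) v" by auto
qed

lemma holo_map_on_frechet:
  assumes "holo_map_on f S" "z \<in> S"
  shows "(f has_derivative frechet_derivative f (at z)) (at z)"
    and "frechet_derivative f (at z) (c *s v) = c *s frechet_derivative f (at z) v"
proof -
  obtain f' where f': "(f has_derivative f') (at z)" "\<forall>c v. f' (c *s v) = c *s f' v"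
    using assms unfolding holo_map_on_def by meson
  then have "f' = frechet_derivative f (at z)" by (simp add: frechet_derivative_at)
  with f' show "(f has_derivative frechet_derivative f (at z)) (at z)"
    "frechet_derivative f (at z) (c *s v) = c *s frechet_derivative f (at z) v" by auto
qed

lemma norm_scaled_vec: "norm (c *s v) = cmod c * norm (v::complex^'n::finite)"
  by (simp add: norm_vec_def norm_mult L2_set_right_distrib)

text \<open>Cauchy's formula for the first derivative at 0 of \<zeta> \<mapsto> f (x + \<zeta> v).
  Since \<open>holo_fun_on\<close> asks only for pointwise differentiability, writing the derivative
  as an integral of values of f is the source of its regularity in x.\<close>

lemma holo_fun_Cauchy_derivative:
  fixes f :: "complex^'n::finite \<Rightarrow> complex"
  assumes f: "holo_fun_on f S" and s: "0 < s" and disc: "\<And>\<zeta>. cmod \<zeta> \<le> s \<Longrightarrow> x + \<zeta> *s v \<in> S"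
  shows "((\<lambda>t. f (x + (of_real s * cis t) *s v) * cis (- t)) has_integral
           (2 * of_real pi * of_real s * frechet_derivative f (at x) v)) {0..2*pi}"
proof -
  define g where "g = (\<lambda>\<zeta>. f (x + \<zeta> *s v))"
  have gd: "g field_differentiable (at \<zeta>)" if "\<zeta> \<in> cball 0 s" for \<zeta>
    unfolding g_def by (rule holo_fun_on_line[OF f that]) (use disc in auto)
  then have gh: "g holomorphic_on cball 0 s"
    unfolding holomorphic_on_def using field_differentiable_at_within by blast
  have xS: "x \<in> S" using disc[of 0] s by simp
  have "(g has_derivative (\<lambda>\<zeta>. frechet_derivative f (at x) (\<zeta> *s v))) (at 0)"
  proof -
    have "((\<lambda>\<zeta>. x + \<zeta> *s v) has_derivative (\<lambda>\<zeta>. \<zeta> *s v)) (at 0)"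
      using has_derivative_add[OF has_derivative_const
        bounded_linear_imp_has_derivative[OF bounded_linear_scaled_vec[of v]]] by simp
    moreover have "(f has_derivative frechet_derivative f (at x)) (at (x + 0 *s v))"
      using holo_fun_on_frechet(1)[OF f xS] by simp
    ultimately show ?thesis unfolding g_def by (rule has_derivative_compose)
  qed
  then have "(g has_field_derivative (frechet_derivative f (at x) v)) (at 0)"
    unfolding has_field_derivative_def
    by (rule has_derivative_eq_rhs) (auto simp: holo_fun_on_frechet(2)[OF f xS])
  then have dg: "deriv g 0 = frechet_derivative f (at x) v" by (rule DERIV_imp_deriv)
  have "((\<lambda>u. g u / (u - 0) ^ Suc 1) has_contour_integral (2 * pi * \<i> / fact 1 * (deriv ^^ 1) g 0)) (circlepath 0 s)"
    by (rule Cauchy_has_contour_integral_higher_derivative_circlepath)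
       (use gh s in \<open>auto intro: holomorphic_on_imp_continuous_on holomorphic_on_subset\<close>)
  then have "((\<lambda>u. g u / u\<^sup>2) has_contour_integral (2 * pi * \<i> * frechet_derivative f (at x) v)) (circlepath 0 s)"
    by (simp add: dg power2_eq_square)
  then have "((\<lambda>t. g (0 + s * cis t) / (0 + s * cis t)\<^sup>2 * s * \<i> * cis t)
      has_integral (2 * pi * \<i> * frechet_derivative f (at x) v)) {0..2*pi}"
    unfolding circlepath_def
    by (subst (asm) has_contour_integral_part_circlepath_iff) auto
  from has_integral_mult_right[OF this, of "- \<i> * s"]
  have *: "((\<lambda>t. - \<i> * s * (g (0 + s * cis t) / (0 + s * cis t)\<^sup>2 * s * \<i> * cis t))
      has_integral (- \<i> * s * (2 * pi * \<i> * frechet_derivative f (at x) v))) {0..2*pi}" .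
  have e1: "- \<i> * s * (g (0 + s * cis t) / (0 + s * cis t)\<^sup>2 * s * \<i> * cis t) = f (x + (of_real s * cis t) *s v) * cis (- t)" for t
  proof -
    have "cis t * cis (- t) = 1" by (simp add: cis_mult)
    then have "cis (- t) = 1 / cis t" by (simp add: field_simps)
    moreover have "- \<i> * s * (g (0 + s * cis t) / (0 + s * cis t)\<^sup>2 * s * \<i> * cis t) = g (s * cis t) * (1 / cis t)"
      using s by (simp add: power2_eq_square mult.left_commute[of \<i>])
    ultimately show ?thesis by (simp add: g_def)
  qed
  have e2: "- \<i> * s * (2 * pi * \<i> * frechet_derivative f (at x) v) = 2 * of_real pi * of_real s * frechet_derivative f (at x) v"
    by (simp add: complex_eq_iff)
  show ?thesis using * unfolding e1 e2 .
qed

lemma uniform_disc_in_open: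
  fixes v :: "complex^'n::finite"
  assumes S: "open S" and x0: "x0 \<in> S"
  obtains e s where "e > 0" "s > 0"
    "\<And>x \<zeta>. x \<in> ball x0 e \<Longrightarrow> cmod \<zeta> \<le> s \<Longrightarrow> x + \<zeta> *s v \<in> S"
proof -
  obtain e where e: "e > 0" "ball x0 e \<subseteq> S" using S x0 by (rule openE)
  define s where "s = e / (2 * (norm v + 1))"
  have s: "s > 0" using e by (simp add: s_def add_nonneg_pos)
  have sv: "s * norm v \<le> e / 2"
  proof -
    have "s * norm v \<le> s * (norm v + 1)" using s by simp
    also have "\<dots> = e / 2" using add_nonneg_pos[OF norm_ge_zero[of v] zero_less_one]
      unfolding s_def by (metis less_irrefl mult.commute nonzero_mult_div_cancel_left times_divide_eq_left mult_divide_mult_cancel_left_if)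
    finally show ?thesis .
  qed
  have "x + \<zeta> *s v \<in> S" if "x \<in> ball x0 (e/2)" "cmod \<zeta> \<le> s" for x \<zeta>
  proof -
    have "cmod \<zeta> * norm v \<le> s * norm v" using that by (simp add: mult_right_mono)
    then have "norm (\<zeta> *s v) \<le> e / 2" using sv by (simp add: norm_scaled_vec)
    then have "dist x0 (x + \<zeta> *s v) < e"
      using that(1) dist_triangle[of x0 "x + \<zeta> *s v" x] by (simp add: dist_norm)
    then show ?thesis using e by auto
  qed
  then show thesis using that[of "e/2" s] e s by simp
qed

text \<open>In Cauchy's formula on a fixed radius the integrand is jointly continuous in x and the
  angle. Continuity comes before differentiability because it justifies differentiation under the
  integral.\<close>

lemma continuous_on_holo_derivative:
  fixes f :: "complex^'n::finite \<Rightarrow> complex"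
  assumes f: "holo_fun_on f S" and S: "open S"
  shows "continuous_on S (\<lambda>x. frechet_derivative f (at x) v)"
proof (rule continuous_at_imp_continuous_on, rule ballI)
  fix x0 assume "x0 \<in> S"
  from uniform_disc_in_open[OF S this, of v] obtain e s where e: "e > 0" and s: "s > 0"
    and disc: "\<And>x \<zeta>. x \<in> ball x0 e \<Longrightarrow> cmod \<zeta> \<le> s \<Longrightarrow> x + \<zeta> *s v \<in> S" by blast
  let ?U = "ball x0 e"
  have eq: "integral (cbox 0 (2*pi)) (\<lambda>t. f (x + (of_real s * cis t) *s v) * cis (- t)) =
       2 * of_real pi * of_real s * frechet_derivative f (at x) v" if "x \<in> ?U" for x
    unfolding cbox_interval
    by (rule integral_unique, rule holo_fun_Cauchy_derivative[OF f s disc[OF that]])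
  have bl: "continuous_on X (\<lambda>x. c x *s v)" if "continuous_on X c" for X :: "('x::topological_space) set" and c
    using continuous_on_compose2[OF linear_continuous_on[OF bounded_linear_scaled_vec[of v], of UNIV] that] by simp
  have "continuous_on (?U \<times> cbox 0 (2*pi)) (\<lambda>(x, t). f (x + (of_real s * cis t) *s v) * cis (- t))"
    unfolding case_prod_beta
    by (intro continuous_intros continuous_on_compose2[OF continuous_on_holo_fun[OF f]] bl)
       (use disc s in \<open>auto simp: norm_mult\<close>)
  then have "continuous_on ?U (\<lambda>x. integral (cbox 0 (2*pi)) (\<lambda>t. f (x + (of_real s * cis t) *s v) * cis (- t)))"
    by (rule integral_continuous_on_param)
  then have "continuous_on ?U (\<lambda>x. 2 * of_real pi * of_real s * frechet_derivative f (at x) v)"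
    by (rule continuous_on_eq) (simp only: eq)
  then have "continuous_on ?U (\<lambda>x. 1 / (2 * of_real pi * of_real s) * (2 * of_real pi * of_real s * frechet_derivative f (at x) v))"
    by (rule continuous_on_mult[OF continuous_on_const])
  then have "continuous_on ?U (\<lambda>x. frechet_derivative f (at x) v)" using s by simp
  then show "isCont (\<lambda>x. frechet_derivative f (at x) v) x0"
    using e by (simp add: continuous_on_eq_continuous_at)
qed

text \<open>Cauchy's formula is differentiated under the integral sign; the new derivative inherits
  complex linearity from the derivatives of f in the integrand.\<close>

lemma holo_fun_on_derivative:
  fixes f :: "complex^'n::finite \<Rightarrow> complex"
  assumes f: "holo_fun_on f S" and S: "open S"
  shows "holo_fun_on (\<lambda>x. frechet_derivative f (at x) v) S"
  unfolding holo_fun_on_def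
proof
  fix x0 assume "x0 \<in> S"
  from uniform_disc_in_open[OF S this, of v] obtain e s where e: "e > 0" and s: "s > 0"
    and disc: "\<And>x \<zeta>. x \<in> ball x0 e \<Longrightarrow> cmod \<zeta> \<le> s \<Longrightarrow> x + \<zeta> *s v \<in> S" by blast
  let ?U = "ball x0 e"
  have eq: "integral (cbox 0 (2*pi)) (\<lambda>t. f (x + (of_real s * cis t) *s v) * cis (- t)) =
       2 * of_real pi * of_real s * frechet_derivative f (at x) v" if "x \<in> ?U" for x
    unfolding cbox_interval
    by (rule integral_unique, rule holo_fun_Cauchy_derivative[OF f s disc[OF that]])
  have bl: "continuous_on X (\<lambda>x. c x *s v)" if "continuous_on X c" for X :: "('x::topological_space) set" and c
    using continuous_on_compose2[OF linear_continuous_on[OF bounded_linear_scaled_vec[of v], of UNIV] that] by simp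
  have arg: "continuous_on X (\<lambda>p. fst p + (of_real s * cis (snd p)) *s v)" for X :: "((complex^'n) \<times> real) set"
    by (intro continuous_intros bl)
  have argS: "x + (of_real s * cis t) *s v \<in> S" if "x \<in> ?U" for x t
    by (rule disc[OF that]) (use s in \<open>simp add: norm_mult\<close>)
  define f' where "f' x = frechet_derivative f (at x)" for x
  have f': "(f has_derivative f' x) (at x)" if "x \<in> S" for x
    unfolding f'_def by (rule holo_fun_on_frechet(1)[OF f that])
  define fx where "fx x t = Blinfun (\<lambda>w. f' (x + (of_real s * cis t) *s v) w * cis (- t))" for x t
  have fx: "blinfun_apply (fx x t) = (\<lambda>w. f' (x + (of_real s * cis t) *s v) w * cis (- t))" if "x \<in> ?U" for x t
    unfolding fx_def
    by (rule bounded_linear_Blinfun_apply, rule bounded_linear_mult_const,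
        rule has_derivative_bounded_linear, rule f'[OF argS[OF that]])
  have x0U: "x0 \<in> ?U" using e by simp
  define I where "I = (\<lambda>x. integral (cbox 0 (2*pi)) (\<lambda>t. f (x + (of_real s * cis t) *s v) * cis (- t)))"
  have contx: "continuous_on (?U \<times> cbox 0 (2*pi)) (\<lambda>(x, t). fx x t)"
  proof (rule continuous_on_blinfun_componentwise)
    fix i :: "complex^'n" assume "i \<in> Basis"
    have "continuous_on (?U \<times> cbox 0 (2*pi)) (\<lambda>p. f' (fst p + (of_real s * cis (snd p)) *s v) i * cis (- snd p))"
      unfolding f'_def
      by (intro continuous_on_mult continuous_on_compose2[OF continuous_on_holo_derivative[OF f S] arg] continuous_intros)
         (use argS in auto)
    then show "continuous_on (?U \<times> cbox 0 (2*pi)) (\<lambda>p. blinfun_apply (case p of (x, t) \<Rightarrow> fx x t) i)"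
      by (rule continuous_on_eq) (auto simp: fx)
  qed
  have "((\<lambda>x. integral (cbox 0 (2*pi)) (\<lambda>t. f (x + (of_real s * cis t) *s v) * cis (- t)))
      has_derivative integral (cbox 0 (2*pi)) (fx x0)) (at x0 within ?U)"
  proof (rule leibniz_rule[OF _ _ contx])
    show "((\<lambda>x. f (x + (of_real s * cis t) *s v) * cis (- t)) has_derivative blinfun_apply (fx x t)) (at x within ?U)"
      if "x \<in> ?U" for x t
    proof -
      have "((\<lambda>x. x + (of_real s * cis t) *s v) has_derivative (\<lambda>w. w)) (at x)"
        by (auto intro!: derivative_eq_intros)
      from has_derivative_compose[OF this f'[OF argS[OF that]]]
      show ?thesis unfolding fx[OF that]
        by (rule has_derivative_at_withinI[OF has_derivative_mult_left])
    qed
    show "(\<lambda>t. f (x + (of_real s * cis t) *s v) * cis (- t)) integrable_on cbox 0 (2*pi)" if "x \<in> ?U" for x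
      unfolding cbox_interval
      by (rule has_integral_integrable, rule holo_fun_Cauchy_derivative[OF f s disc[OF that]])
  qed (use e in auto)
  then have dI: "(I has_derivative blinfun_apply (integral (cbox 0 (2*pi)) (fx x0))) (at x0)"
    unfolding I_def at_within_open[OF x0U open_ball] .
  have "fx x0 integrable_on cbox 0 (2*pi)"
  proof (rule integrable_continuous)
    show "continuous_on (cbox 0 (2*pi)) (fx x0)"
    proof -
      have "continuous_on (cbox 0 (2*pi)) (\<lambda>t. (x0, t))" by (intro continuous_intros)
      moreover have "(\<lambda>t. (x0, t)) ` cbox 0 (2*pi) \<subseteq> ?U \<times> cbox 0 (2*pi)" using x0U by auto
      ultimately show ?thesis using continuous_on_compose2[OF contx] by fastforce
    qed
  qed
  then have ap: "blinfun_apply (integral (cbox 0 (2*pi)) (fx x0)) w = integral (cbox 0 (2*pi)) (\<lambda>t. fx x0 t w)" for w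
    by (rule blinfun_apply_integral)
  have lin: "blinfun_apply (integral (cbox 0 (2*pi)) (fx x0)) (c *s w) =
      c * blinfun_apply (integral (cbox 0 (2*pi)) (fx x0)) w" for c w
    unfolding ap fx[OF x0U] f'_def holo_fun_on_frechet(2)[OF f argS[OF x0U]]
    by (simp only: mult.assoc integral_mult_right)
  let ?k = "1 / (2 * of_real pi * of_real s) :: complex"
  have "((\<lambda>x. ?k * I x) has_derivative (\<lambda>w. ?k * blinfun_apply (integral (cbox 0 (2*pi)) (fx x0)) w)) (at x0)"
    by (rule has_derivative_mult_right[OF dI])
  then have "((\<lambda>x. frechet_derivative f (at x) v) has_derivative
      (\<lambda>w. ?k * blinfun_apply (integral (cbox 0 (2*pi)) (fx x0)) w)) (at x0)"
    by (rule has_derivative_transform_within_open[OF _ open_ball x0U]) (use s in \<open>simp only: I_def eq\<close>, simp)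
  then show "\<exists>g'. ((\<lambda>x. frechet_derivative f (at x) v) has_derivative g') (at x0) \<and>
      (\<forall>c w. g' (c *s w) = c * g' w)"
    using lin by (intro exI conjI) (auto simp: lin)
qed

lemma Ck_on_holo_fun:
  assumes "holo_fun_on f S" "open S"
  shows "Ck_on k f S"
  using assms(1)
proof (induction k arbitrary: f)
  case 0
  then show ?case by (simp add: continuous_on_holo_fun)
next
  case (Suc k)
  show ?case
    by (rule Ck_on_SucI[OF assms(2) holo_fun_on_frechet(1)[OF Suc.prems]
          Suc.IH[OF holo_fun_on_derivative[OF Suc.prems assms(2)]]])
qed

lemma Ck_on_holo_map:
  assumes "holo_map_on f S" "open S"
  shows "Ck_on k f S"
proof -
  have "Ck_on k (\<lambda>x. \<Sum>j\<in>UNIV. axis j (f x $ j)) S"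
    using assms by (intro Ck_on_sum Ck_on_linear_compose[OF bounded_linear_axis] Ck_on_holo_fun)
      (auto simp: holo_map_on_components)
  then show ?thesis by (simp add: sum_axis)
qed

lemma holo_map_on_derivative:
  assumes "holo_map_on f S" "open S"
  shows "holo_map_on (\<lambda>x. frechet_derivative f (at x) v) S"
  unfolding holo_map_on_components
proof
  fix j
  have h: "holo_fun_on (\<lambda>x. f x $ j) S" using assms by (simp add: holo_map_on_components)
  have eq: "frechet_derivative (\<lambda>x. f x $ j) (at x) v = frechet_derivative f (at x) v $ j" if "x \<in> S" for x
  proof -
    have "((\<lambda>x. f x $ j) has_derivative (\<lambda>v. frechet_derivative f (at x) v $ j)) (at x)"
      by (rule bounded_linear.has_derivative[OF bounded_linear_vec_nth holo_map_on_frechet(1)[OF assms(1) that]])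
    then show ?thesis using frechet_derivative_at by (metis (no_types, lifting))
  qed
  show "holo_fun_on (\<lambda>x. frechet_derivative f (at x) v $ j) S"
    unfolding holo_fun_on_def
  proof
    fix z assume z: "z \<in> S"
    obtain f' where f': "((\<lambda>x. frechet_derivative (\<lambda>x. f x $ j) (at x) v) has_derivative f') (at z)"
        "\<forall>c w. f' (c *s w) = c * f' w"
      using holo_fun_on_derivative[OF h assms(2), of v] z unfolding holo_fun_on_def by blast
    have "((\<lambda>x. frechet_derivative f (at x) v $ j) has_derivative f') (at z)"
      by (rule has_derivative_transform_within_open[OF f'(1) assms(2) z eq])
    then show "\<exists>f'. ((\<lambda>x. frechet_derivative f (at x) v $ j) has_derivative f') (at z) \<and>
        (\<forall>c w. f' (c *s w) = c * f' w)" using f'(2) by blast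
  qed
qed

section \<open>Strictly plurisubharmonic functions vanishing on totally real sets\<close>

text \<open>At a point the Taylor expansion of \<open>G\<close> produces a holomorphic minorant of
  \<open>\<parallel>G\<parallel>\<^sup>2 - \<kappa> \<parallel>z - q\<parallel>\<^sup>2\<close>: the quadratic form \<open>\<parallel>A v\<parallel>\<^sup>2\<close> is half of
  \<open>\<parallel>A v\<parallel>\<^sup>2 - \<parallel>A (\<i> v)\<parallel>\<^sup>2\<close>, which is pluriharmonic, plus half of
  \<open>\<parallel>A v\<parallel>\<^sup>2 + \<parallel>A (\<i> v)\<parallel>\<^sup>2\<close>, which is positive definite when the kernel of \<open>A\<close> is totally real.\<close>

lemma psh_norm_sq_compose:
  fixes G :: "complex^'n::finite \<Rightarrow> 'b::euclidean_space" and A :: "complex^'n \<Rightarrow> complex^'n \<Rightarrow> 'b"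
  assumes S: "open S" and contG: "continuous_on S G" and A: "\<And>z. z \<in> S \<Longrightarrow> bounded_linear (A z)"
    and taylor: "\<And>z y. z \<in> S \<Longrightarrow> y \<in> S \<Longrightarrow> norm (G y - G z - A z (y - z)) \<le> C * (norm (y - z))\<^sup>2"
    and a: "\<And>z v. z \<in> S \<Longrightarrow> norm (A z v) \<le> a * norm v" "0 \<le> a"
    and m: "\<And>z v. z \<in> S \<Longrightarrow> m * (norm v)\<^sup>2 \<le> (norm (A z v))\<^sup>2 + (norm (A z (\<i> *s v)))\<^sup>2"
    and \<eta>: "\<And>z. z \<in> S \<Longrightarrow> norm (G z) \<le> \<eta>" and C: "0 \<le> C" and small: "2 * C * \<eta> + \<kappa> < m / 2"
  shows "psh S (\<lambda>z. (norm (G z))\<^sup>2 - \<kappa> * (norm (z - q))\<^sup>2)"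
  unfolding psh_def
proof (intro conjI ballI)
  show "continuous_on S (\<lambda>z. (norm (G z))\<^sup>2 - \<kappa> * (norm (z - q))\<^sup>2)"
    by (intro continuous_intros contG)
  fix z assume z: "z \<in> S"
  interpret A: bounded_linear "A z" by (rule A[OF z])
  interpret J: bounded_linear "\<lambda>v::complex^'n. \<i> *s v" by (rule bounded_linear_i_scale)
  define l where "l v = 2 * (A z v \<bullet> G z) - 2 * \<kappa> * (v \<bullet> (z - q))" for v
  have l: "bounded_linear l" unfolding l_def
    by (intro bounded_linear_sub bounded_linear_const_mult bounded_linear_inner_left
        bounded_linear_compose[OF bounded_linear_inner_left A.bounded_linear_axioms])
  \<comment> \<open>The pluriharmonic half of |A v|^2, polarised; the discarded half is what
    \<open>m\<close> bounds from below.\<close>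
  define H where "H v w = (A z v \<bullet> A z w - A z (\<i> *s v) \<bullet> A z (\<i> *s w)) / 2" for v w
  have Hb: "bounded_bilinear H"
  proof -
    have "linear (H x)" for x
      by (rule linearI) (simp_all add: H_def A.add A.scaleR J.add J.scaleR inner_add_right field_simps)
    moreover have "linear (\<lambda>x. H x y)" for y
      by (rule linearI) (simp_all add: H_def A.add A.scaleR J.add J.scaleR inner_add_left field_simps)
    ultimately show ?thesis
      by (intro bilinear_conv_bounded_bilinear[THEN iffD1]) (simp add: bilinear_def)
  qed
  have Hsym: "H v w = H w v" for v w by (simp add: H_def inner_commute)
  have HJ: "H (\<i> *s v) (\<i> *s w) = - H v w" for v w
    by (simp add: H_def i_scale_i_scale A.neg field_simps)
  obtain d where d: "d > 0" "ball z d \<subseteq> S" using S z by (rule openE)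
  \<comment> \<open>The positive half contributes (m/2) |\<delta>|^2; the Taylor remainder costs up
    to 2 C (\<eta> + a |\<delta>|) |\<delta>|^2 and the last term \<kappa> |\<delta>|^2. The radius
    e keeps the part 2 C a |\<delta>| within the gap, and the 1 in its denominator covers the case C
    a = 0.\<close>
  define gap where "gap = m / 2 - (2 * C * \<eta> + \<kappa>)"
  have gap: "gap > 0" using small by (simp add: gap_def)
  define e where "e = min d (gap / (2 * C * a + 1))"
  have pos: "2 * C * a + 1 > 0" using C a(2) by (simp add: add_nonneg_pos)
  have e: "e > 0" "e \<le> d" "e \<le> gap / (2 * C * a + 1)" using d gap pos by (auto simp: e_def)
  have eg: "2 * C * a * e \<le> gap"
  proof -
    have "(2 * C * a + 1) * e \<le> gap" using e(3) pos by (simp add: field_simps)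
    then show ?thesis using e(1) by (simp add: algebra_simps)
  qed
  define F where "F y = of_real ((norm (G z))\<^sup>2 - \<kappa> * (norm (z - q))\<^sup>2)
      + (Complex (l (y - z)) (- l (\<i> *s (y - z))) + complexify H (y - z))" for y
  have "holo_fun_on F (ball z e)" unfolding F_def
    by (intro holo_fun_on_add holo_fun_on_const holo_fun_on_translate linear_Re_holo[OF l]
        holo_fun_on_complexify[OF Hb Hsym HJ])
  moreover have "Re (F z) = (norm (G z))\<^sup>2 - \<kappa> * (norm (z - q))\<^sup>2"
    by (simp add: F_def l_def complexify_def H_def A.zero J.zero)
  moreover have "Re (F y) \<le> (norm (G y))\<^sup>2 - \<kappa> * (norm (y - q))\<^sup>2" if y: "y \<in> ball z e" for y
  proof -
    define \<delta> where "\<delta> = y - z"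
    have yS: "y \<in> S" using y e d by auto
    have n\<delta>: "norm \<delta> < e" using y by (simp add: \<delta>_def dist_norm norm_minus_commute)
    define r where "r = G y - G z - A z \<delta>"
    have r: "norm r \<le> C * (norm \<delta>)\<^sup>2" using taylor[OF z yS] by (simp add: r_def \<delta>_def)
    have Gy: "G y = G z + A z \<delta> + r" by (simp add: r_def)
    have i1: "\<bar>(G z + A z \<delta>) \<bullet> r\<bar> \<le> (\<eta> + a * norm \<delta>) * (C * (norm \<delta>)\<^sup>2)"
    proof -
      have "\<bar>(G z + A z \<delta>) \<bullet> r\<bar> \<le> norm (G z + A z \<delta>) * norm r" by (rule Cauchy_Schwarz_ineq2)
      also have "\<dots> \<le> (\<eta> + a * norm \<delta>) * (C * (norm \<delta>)\<^sup>2)"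
        using \<eta>[OF z] a(1)[OF z, of \<delta>] norm_triangle_ineq[of "G z" "A z \<delta>"] r a(2) order_trans[OF norm_ge_zero \<eta>[OF z]]
        by (intro mult_mono) auto
      finally show ?thesis .
    qed
    have i2: "(norm (G y))\<^sup>2 = (norm (G z))\<^sup>2 + 2 * (A z \<delta> \<bullet> G z) + (norm (A z \<delta>))\<^sup>2
        + 2 * ((G z + A z \<delta>) \<bullet> r) + (norm r)\<^sup>2"
      unfolding Gy power2_norm_eq_inner by (simp add: inner_add_left inner_add_right inner_commute algebra_simps)
    have i3: "(norm (y - q))\<^sup>2 = (norm (z - q))\<^sup>2 + 2 * (\<delta> \<bullet> (z - q)) + (norm \<delta>)\<^sup>2"
      unfolding power2_norm_eq_inner \<delta>_def by (simp add: algebra_simps inner_commute)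
    have i4: "(norm (A z \<delta>))\<^sup>2 \<ge> H \<delta> \<delta> + m / 2 * (norm \<delta>)\<^sup>2"
      using m[OF z, of \<delta>] by (simp add: H_def power2_norm_eq_inner field_simps)
    have i5: "2 * ((\<eta> + a * norm \<delta>) * (C * (norm \<delta>)\<^sup>2)) + \<kappa> * (norm \<delta>)\<^sup>2 \<le> m / 2 * (norm \<delta>)\<^sup>2"
    proof -
      have "2 * C * a * norm \<delta> \<le> 2 * C * a * e" using n\<delta> C a(2) by (intro mult_left_mono) auto
      then have "2 * C * \<eta> + 2 * C * a * norm \<delta> + \<kappa> \<le> m / 2" using eg by (simp add: gap_def)
      then have "(2 * C * \<eta> + 2 * C * a * norm \<delta> + \<kappa>) * (norm \<delta>)\<^sup>2 \<le> m / 2 * (norm \<delta>)\<^sup>2"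
        by (intro mult_right_mono) auto
      then show ?thesis by (simp add: algebra_simps)
    qed
    have "Re (F y) = (norm (G z))\<^sup>2 - \<kappa> * (norm (z - q))\<^sup>2 + l \<delta> + H \<delta> \<delta>"
      by (simp add: F_def complexify_def \<delta>_def)
    moreover have "\<kappa> * (norm (y - q))\<^sup>2 = \<kappa> * (norm (z - q))\<^sup>2 + 2 * \<kappa> * (\<delta> \<bullet> (z - q)) + \<kappa> * (norm \<delta>)\<^sup>2"
      unfolding i3 by (simp add: algebra_simps)
    moreover have "(norm r)\<^sup>2 \<ge> 0" by simp
    ultimately show ?thesis using i1 i2 i4 i5 unfolding l_def abs_le_iff by linarith
  qed
  ultimately show "\<exists>F e. 0 < e \<and> holo_fun_on F (ball z e) \<and>
      Re (F z) = (norm (G z))\<^sup>2 - \<kappa> * (norm (z - q))\<^sup>2 \<and>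
      (\<forall>y\<in>ball z e. Re (F y) \<le> (norm (G y))\<^sup>2 - \<kappa> * (norm (y - q))\<^sup>2)"
    using e(1) by (intro exI[of _ F] exI[of _ e]) auto
qed


section \<open>Uniform derivative estimates and their use near a totally real kernel\<close>

lemma Ck_on_derivative_bound:
  fixes g :: "'a::euclidean_space \<Rightarrow> 'b::real_normed_vector"
  assumes "Ck_on 1 g N" "compact K" "K \<subseteq> N"
  obtains C where "C \<ge> 0" "\<And>x v. x \<in> K \<Longrightarrow> norm (frechet_derivative g (at x) v) \<le> C * norm v"
proof -
  have g: "\<And>x. x \<in> N \<Longrightarrow> (g has_derivative frechet_derivative g (at x)) (at x)"
      "\<And>v. continuous_on N (\<lambda>x. frechet_derivative g (at x) v)"
    using Ck_on_SucD[of 0 g N] assms(1) by auto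
  have "\<exists>C\<ge>0. \<forall>x\<in>K. norm (frechet_derivative g (at x) b) \<le> C" for b
  proof -
    have "compact ((\<lambda>x. frechet_derivative g (at x) b) ` K)"
      using compact_continuous_image[OF continuous_on_subset[OF g(2) assms(3)] assms(2)] .
    then obtain C where "\<forall>y\<in>(\<lambda>x. frechet_derivative g (at x) b) ` K. norm y \<le> C"
      using compact_imp_bounded bounded_iff by metis
    then show ?thesis by (intro exI[of _ "max C 0"]) auto
  qed
  then obtain C where C: "\<And>b. C b \<ge> 0" "\<And>b x. x \<in> K \<Longrightarrow> norm (frechet_derivative g (at x) b) \<le> C b"
    by metis
  show thesis
  proof (rule that)
    show "(\<Sum>b\<in>Basis. C b) \<ge> 0" by (intro sum_nonneg C)
    fix x v assume x: "x \<in> K"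
    have "norm (frechet_derivative g (at x) v) = norm (\<Sum>b\<in>Basis. (v \<bullet> b) *\<^sub>R frechet_derivative g (at x) b)"
      using linear_sum_Basis[OF has_derivative_linear[OF g(1)], of x v] x assms(3) by auto
    also have "\<dots> \<le> (\<Sum>b\<in>Basis. norm ((v \<bullet> b) *\<^sub>R frechet_derivative g (at x) b))" by (rule norm_sum)
    also have "\<dots> \<le> (\<Sum>b\<in>Basis. norm v * C b)"
      using C(2)[OF x] Basis_le_norm by (intro sum_mono) (auto intro!: mult_mono)
    finally show "norm (frechet_derivative g (at x) v) \<le> (\<Sum>b\<in>Basis. C b) * norm v"
      by (simp add: sum_distrib_left sum_distrib_right mult.commute[of "norm v"])
  qed
qed

lemma Ck_on_derivative_Lipschitz:
  fixes G :: "'a::euclidean_space \<Rightarrow> 'b::real_normed_vector"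
  assumes "Ck_on 2 G N" "cball x0 r \<subseteq> N"
  obtains C where "C \<ge> 0" "\<And>x y v. x \<in> cball x0 r \<Longrightarrow> y \<in> cball x0 r \<Longrightarrow>
      norm (frechet_derivative G (at y) v - frechet_derivative G (at x) v) \<le> C * norm (y - x) * norm v"
proof -
  let ?D = "\<lambda>x. frechet_derivative G (at x)"
  have G: "\<And>x. x \<in> N \<Longrightarrow> (G has_derivative ?D x) (at x)" "\<And>v. Ck_on 1 (\<lambda>x. ?D x v) N"
    using Ck_on_SucD[of 1 G N] assms(1) by (auto simp: numeral_2_eq_2)
  have "\<exists>C\<ge>0. \<forall>x\<in>cball x0 r. \<forall>y\<in>cball x0 r. norm (?D y b - ?D x b) \<le> C * norm (y - x)" for b
  proof -
    obtain C where C: "C \<ge> 0" "\<And>x v. x \<in> cball x0 r \<Longrightarrow>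
        norm (frechet_derivative (\<lambda>x. ?D x b) (at x) v) \<le> C * norm v"
      using Ck_on_derivative_bound[OF G(2) compact_cball assms(2)] by metis
    have "norm (?D y b - ?D x b) \<le> C * norm (y - x)" if "x \<in> cball x0 r" "y \<in> cball x0 r" for x y
    proof (rule differentiable_bound[OF convex_cball, of x0 r "\<lambda>x. ?D x b" "\<lambda>x. frechet_derivative (\<lambda>x. ?D x b) (at x)"])
      fix z assume z: "z \<in> cball x0 r"
      show "((\<lambda>x. ?D x b) has_derivative frechet_derivative (\<lambda>x. ?D x b) (at z)) (at z within cball x0 r)"
        by (rule has_derivative_at_withinI, rule Ck_on_SucD(1)[of 0 "\<lambda>x. ?D x b" N])
           (use G(2)[of b] z assms(2) in auto)
      show "onorm (frechet_derivative (\<lambda>x. ?D x b) (at z)) \<le> C"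
        by (rule onorm_bound[OF C(1) C(2)[OF z]])
    qed (use that in auto)
    then show ?thesis using C(1) by blast
  qed
  then obtain C where C: "\<And>b. C b \<ge> 0" "\<And>b x y. x \<in> cball x0 r \<Longrightarrow> y \<in> cball x0 r \<Longrightarrow>
      norm (?D y b - ?D x b) \<le> C b * norm (y - x)" by metis
  show thesis
  proof (rule that)
    show "(\<Sum>b\<in>Basis. C b) \<ge> 0" by (intro sum_nonneg C)
    fix x y v assume xy: "x \<in> cball x0 r" "y \<in> cball x0 r"
    have "linear (\<lambda>v. ?D y v - ?D x v)"
      using xy assms(2) by (intro linear_compose_sub has_derivative_linear[OF G(1)]) auto
    then have "norm (?D y v - ?D x v) = norm (\<Sum>b\<in>Basis. (v \<bullet> b) *\<^sub>R (?D y b - ?D x b))"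
      using linear_sum_Basis[of "\<lambda>v. ?D y v - ?D x v" v] by simp
    also have "\<dots> \<le> (\<Sum>b\<in>Basis. norm ((v \<bullet> b) *\<^sub>R (?D y b - ?D x b)))" by (rule norm_sum)
    also have "\<dots> \<le> (\<Sum>b\<in>Basis. norm v * (C b * norm (y - x)))"
      using C(2)[OF xy] Basis_le_norm by (intro sum_mono) (auto intro!: mult_mono)
    also have "\<dots> = (\<Sum>b\<in>Basis. C b) * norm (y - x) * norm v"
      by (simp add: sum_distrib_left sum_distrib_right mult_ac)
    finally show "norm (?D y v - ?D x v) \<le> (\<Sum>b\<in>Basis. C b) * norm (y - x) * norm v" .
  qed
qed

text \<open>The hypothesis says that the kernel of the derivative at 0 contains no complex line, so
  |A v|^2 + |A (i v)|^2 is positive definite at 0 and, by continuity of the derivative, uniformly so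
  nearby. As G vanishes at 0, its values on a small ball are small compared with this bound.\<close>

lemma psh_near_totally_real_zero:
  fixes G :: "complex^'n::finite \<Rightarrow> 'b::euclidean_space"
  assumes G: "Ck_on 2 G N" "open N" "0 \<in> N" "G 0 = 0"
    and real: "\<And>v. frechet_derivative G (at 0) v = 0 \<Longrightarrow> frechet_derivative G (at 0) (\<i> *s v) = 0 \<Longrightarrow> v = 0"
  obtains r \<kappa> where "r > 0" "\<kappa> > 0" "ball 0 r \<subseteq> N"
    "\<And>q. psh (ball 0 r) (\<lambda>z. (norm (G z))\<^sup>2 - \<kappa> * (norm (z - q))\<^sup>2)"
proof -
  let ?D = "\<lambda>x. frechet_derivative G (at x)"
  have D: "(G has_derivative ?D x) (at x)" if "x \<in> N" for x
    using Ck_on_SucD(1)[of 1 G N x] G(1) that by (auto simp: numeral_2_eq_2)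
  obtain r0 where r0: "r0 > 0" "cball 0 r0 \<subseteq> N" using G(2,3) open_contains_cball by blast
  obtain C where C: "C \<ge> 0" "\<And>x y v. x \<in> cball 0 r0 \<Longrightarrow> y \<in> cball 0 r0 \<Longrightarrow>
      norm (?D y v - ?D x v) \<le> C * norm (y - x) * norm v"
    using Ck_on_derivative_Lipschitz[OF G(1) r0(2)] by blast
  have "Ck_on 1 G N" using Ck_on_le[OF G(1), of 1] by simp
  then obtain a where a: "a \<ge> 0" "\<And>x v. x \<in> cball 0 r0 \<Longrightarrow> norm (?D x v) \<le> a * norm v"
    using Ck_on_derivative_bound[OF _ compact_cball r0(2)] by metis
  have lin: "bounded_linear (?D x)" if "x \<in> N" for x
    using has_derivative_bounded_linear[OF D[OF that]] .
  interpret D0: bounded_linear "?D 0" by (rule lin[OF G(3)])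
  define f where "f v = (norm (?D 0 v))\<^sup>2 + (norm (?D 0 (\<i> *s v)))\<^sup>2" for v
  have "continuous_on (sphere 0 1) f" unfolding f_def
    by (intro continuous_intros linear_continuous_on D0.bounded_linear_axioms
        bounded_linear_compose[OF D0.bounded_linear_axioms bounded_linear_i_scale])
  moreover have "sphere (0::complex^'n) 1 \<noteq> {}" by simp
  ultimately obtain v0 where v0: "v0 \<in> sphere 0 1" "\<And>v. v \<in> sphere 0 1 \<Longrightarrow> f v0 \<le> f v"
    using continuous_attains_inf[OF compact_sphere] by blast
  define m where "m = f v0"
  have "v0 \<noteq> 0" using v0(1) by auto
  then have "?D 0 v0 \<noteq> 0 \<or> ?D 0 (\<i> *s v0) \<noteq> 0" using real[of v0] by blast
  then have m: "m > 0" unfolding m_def f_def by (auto intro: add_pos_nonneg add_nonneg_pos)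
  have fm: "m * (norm v)\<^sup>2 \<le> f v" for v
  proof (cases "v = 0")
    case True then show ?thesis by (simp add: f_def)
  next
    case False
    define w where "w = (1 / norm v) *\<^sub>R v"
    have "w \<in> sphere 0 1" using False by (simp add: w_def)
    then have "m \<le> f w" using v0(2) by (simp add: m_def)
    moreover have v: "v = norm v *\<^sub>R w" using False by (simp add: w_def)
    have "\<i> *s v = norm v *\<^sub>R (\<i> *s w)" by (subst v) (simp add: vec_eq_iff)
    then have "f v = (norm v)\<^sup>2 * f w"
      unfolding f_def by (subst (1) v) (simp add: D0.scaleR power_mult_distrib algebra_simps)
    ultimately show ?thesis by (simp add: mult.commute mult_right_mono)
  qed
  \<comment> \<open>Two conditions are met at once: (C r)^2 \<le> m/64, so that the constant of
    positivity drops only from m to m/4, and C a r \<le> m/64, so that the bound a r on |G|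
    satisfies 2 C a r + m/16 < m/8. The bound r \<le> 1 lets C C r control (C r)^2.\<close>
  define r where "r = min (min r0 1) (m / (64 * (C * C + C * a + 1)))"
  have den: "C * C + C * a + 1 > 0" using C(1) a(1) by (simp add: add_nonneg_pos)
  have r: "r > 0" "r \<le> r0" "r \<le> 1" "r * (C * C + C * a + 1) \<le> m / 64"
  proof -
    have "r \<le> m / (64 * (C * C + C * a + 1))" by (simp add: r_def)
    then have "r * (64 * (C * C + C * a + 1)) \<le> m" using den by (simp add: pos_le_divide_eq)
    then show "r * (C * C + C * a + 1) \<le> m / 64" by (simp add: algebra_simps)
  qed (use r0 m den in \<open>auto simp: r_def\<close>)
  have CC: "C * C * r \<le> m / 64" "C * a * r \<le> m / 64"
    using r(4) mult_nonneg_nonneg[OF mult_nonneg_nonneg[OF C(1) C(1)], of r]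
      mult_nonneg_nonneg[OF mult_nonneg_nonneg[OF C(1) a(1)], of r] r(1)
    by (auto simp: algebra_simps)
  have bin: "z \<in> cball 0 r0" "z \<in> N" if "z \<in> ball 0 r" for z using that r(2) r0(2) by auto
  have taylor: "norm (G y - G z - ?D z (y - z)) \<le> C * (norm (y - z))\<^sup>2"
    if "z \<in> ball 0 r" "y \<in> ball 0 r" for z y
  proof -
    let ?S = "cball z (norm (y - z)) \<inter> cball 0 r0"
    have "norm (G y - G z - ?D z (y - z)) \<le> norm (y - z) * (C * norm (y - z))"
    proof (rule differentiable_bound_linearization[of z y ?S])
      show "z + t *\<^sub>R (y - z) \<in> ?S" if "t \<in> {0..1}" for t
      proof -
        have "convex ?S" by (intro convex_Int convex_cball)
        moreover have "z \<in> ?S" "y \<in> ?S" using bin \<open>z \<in> ball 0 r\<close> \<open>y \<in> ball 0 r\<close>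
          by (auto simp: dist_norm norm_minus_commute)
        ultimately have "(1 - t) *\<^sub>R z + t *\<^sub>R y \<in> ?S" using that by (intro convexD) auto
        then show ?thesis by (simp add: algebra_simps)
      qed
      show "(G has_derivative ?D x) (at x within ?S)" if "x \<in> ?S" for x
        by (rule has_derivative_at_withinI, rule D) (use that r0(2) in auto)
      show "onorm (?D x - ?D z) \<le> C * norm (y - z)" if x: "x \<in> ?S" for x
        unfolding fun_diff_def
      proof (rule onorm_bound)
        fix v
        have "norm (?D x v - ?D z v) \<le> C * norm (x - z) * norm v"
          using C(2)[of z x v] bin(1)[OF \<open>z \<in> ball 0 r\<close>] x by auto
        also have "\<dots> \<le> C * norm (y - z) * norm v"
          using x C(1) by (intro mult_right_mono mult_left_mono) (auto simp: dist_norm norm_minus_commute)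
        finally show "norm (?D x v - ?D z v) \<le> C * norm (y - z) * norm v" .
      qed (use C(1) in auto)
      show "z \<in> ?S" using bin that by auto
    qed
    then show ?thesis by (simp add: power2_eq_square mult_ac)
  qed
  have low: "m / 4 * (norm v)\<^sup>2 \<le> (norm (?D z v))\<^sup>2 + (norm (?D z (\<i> *s v)))\<^sup>2" if z: "z \<in> ball 0 r" for z v
  proof -
    have half: "(norm (?D 0 w))\<^sup>2 / 2 - (C * r * norm w)\<^sup>2 \<le> (norm (?D z w))\<^sup>2" for w
    proof -
      have 1: "norm (?D z w - ?D 0 w) \<le> C * norm z * norm w"
        using C(2)[of 0 z w] bin(1)[OF z] r0(1) by simp
      also have "\<dots> \<le> C * r * norm w" using z C(1) by (intro mult_right_mono mult_left_mono) auto
      finally have "norm (?D 0 w) \<le> norm (?D z w) + C * r * norm w"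
        using norm_triangle_ineq2[of "?D 0 w" "?D z w"] by (simp add: norm_minus_commute)
      then have "(norm (?D 0 w))\<^sup>2 \<le> (norm (?D z w) + C * r * norm w)\<^sup>2" by (intro power_mono) auto
      also have "\<dots> \<le> 2 * (norm (?D z w))\<^sup>2 + 2 * (C * r * norm w)\<^sup>2"
        using sum_squares_bound[of "norm (?D z w)" "C * r * norm w"] by (simp add: power2_sum)
      finally show ?thesis by simp
    qed
    have "(C * r * norm v)\<^sup>2 \<le> m / 64 * (norm v)\<^sup>2"
    proof -
      have "(C * r)\<^sup>2 = C * C * r * r" by (simp add: power2_eq_square mult_ac)
      also have "\<dots> \<le> m / 64 * 1" using CC(1) r(1,3) m by (intro mult_mono) auto
      finally have "(C * r)\<^sup>2 \<le> m / 64" by simp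
      from mult_right_mono[OF this, of "(norm v)\<^sup>2"] show ?thesis by (simp add: power_mult_distrib)
    qed
    moreover have "m * (norm v)\<^sup>2 \<ge> 0" using m by simp
    ultimately show ?thesis using half[of v] half[of "\<i> *s v"] fm[of v]
      unfolding f_def norm_i_scale by argo
  qed
  show thesis
  proof (rule that[of r "m / 16"])
    fix q
    show "psh (ball 0 r) (\<lambda>z. (norm (G z))\<^sup>2 - m / 16 * (norm (z - q))\<^sup>2)"
    proof (rule psh_norm_sq_compose[OF open_ball _ lin taylor a(2) a(1) low])
      show "continuous_on (ball 0 r) G"
        by (rule continuous_at_imp_continuous_on, rule ballI, rule has_derivative_continuous, rule D, rule bin)
      show "norm (G z) \<le> a * r" if z: "z \<in> ball 0 r" for z
      proof -
        have "norm (G z - G 0) \<le> a * norm (z - 0)"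
        proof (rule differentiable_bound[OF convex_cball, of 0 r0 G ?D])
          fix x assume x: "x \<in> cball (0::complex^'n) r0"
          show "(G has_derivative ?D x) (at x within cball 0 r0)"
            by (rule has_derivative_at_withinI, rule D) (use x r0(2) in auto)
          show "onorm (?D x) \<le> a" by (rule onorm_bound[OF a(1) a(2)[OF x]])
        qed (use z r(2) r0 in auto)
        also have "\<dots> \<le> a * r" using z a(1) by (intro mult_left_mono) auto
        finally show ?thesis using G(4) by simp
      qed
      show "2 * C * (a * r) + m / 16 < m / 4 / 2" using CC(2) m by (simp add: mult.assoc)
    qed (use bin C in auto)
  qed (use r m bin in auto)
qed

section \<open>Coordinates on complex manifolds\<close>

locale complex_manifold =
  fixes A :: "('m::{t2_space, second_countable_topology}, 'n::finite) chart set"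
  assumes atlas: "complex_atlas A"
begin

definition transition :: "('m, 'n) chart \<Rightarrow> ('m, 'n) chart \<Rightarrow> complex^'n \<Rightarrow> complex^'n" where
  "transition \<phi> \<psi> = snd \<psi> \<circ> chart_inv \<phi>"

text \<open>The base point is a point of the manifold rather than of a chart, so that the chain rule
  becomes a cocycle identity over a fixed p.\<close>

definition dtrans :: "('m, 'n) chart \<Rightarrow> ('m, 'n) chart \<Rightarrow> 'm \<Rightarrow> complex^'n \<Rightarrow> complex^'n" where
  "dtrans \<phi> \<psi> p = frechet_derivative (transition \<phi> \<psi>) (at (snd \<phi> p))"

lemma chart_covers: obtains \<phi> where "\<phi> \<in> A" "p \<in> fst \<phi>"
  using atlas unfolding complex_atlas_def by blast

context
  fixes \<phi> assumes \<phi>: "\<phi> \<in> A"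
begin

lemma chart_homeo: "homeomorphism (fst \<phi>) (snd \<phi> ` fst \<phi>) (snd \<phi>) (chart_inv \<phi>)"
  and open_chart_dom: "open (fst \<phi>)" and open_chart_range: "open (snd \<phi> ` fst \<phi>)"
  using atlas \<phi> unfolding complex_atlas_def by auto

lemma chart_inv_chart: "x \<in> fst \<phi> \<Longrightarrow> chart_inv \<phi> (snd \<phi> x) = x"
  using chart_homeo by (simp add: homeomorphism_def)

lemma chart_chart_inv: "z \<in> snd \<phi> ` fst \<phi> \<Longrightarrow> snd \<phi> (chart_inv \<phi> z) = z"
  using chart_homeo by (auto simp: homeomorphism_def)

lemma chart_inv_in: "z \<in> snd \<phi> ` fst \<phi> \<Longrightarrow> chart_inv \<phi> z \<in> fst \<phi>"
  using chart_homeo by (auto simp: homeomorphism_def)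

lemma continuous_on_chart: "continuous_on (fst \<phi>) (snd \<phi>)"
  and continuous_on_chart_inv: "continuous_on (snd \<phi> ` fst \<phi>) (chart_inv \<phi>)"
  using chart_homeo by (auto simp: homeomorphism_def)

lemma chart_image_eq: "snd \<phi> ` (fst \<phi> \<inter> O') = snd \<phi> ` fst \<phi> \<inter> chart_inv \<phi> -` O'"
  using chart_inv_chart by (auto simp: chart_inv_in chart_chart_inv intro!: rev_image_eqI)

lemma open_chart_image: "open O' \<Longrightarrow> open (snd \<phi> ` (fst \<phi> \<inter> O'))"
  unfolding chart_image_eq by (rule continuous_open_preimage[OF continuous_on_chart_inv open_chart_range])

lemma chart_inv_image_eq:
  assumes "Z \<subseteq> snd \<phi> ` fst \<phi>"
  shows "chart_inv \<phi> ` Z = fst \<phi> \<inter> snd \<phi> -` Z"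
proof (intro equalityI subsetI)
  fix x assume "x \<in> chart_inv \<phi> ` Z"
  then obtain z where "z \<in> Z" "x = chart_inv \<phi> z" by blast
  then show "x \<in> fst \<phi> \<inter> snd \<phi> -` Z" using assms chart_inv_in chart_chart_inv by auto
next
  fix x assume "x \<in> fst \<phi> \<inter> snd \<phi> -` Z"
  then show "x \<in> chart_inv \<phi> ` Z" using chart_inv_chart[of x] by (metis IntD1 IntD2 image_eqI vimageD)
qed

lemma open_chart_inv_image:
  assumes "open Z" "Z \<subseteq> snd \<phi> ` fst \<phi>"
  shows "open (chart_inv \<phi> ` Z)"
  unfolding chart_inv_image_eq[OF assms(2)]
  by (rule continuous_open_preimage[OF continuous_on_chart open_chart_dom assms(1)])

lemma transition_holo: "\<psi> \<in> A \<Longrightarrow> holo_map_on (transition \<phi> \<psi>) (snd \<phi> ` (fst \<phi> \<inter> fst \<psi>))"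
  using atlas \<phi> unfolding complex_atlas_def transition_def by blast

lemma transition_Ck: "\<psi> \<in> A \<Longrightarrow> Ck_on k (transition \<phi> \<psi>) (snd \<phi> ` (fst \<phi> \<inter> fst \<psi>))"
  using Ck_on_holo_map[OF transition_holo open_chart_image] atlas unfolding complex_atlas_def by blast

end

lemma transition_chart: "\<phi> \<in> A \<Longrightarrow> x \<in> fst \<phi> \<Longrightarrow> transition \<phi> \<psi> (snd \<phi> x) = snd \<psi> x"
  by (simp add: transition_def chart_inv_chart)

lemma dtrans_has_derivative:
  assumes "\<phi> \<in> A" "\<psi> \<in> A" "p \<in> fst \<phi>" "p \<in> fst \<psi>"
  shows "(transition \<phi> \<psi> has_derivative dtrans \<phi> \<psi> p) (at (snd \<phi> p))"
  unfolding dtrans_def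
  by (rule holo_map_on_frechet(1)[OF transition_holo[OF assms(1,2)]]) (use assms in auto)

lemma dtrans_scale:
  assumes "\<phi> \<in> A" "\<psi> \<in> A" "p \<in> fst \<phi>" "p \<in> fst \<psi>"
  shows "dtrans \<phi> \<psi> p (c *s v) = c *s dtrans \<phi> \<psi> p v"
  unfolding dtrans_def
  by (rule holo_map_on_frechet(2)[OF transition_holo[OF assms(1,2)]]) (use assms in auto)

lemma dtrans_linear:
  assumes "\<phi> \<in> A" "\<psi> \<in> A" "p \<in> fst \<phi>" "p \<in> fst \<psi>"
  shows "linear (dtrans \<phi> \<psi> p)"
  using has_derivative_linear[OF dtrans_has_derivative[OF assms]] .

lemma dtrans_cocycle:
  assumes "\<phi> \<in> A" "\<psi> \<in> A" "\<xi> \<in> A" "p \<in> fst \<phi>" "p \<in> fst \<psi>" "p \<in> fst \<xi>"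
  shows "dtrans \<psi> \<xi> p (dtrans \<phi> \<psi> p v) = dtrans \<phi> \<xi> p v"
proof -
  have "((\<lambda>z. transition \<psi> \<xi> (transition \<phi> \<psi> z)) has_derivative (\<lambda>v. dtrans \<psi> \<xi> p (dtrans \<phi> \<psi> p v))) (at (snd \<phi> p))"
    by (rule has_derivative_compose[OF dtrans_has_derivative[OF assms(1,2,4,5)]])
       (use dtrans_has_derivative[OF assms(2,3,5,6)] assms in \<open>simp add: transition_chart\<close>)
  then have "(transition \<phi> \<xi> has_derivative (\<lambda>v. dtrans \<psi> \<xi> p (dtrans \<phi> \<psi> p v))) (at (snd \<phi> p))"
  proof (rule has_derivative_transform_within_open)
    show "open (snd \<phi> ` (fst \<phi> \<inter> fst \<psi>))" by (intro open_chart_image open_chart_dom assms)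
    show "snd \<phi> p \<in> snd \<phi> ` (fst \<phi> \<inter> fst \<psi>)" using assms by auto
    show "transition \<psi> \<xi> (transition \<phi> \<psi> z) = transition \<phi> \<xi> z" if "z \<in> snd \<phi> ` (fst \<phi> \<inter> fst \<psi>)" for z
      using that assms by (auto simp: transition_chart)
  qed
  then have "dtrans \<phi> \<xi> p = (\<lambda>v. dtrans \<psi> \<xi> p (dtrans \<phi> \<psi> p v))"
    unfolding dtrans_def[of \<phi> \<xi>] using frechet_derivative_at by metis
  then show ?thesis by simp
qed

lemma dtrans_same:
  assumes "\<phi> \<in> A" "p \<in> fst \<phi>"
  shows "dtrans \<phi> \<phi> p v = v"
proof -
  have "(transition \<phi> \<phi> has_derivative (\<lambda>v. v)) (at (snd \<phi> p))"
  proof (rule has_derivative_transform_within_open[OF has_derivative_ident open_chart_range[OF assms(1)]])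
    show "z = transition \<phi> \<phi> z" if "z \<in> snd \<phi> ` fst \<phi>" for z
      using that assms by (auto simp: transition_chart)
  qed (use assms in auto)
  then have "dtrans \<phi> \<phi> p = (\<lambda>v. v)"
    unfolding dtrans_def using frechet_derivative_at by metis
  then show ?thesis by simp
qed

lemma coord_vec_eq:
  "coord_vec A \<phi> p a = (\<lambda>\<psi>. if \<psi> \<in> A \<and> p \<in> fst \<psi> then dtrans \<phi> \<psi> p a else 0)"
  by (auto simp: fun_eq_iff coord_vec_def dtrans_def transition_def)

lemma coord_vec_self: "\<phi> \<in> A \<Longrightarrow> p \<in> fst \<phi> \<Longrightarrow> coord_vec A \<phi> p a \<phi> = a"
  by (simp add: coord_vec_eq dtrans_same)

lemma coord_vec_tangent:
  assumes "\<phi> \<in> A" "p \<in> fst \<phi>"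
  shows "coord_vec A \<phi> p a \<in> tangent_space A p"
  unfolding tangent_space_def coord_vec_eq
  using assms dtrans_cocycle[OF assms(1) _ _ assms(2)]
  by (auto simp flip: transition_def dtrans_def)

lemma coord_vec_change:
  assumes "\<phi> \<in> A" "p \<in> fst \<phi>" "\<psi> \<in> A" "p \<in> fst \<psi>"
  shows "coord_vec A \<psi> p (dtrans \<phi> \<psi> p a) = coord_vec A \<phi> p a"
  unfolding coord_vec_eq using assms dtrans_cocycle[OF assms(1,3) _ assms(2,4)] by auto

lemma coord_vec_add:
  assumes "\<phi> \<in> A" "p \<in> fst \<phi>"
  shows "coord_vec A \<phi> p (a + b) = tv_add (coord_vec A \<phi> p a) (coord_vec A \<phi> p b)"
  unfolding coord_vec_eq tv_add_def using linear_add[OF dtrans_linear[OF assms(1) _ assms(2)]] by auto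

lemma coord_vec_scaleR:
  assumes "\<phi> \<in> A" "p \<in> fst \<phi>"
  shows "coord_vec A \<phi> p (r *\<^sub>R a) = tv_scale r (coord_vec A \<phi> p a)"
  unfolding coord_vec_eq tv_scale_def using linear_cmul[OF dtrans_linear[OF assms(1) _ assms(2)]] by auto

lemma coord_vec_J:
  assumes "\<phi> \<in> A" "p \<in> fst \<phi>"
  shows "coord_vec A \<phi> p (\<i> *s a) = Jop (coord_vec A \<phi> p a)"
  unfolding coord_vec_eq Jop_def using dtrans_scale[OF assms(1) _ assms(2)] by auto

lemma coord_vec_eq_zero_iff:
  assumes "\<phi> \<in> A" "p \<in> fst \<phi>"
  shows "coord_vec A \<phi> p a = tv_zero \<longleftrightarrow> a = 0"
proof
  assume "coord_vec A \<phi> p a = tv_zero"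
  then show "a = 0" using coord_vec_self[OF assms, of a] by (simp add: tv_zero_def)
next
  assume "a = 0"
  then show "coord_vec A \<phi> p a = tv_zero"
    unfolding coord_vec_eq tv_zero_def using linear_0[OF dtrans_linear[OF assms(1) _ assms(2)]] by auto
qed

text \<open>By the chain rule the derivative in one chart determines the components of the velocity
  in all others.\<close>

lemma velocity_eq_coord_vec:
  assumes \<phi>: "\<phi> \<in> A" "\<gamma> t \<in> fst \<phi>" and I: "open I" "t \<in> I" "continuous_on I \<gamma>"
    and d: "((snd \<phi> \<circ> \<gamma>) has_vector_derivative w) (at t)"
  shows "velocity A \<gamma> t = coord_vec A \<phi> (\<gamma> t) w"
proof
  fix \<psi>
  show "velocity A \<gamma> t \<psi> = coord_vec A \<phi> (\<gamma> t) w \<psi>"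
  proof (cases "\<psi> \<in> A \<and> \<gamma> t \<in> fst \<psi>")
    case True
    then have \<psi>: "\<psi> \<in> A" "\<gamma> t \<in> fst \<psi>" by auto
    let ?I = "I \<inter> \<gamma> -` (fst \<phi>)"
    have oI: "open ?I" by (rule continuous_open_preimage[OF I(3,1) open_chart_dom[OF \<phi>(1)]])
    have "((\<lambda>s. transition \<phi> \<psi> ((snd \<phi> \<circ> \<gamma>) s)) has_derivative (\<lambda>r. dtrans \<phi> \<psi> (\<gamma> t) (r *\<^sub>R w))) (at t)"
      by (rule has_derivative_compose[OF d[unfolded has_vector_derivative_def]])
         (use dtrans_has_derivative[OF \<phi>(1) \<psi>(1) \<phi>(2) \<psi>(2)] in simp)
    then have "((\<lambda>s. transition \<phi> \<psi> ((snd \<phi> \<circ> \<gamma>) s)) has_vector_derivative dtrans \<phi> \<psi> (\<gamma> t) w) (at t)"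
      unfolding has_vector_derivative_def
      using linear_cmul[OF dtrans_linear[OF \<phi>(1) \<psi>(1) \<phi>(2) \<psi>(2)]] by simp
    then have "((snd \<psi> \<circ> \<gamma>) has_vector_derivative dtrans \<phi> \<psi> (\<gamma> t) w) (at t)"
      by (rule has_vector_derivative_transform_within_open[OF _ oI]) (use I \<phi> in \<open>auto simp: transition_chart\<close>)
    then show ?thesis using \<psi> by (simp add: velocity_def coord_vec_eq vector_derivative_at)
  next
    case False
    then show ?thesis by (auto simp: velocity_def coord_vec_eq)
  qed
qed

end

section \<open>The two-form at a point as a bilinear form on the coordinate space\<close>

locale taming_form = complex_manifold A
  for A :: "('m::{t2_space, second_countable_topology}, 'n::finite) chart set" +
  fixes \<omega> :: "('m, 'n) two_form"
  assumes smooth_form: "smooth_two_form A \<omega>" and tame: "tames_J A \<omega>"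
begin

definition form_at :: "('m, 'n) chart \<Rightarrow> 'm \<Rightarrow> complex^'n \<Rightarrow> complex^'n \<Rightarrow> real" where
  "form_at \<phi> p a b = \<omega> p (coord_vec A \<phi> p a) (coord_vec A \<phi> p b)"

lemma form_coeff_eq: "form_coeff A \<omega> \<phi> a b = (\<lambda>z. form_at \<phi> (chart_inv \<phi> z) a b)"
  by (simp add: form_coeff_def form_at_def)

lemma form_at_bilinear:
  assumes "\<phi> \<in> A" "p \<in> fst \<phi>"
  shows "form_at \<phi> p (a + b) c = form_at \<phi> p a c + form_at \<phi> p b c"
    and "form_at \<phi> p (r *\<^sub>R a) c = r * form_at \<phi> p a c"
    and "form_at \<phi> p a c = - form_at \<phi> p c a"
    and "form_at \<phi> p c (a + b) = form_at \<phi> p c a + form_at \<phi> p c b"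
    and "form_at \<phi> p c (r *\<^sub>R a) = r * form_at \<phi> p c a"
proof -
  have alt: "alternating_bilinear_on (tangent_space A p) (\<omega> p)"
    using smooth_form by (auto simp: smooth_two_form_def)
  note T = coord_vec_tangent[OF assms]
  show 1: "form_at \<phi> p (a + b) c = form_at \<phi> p a c + form_at \<phi> p b c" for a b c
    using alt T unfolding alternating_bilinear_on_def form_at_def coord_vec_add[OF assms] by blast
  show 2: "form_at \<phi> p (r *\<^sub>R a) c = r * form_at \<phi> p a c" for r a c
    using alt T unfolding alternating_bilinear_on_def form_at_def coord_vec_scaleR[OF assms] by blast
  show 3: "form_at \<phi> p a c = - form_at \<phi> p c a" for a c
    using alt T unfolding alternating_bilinear_on_def form_at_def by blast
  show "form_at \<phi> p c (a + b) = form_at \<phi> p c a + form_at \<phi> p c b"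
    using 1[of a b c] 3[of c] by simp
  show "form_at \<phi> p c (r *\<^sub>R a) = r * form_at \<phi> p c a"
    using 2[of r a c] 3[of c] by simp
qed

lemma bounded_bilinear_form_at:
  assumes "\<phi> \<in> A" "p \<in> fst \<phi>"
  shows "bounded_bilinear (form_at \<phi> p)"
  by (rule bilinear_conv_bounded_bilinear[THEN iffD1])
     (auto simp: bilinear_def form_at_bilinear(1,2,4,5)[OF assms] intro!: linearI)

lemma form_at_tame:
  assumes "\<phi> \<in> A" "p \<in> fst \<phi>" "a \<noteq> 0"
  shows "form_at \<phi> p a (\<i> *s a) > 0"
  using tame coord_vec_tangent[OF assms(1,2)] assms
  unfolding tames_J_def form_at_def coord_vec_J[OF assms(1,2)]
  by (auto simp: coord_vec_eq_zero_iff)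

lemma riem_metric_coord:
  assumes "\<phi> \<in> A" "p \<in> fst \<phi>"
  shows "riem_metric \<omega> p (coord_vec A \<phi> p a) (coord_vec A \<phi> p a) = form_at \<phi> p a (\<i> *s a)"
  unfolding riem_metric_def form_at_def coord_vec_J[OF assms] by simp

end

section \<open>Defining maps of submanifolds\<close>

text \<open>The map is the identity minus the orthogonal projection onto E; it turns the slice
  condition of a submanifold into an equation.\<close>

lemma subspace_kernel_projection:
  fixes E :: "'a::euclidean_space set"
  assumes "subspace E"
  obtains \<pi> :: "'a \<Rightarrow> 'a" where "bounded_linear \<pi>" "\<And>x. \<pi> x = 0 \<longleftrightarrow> x \<in> E"
proof -
  obtain B where B: "B \<subseteq> E" "pairwise orthogonal B" "\<And>x. x \<in> B \<Longrightarrow> norm x = 1"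
      "independent B" "span B = E"
    using orthonormal_basis_subspace[OF assms] by metis
  have finB: "finite B" using B(4) by (simp add: independent_imp_finite)
  define \<pi> where "\<pi> x = x - (\<Sum>b\<in>B. (x \<bullet> b) *\<^sub>R b)" for x :: 'a
  have "linear \<pi>" unfolding \<pi>_def
    by (rule linearI) (auto simp: algebra_simps inner_add_left sum.distrib scaleR_sum_right)
  then have "bounded_linear \<pi>" by (simp add: linear_conv_bounded_linear)
  moreover have "\<pi> x = 0 \<longleftrightarrow> x \<in> E" for x
  proof
    assume "\<pi> x = 0"
    then have "x = (\<Sum>b\<in>B. (x \<bullet> b) *\<^sub>R b)" by (simp add: \<pi>_def)
    then show "x \<in> E" using B(1) assms by (metis (no_types, lifting) subspace_scale subspace_sum subsetD)
  next
    assume "x \<in> E"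
    then have "(\<Sum>b\<in>B. (x \<bullet> b) *\<^sub>R b) = x"
      by (intro orthonormal_basis_expand) (use B finB in auto)
    then show "\<pi> x = 0" by (simp add: \<pi>_def)
  qed
  ultimately show thesis using that by blast
qed

context complex_manifold
begin

text \<open>Composing a slice chart with a linear map whose kernel is the slice gives G. A kernel
  vector of its derivative is the velocity of a straight line in the slice, pulled back to the
  manifold; conversely G is constant along curves in L, so their velocities lie in the
  kernel.\<close>

lemma submanifold_defining_map:
  assumes L: "embedded_submanifold A k L" "p \<in> L" and \<phi>: "\<phi> \<in> A" "p \<in> fst \<phi>"
  obtains N and G :: "complex^'n \<Rightarrow> complex^'n"
  where "open N" "snd \<phi> p \<in> N" "N \<subseteq> snd \<phi> ` fst \<phi>" "\<And>k. Ck_on k G N"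
    "\<And>z. z \<in> N \<Longrightarrow> chart_inv \<phi> z \<in> L \<longleftrightarrow> G z = 0"
    "\<And>w. frechet_derivative G (at (snd \<phi> p)) w = 0 \<Longrightarrow> coord_vec A \<phi> p w \<in> submanifold_tangent_space A L p"
    "\<And>u. u \<in> submanifold_tangent_space A L p \<Longrightarrow>
       frechet_derivative G (at (snd \<phi> p)) (u \<phi>) = 0 \<and> u = coord_vec A \<phi> p (u \<phi>)"
proof -
  from bspec[OF L(1)[unfolded embedded_submanifold_def] L(2)]
  obtain \<psi> V W F H E where \<psi>: "\<psi> \<in> A" "p \<in> fst \<psi>" and pV: "snd \<psi> p \<in> V" and Vsub: "V \<subseteq> snd \<psi> ` fst \<psi>"
    and oV: "open V" and oW: "open W" and hom: "homeomorphism V W F H" and sF: "smooth_on F V" and sH: "smooth_on H W"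
    and E: "subspace (E :: (complex^'n) set)" and slice: "F ` (V \<inter> snd \<psi> ` (fst \<psi> \<inter> L)) = W \<inter> E"
    by (elim bexE exE conjE) (rule that)
  have HF: "\<And>x. x \<in> V \<Longrightarrow> H (F x) = x" and FH: "\<And>y. y \<in> W \<Longrightarrow> F (H y) = y"
    and FW: "\<And>x. x \<in> V \<Longrightarrow> F x \<in> W" and HV: "\<And>y. y \<in> W \<Longrightarrow> H y \<in> V"
    using hom by (auto simp: homeomorphism_def)
  have CF: "Ck_on k F V" and CH: "Ck_on k H W" for k using sF sH by (auto simp: smooth_on_def)
  obtain \<pi> where \<pi>: "bounded_linear (\<pi> :: complex^'n \<Rightarrow> complex^'n)" "\<And>x. \<pi> x = 0 \<longleftrightarrow> x \<in> E"
    using subspace_kernel_projection[OF E] by blast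
  let ?\<tau> = "transition \<phi> \<psi>"
  define N where "N = snd \<phi> ` (fst \<phi> \<inter> chart_inv \<psi> ` V)"
  \<comment> \<open>G takes values in the whole coordinate space, so it is no submersion in general;
    what matters is that it cuts out L and that its derivative has the tangent space as
    kernel.\<close>
  define G where "G = (\<lambda>z. \<pi> (F (?\<tau> z)))"
  have oVi: "open (chart_inv \<psi> ` V)" by (rule open_chart_inv_image[OF \<psi>(1) oV Vsub])
  have Vi: "chart_inv \<psi> ` V = fst \<psi> \<inter> snd \<psi> -` V" by (rule chart_inv_image_eq[OF \<psi>(1) Vsub])
  have oN: "open N" unfolding N_def by (rule open_chart_image[OF \<phi>(1) oVi])
  have pN: "snd \<phi> p \<in> N" unfolding N_def Vi using \<phi> \<psi> pV by auto
  have NV: "?\<tau> z \<in> V" and Nsub: "z \<in> snd \<phi> ` (fst \<phi> \<inter> fst \<psi>)" if "z \<in> N" for z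
    using that \<phi> unfolding N_def Vi by (auto simp: transition_chart)
  have C\<tau>: "Ck_on k ?\<tau> N" for k
    by (rule Ck_on_subset[OF transition_Ck[OF \<phi>(1) \<psi>(1)]]) (use Nsub in blast)
  have CF\<tau>: "Ck_on k (\<lambda>z. F (?\<tau> z)) N" for k
    by (rule Ck_on_compose[OF oN oV _ C\<tau> CF]) (use NV in blast)
  have CG: "Ck_on k G N" for k unfolding G_def
    by (rule Ck_on_linear_compose[OF \<pi>(1) oN CF\<tau>])
  have GL: "chart_inv \<phi> z \<in> L \<longleftrightarrow> G z = 0" if z: "z \<in> N" for z
  proof -
    define x where "x = chart_inv \<phi> z"
    have x: "x \<in> fst \<phi>" "x \<in> fst \<psi>" "snd \<psi> x \<in> V" "?\<tau> z = snd \<psi> x"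
      using z \<phi> unfolding N_def Vi x_def by (auto simp: chart_inv_chart transition_chart)
    have "x \<in> L \<longleftrightarrow> F (snd \<psi> x) \<in> E"
    proof
      assume "x \<in> L"
      then have "F (snd \<psi> x) \<in> F ` (V \<inter> snd \<psi> ` (fst \<psi> \<inter> L))" using x by blast
      then show "F (snd \<psi> x) \<in> E" using slice by blast
    next
      assume "F (snd \<psi> x) \<in> E"
      then have "F (snd \<psi> x) \<in> F ` (V \<inter> snd \<psi> ` (fst \<psi> \<inter> L))" using slice FW[OF x(3)] by blast
      then obtain y where y: "y \<in> fst \<psi>" "y \<in> L" "snd \<psi> y \<in> V" "F (snd \<psi> x) = F (snd \<psi> y)" by auto
      then have "snd \<psi> x = snd \<psi> y" using HF x(3) by metis
      then have "x = y" using chart_inv_chart[OF \<psi>(1)] x(2) y(1) by metis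
      then show "x \<in> L" using y by simp
    qed
    then show ?thesis by (simp add: G_def x \<pi> flip: x_def)
  qed
  define DF where "DF = frechet_derivative F (at (snd \<psi> p))"
  have DF: "(F has_derivative DF) (at (snd \<psi> p))"
    unfolding DF_def using Ck_on_SucD(1)[OF CF pV] .
  have DG: "(G has_derivative (\<lambda>w. \<pi> (DF (dtrans \<phi> \<psi> p w)))) (at (snd \<phi> p))"
    unfolding G_def
    by (rule bounded_linear.has_derivative[OF \<pi>(1)], rule has_derivative_compose[OF dtrans_has_derivative[OF \<phi>(1) \<psi>(1) \<phi>(2) \<psi>(2)]])
       (use DF \<phi> in \<open>simp add: transition_chart\<close>)
  then have DG': "frechet_derivative G (at (snd \<phi> p)) w = \<pi> (DF (dtrans \<phi> \<psi> p w))" for w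
    using frechet_derivative_at by metis
  show thesis
  proof (rule that[OF oN pN _ CG GL])
    show "N \<subseteq> snd \<phi> ` fst \<phi>" unfolding N_def by auto
    fix w assume w: "frechet_derivative G (at (snd \<phi> p)) w = 0"
    define v where "v = dtrans \<phi> \<psi> p w"
    define e where "e = DF v"
    have eE: "e \<in> E" using w unfolding DG' \<pi>(2) e_def v_def .
    define y0 where "y0 = F (snd \<psi> p)"
    have y0W: "y0 \<in> W" using FW pV by (simp add: y0_def)
    have y0E: "y0 \<in> E" using slice L(2) \<psi> pV unfolding y0_def by blast
    \<comment> \<open>The straight line through the image of p in the direction e; it stays in E
      because both y0 and e lie there.\<close>
    define l where "l = (\<lambda>t::real. y0 + t *\<^sub>R e)"
    define I where "I = l -` W"
    have cl: "continuous_on X l" for X unfolding l_def by (intro continuous_intros)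
    have oI: "open I" unfolding I_def by (rule open_vimage[OF oW cl])
    have I0: "0 \<in> I" using y0W by (simp add: I_def l_def)
    have dl: "(l has_derivative (\<lambda>r. r *\<^sub>R e)) (at t)" for t
      unfolding l_def by (auto intro!: derivative_eq_intros)
    have Cl: "Ck_on k l I" for k
    proof (cases k)
      case 0 then show ?thesis using cl by simp
    next
      case (Suc j)
      then show ?thesis using Ck_on_SucI[OF oI dl Ck_on_const] by simp
    qed
    have CHl: "Ck_on k (\<lambda>t. H (l t)) I" for k
      by (rule Ck_on_compose[OF oI oW _ Cl CH]) (auto simp: I_def)
    define \<gamma> where "\<gamma> = (\<lambda>t. chart_inv \<psi> (H (l t)))"
    have HlV: "H (l t) \<in> V" if "t \<in> I" for t using HV that by (simp add: I_def)
    have \<gamma>\<psi>: "\<gamma> t \<in> fst \<psi>" "snd \<psi> (\<gamma> t) = H (l t)" if "t \<in> I" for t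
      unfolding \<gamma>_def using HlV[OF that] Vsub chart_inv_in[OF \<psi>(1)] chart_chart_inv[OF \<psi>(1)] by blast+
    have \<gamma>L: "\<gamma> t \<in> L" if t: "t \<in> I" for t
    proof -
      have "l t \<in> W \<inter> E" using t y0E eE E by (simp add: I_def l_def subspace_add subspace_scale)
      then obtain x where x: "x \<in> fst \<psi>" "x \<in> L" "snd \<psi> x \<in> V" "l t = F (snd \<psi> x)" using slice by blast
      then have "H (l t) = snd \<psi> x" using HF by simp
      then show ?thesis using x chart_inv_chart[OF \<psi>(1)] by (simp add: \<gamma>_def)
    qed
    have \<gamma>0: "\<gamma> 0 = p" using HF[OF pV] chart_inv_chart[OF \<psi>] by (simp add: \<gamma>_def l_def y0_def)
    have c\<gamma>: "continuous_on I \<gamma>"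
      unfolding \<gamma>_def
      by (rule continuous_on_compose2[OF continuous_on_chart_inv[OF \<psi>(1)]])
         (use CHl[of 0] HlV Vsub in auto)
    have sm: "smooth_curve_on A I \<gamma>"
      unfolding smooth_curve_on_def smooth_on_def
    proof (intro conjI ballI allI oI c\<gamma>)
      fix \<xi> k assume \<xi>: "\<xi> \<in> A"
      let ?T = "{t \<in> I. \<gamma> t \<in> fst \<xi>}"
      have "?T = I \<inter> \<gamma> -` fst \<xi>" by auto
      then have oT: "open ?T" using continuous_open_preimage[OF c\<gamma> oI open_chart_dom[OF \<xi>]] by simp
      have "Ck_on k (\<lambda>t. transition \<psi> \<xi> (H (l t))) ?T"
      proof (rule Ck_on_compose[OF oT open_chart_image[OF \<psi>(1) open_chart_dom[OF \<xi>]] _ _ transition_Ck[OF \<psi>(1) \<xi>]])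
        show "Ck_on k (\<lambda>t. H (l t)) ?T" by (rule Ck_on_subset[OF CHl]) auto
        show "(\<lambda>t. H (l t)) ` ?T \<subseteq> snd \<psi> ` (fst \<psi> \<inter> fst \<xi>)"
        proof
          fix z assume "z \<in> (\<lambda>t. H (l t)) ` ?T"
          then obtain t where t: "t \<in> I" "\<gamma> t \<in> fst \<xi>" "z = H (l t)" by blast
          then show "z \<in> snd \<psi> ` (fst \<psi> \<inter> fst \<xi>)" using \<gamma>\<psi>[OF t(1)] by (metis IntI image_eqI)
        qed
      qed
      then show "Ck_on k (snd \<xi> \<circ> \<gamma>) ?T" by (simp add: transition_def \<gamma>_def o_def)
    qed
    have "(H has_derivative frechet_derivative H (at y0)) (at y0)"
      by (rule Ck_on_SucD(1)[OF CH[of "Suc 0"] y0W])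
    then obtain DH where DH: "(H has_derivative DH) (at y0)" by blast
    \<comment> \<open>The derivatives of F and H are inverse to each other, so pulling back the line
      with direction e = DF v gives velocity v.\<close>
    have DHF: "DH (DF x) = x" for x
    proof -
      have "((\<lambda>x. H (F x)) has_derivative (\<lambda>x. DH (DF x))) (at (snd \<psi> p))"
        by (rule has_derivative_compose[OF DF]) (use DH in \<open>simp add: y0_def\<close>)
      then have "((\<lambda>x. x) has_derivative (\<lambda>x. DH (DF x))) (at (snd \<psi> p))"
        by (rule has_derivative_transform_within_open[OF _ oV pV]) (use HF in auto)
      then have "(\<lambda>x. DH (DF x)) = (\<lambda>x. x)" using has_derivative_unique has_derivative_ident by blast
      then show ?thesis by metis
    qed
    have "((\<lambda>t. H (l t)) has_derivative (\<lambda>r. DH (r *\<^sub>R e))) (at 0)"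
      by (rule has_derivative_compose[OF dl]) (use DH in \<open>simp add: l_def\<close>)
    then have "((\<lambda>t. H (l t)) has_vector_derivative v) (at 0)"
      unfolding has_vector_derivative_def
      using linear_cmul[OF has_derivative_linear[OF DH]] DHF[of v] by (simp add: e_def)
    then have "((snd \<psi> \<circ> \<gamma>) has_vector_derivative v) (at 0)"
      by (rule has_vector_derivative_transform_within_open[OF _ oI I0]) (use \<gamma>\<psi> in auto)
    then have "velocity A \<gamma> 0 = coord_vec A \<psi> (\<gamma> 0) v"
      by (intro velocity_eq_coord_vec[OF \<psi>(1) _ oI I0 c\<gamma>]) (use \<gamma>0 \<psi> in auto)
    then have "velocity A \<gamma> 0 = coord_vec A \<phi> p w"
      using coord_vec_change[OF \<phi> \<psi>] by (simp add: \<gamma>0 v_def)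
    then show "coord_vec A \<phi> p w \<in> submanifold_tangent_space A L p"
      unfolding submanifold_tangent_space_def using sm I0 \<gamma>0 \<gamma>L by (force intro!: exI[of _ \<gamma>] exI[of _ I])
  next
    fix u assume "u \<in> submanifold_tangent_space A L p"
    then obtain \<gamma> I where u: "u = velocity A \<gamma> 0" and I: "0 \<in> I" and sm: "smooth_curve_on A I \<gamma>"
        and \<gamma>L: "\<gamma> ` I \<subseteq> L" and \<gamma>0: "\<gamma> 0 = p"
      unfolding submanifold_tangent_space_def by blast
    have oI: "open I" and c\<gamma>: "continuous_on I \<gamma>" and "smooth_on (snd \<phi> \<circ> \<gamma>) {t \<in> I. \<gamma> t \<in> fst \<phi>}"
      using sm \<phi> by (auto simp: smooth_curve_on_def)
    then have "Ck_on (Suc 0) (snd \<phi> \<circ> \<gamma>) {t \<in> I. \<gamma> t \<in> fst \<phi>}" unfolding smooth_on_def by blast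
    from Ck_on_SucD(1)[OF this, of 0] have "((snd \<phi> \<circ> \<gamma>) differentiable (at 0))"
      using I \<gamma>0 \<phi> by (auto simp: differentiable_def)
    then obtain w where w: "((snd \<phi> \<circ> \<gamma>) has_vector_derivative w) (at 0)"
      by (rule that[OF vector_derivative_works[THEN iffD1]])
    have uc: "u = coord_vec A \<phi> p w"
      using velocity_eq_coord_vec[OF \<phi>(1) _ oI I c\<gamma> w] u \<gamma>0 \<phi> by simp
    then have uw: "u \<phi> = w" using coord_vec_self[OF \<phi>] by simp
    \<comment> \<open>The times at which the curve is inside both charts and G is defined along
      it.\<close>
    define J where "J = I \<inter> \<gamma> -` (fst \<phi> \<inter> chart_inv \<psi> ` V)"
    have oJ: "open J" unfolding J_def
      by (rule continuous_open_preimage[OF c\<gamma> oI]) (intro open_Int oVi open_chart_dom \<phi>)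
    have J0: "0 \<in> J" using I \<gamma>0 \<phi> \<psi> pV unfolding J_def Vi by auto
    have zero: "G (snd \<phi> (\<gamma> t)) = 0" if "t \<in> J" for t
    proof -
      have "snd \<phi> (\<gamma> t) \<in> N" using that unfolding J_def N_def by blast
      moreover have "chart_inv \<phi> (snd \<phi> (\<gamma> t)) \<in> L"
        using that \<gamma>L chart_inv_chart[OF \<phi>(1)] unfolding J_def by auto
      ultimately show ?thesis using GL by blast
    qed
    have "((\<lambda>t. G ((snd \<phi> \<circ> \<gamma>) t)) has_derivative (\<lambda>r. \<pi> (DF (dtrans \<phi> \<psi> p (r *\<^sub>R w))))) (at 0)"
      by (rule has_derivative_compose[OF w[unfolded has_vector_derivative_def]]) (use DG \<gamma>0 in simp)
    then have "((\<lambda>t. 0) has_derivative (\<lambda>r. \<pi> (DF (dtrans \<phi> \<psi> p (r *\<^sub>R w))))) (at (0::real))"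
      by (rule has_derivative_transform_within_open[OF _ oJ J0]) (use zero in simp)
    then have "(\<lambda>r. \<pi> (DF (dtrans \<phi> \<psi> p (r *\<^sub>R w)))) = (\<lambda>r. 0)"
      using has_derivative_unique has_derivative_const by blast
    from fun_cong[OF this, of 1] show "frechet_derivative G (at (snd \<phi> p)) (u \<phi>) = 0 \<and> u = coord_vec A \<phi> p (u \<phi>)"
      using uc uw by (simp add: DG')
  qed
qed

end

section \<open>Coordinate balls are Stein\<close>

text \<open>With u = 1 / (c - |\<tau>|^2), the derivative in direction v is 2 u^2 times the inner
  product of \<tau> with its derivative; differentiating again gives the two terms.\<close>

lemma second_derivative_inverse_ball:
  fixes \<tau> :: "complex^'n::finite \<Rightarrow> complex^'n"
  assumes \<tau>: "holo_map_on \<tau> Y" and Y: "open Y" and y: "y \<in> Y"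
    and pos: "\<And>x. x \<in> Y \<Longrightarrow> \<tau> x \<bullet> \<tau> x < c"
    and E': "((\<lambda>x. frechet_derivative \<tau> (at x) v) has_derivative E') (at y)"
  defines "u \<equiv> \<lambda>x. 1 / (c - \<tau> x \<bullet> \<tau> x)" and "d \<equiv> frechet_derivative \<tau> (at y) v"
  shows "frechet_derivative (\<lambda>x. frechet_derivative u (at x) v) (at y) v =
    2 * (u y)^3 * (2 * (\<tau> y \<bullet> d))\<^sup>2 + 2 * (u y)\<^sup>2 * ((norm d)\<^sup>2 + \<tau> y \<bullet> E' v)"
proof -
  let ?D = "\<lambda>x. frechet_derivative \<tau> (at x)"
  have D: "(\<tau> has_derivative ?D x) (at x)" if "x \<in> Y" for x
    by (rule holo_map_on_frechet(1)[OF \<tau> that])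
  have du: "(u has_derivative (\<lambda>w. (u x)\<^sup>2 * (2 * (\<tau> x \<bullet> ?D x w)))) (at x)" if x: "x \<in> Y" for x
    unfolding u_def using pos[OF x]
    by (auto intro!: derivative_eq_intros D[OF x] simp: inner_commute power2_eq_square divide_simps)
  have eq: "frechet_derivative u (at x) v = (u x)\<^sup>2 * (2 * (\<tau> x \<bullet> ?D x v))" if x: "x \<in> Y" for x
    using frechet_derivative_at[OF du[OF x]] by metis
  have "((\<lambda>x. (u x)\<^sup>2 * (2 * (\<tau> x \<bullet> ?D x v))) has_derivative
     (\<lambda>w. 2 * u y * ((u y)\<^sup>2 * (2 * (\<tau> y \<bullet> ?D y w))) * (2 * (\<tau> y \<bullet> d))
        + (u y)\<^sup>2 * (2 * (\<tau> y \<bullet> E' w + ?D y w \<bullet> d)))) (at y)"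
    unfolding d_def
    by (rule derivative_eq_intros du[OF y] D[OF y] E' refl)+ (simp add: fun_eq_iff algebra_simps power2_eq_square)
  then have "((\<lambda>x. frechet_derivative u (at x) v) has_derivative
     (\<lambda>w. 2 * u y * ((u y)\<^sup>2 * (2 * (\<tau> y \<bullet> ?D y w))) * (2 * (\<tau> y \<bullet> d))
        + (u y)\<^sup>2 * (2 * (\<tau> y \<bullet> E' w + ?D y w \<bullet> d)))) (at y)"
    by (rule has_derivative_transform_within_open[OF _ Y y]) (simp add: eq)
  from fun_cong[OF frechet_derivative_at[OF this], of v, symmetric]
  have "frechet_derivative (\<lambda>x. frechet_derivative u (at x) v) (at y) v =
     2 * u y * ((u y)\<^sup>2 * (2 * (\<tau> y \<bullet> d))) * (2 * (\<tau> y \<bullet> d))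
        + (u y)\<^sup>2 * (2 * (\<tau> y \<bullet> E' v + d \<bullet> d))" by (simp add: d_def)
  moreover have "d \<bullet> d = (norm d)\<^sup>2" by (simp add: power2_norm_eq_inner)
  ultimately show ?thesis
    by (simp only:) (simp add: power2_eq_square power3_eq_cube algebra_simps)
qed

text \<open>Adding the second derivatives along w and i w cancels the terms with second derivatives
  of \<tau>, because \<tau> is holomorphic. What remains is a sum of squares with positive
  coefficients that contains the squared norm of the derivative of \<tau>.\<close>

lemma levi_form_inverse_ball_pos:
  fixes \<tau> :: "complex^'n::finite \<Rightarrow> complex^'n"
  assumes \<tau>: "holo_map_on \<tau> Y" and Y: "open Y" and y: "y \<in> Y"
    and pos: "\<And>x. x \<in> Y \<Longrightarrow> \<tau> x \<bullet> \<tau> x < c"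
    and w: "frechet_derivative \<tau> (at y) w \<noteq> 0"
  shows "levi_form (\<lambda>x. 1 / (c - \<tau> x \<bullet> \<tau> x)) y w > 0"
proof -
  let ?D = "\<lambda>x. frechet_derivative \<tau> (at x)" and ?k = "1 / (c - \<tau> y \<bullet> \<tau> y)"
  obtain E' where E': "((\<lambda>x. ?D x w) has_derivative E') (at y)" "\<And>c v. E' (c *s v) = c *s E' v"
    using holo_map_on_derivative[OF \<tau> Y, of w] y unfolding holo_map_on_def by meson
  have Di: "?D x (\<i> *s w) = \<i> *s ?D x w" if "x \<in> Y" for x
    by (rule holo_map_on_frechet(2)[OF \<tau> that])
  have Ei: "((\<lambda>x. ?D x (\<i> *s w)) has_derivative (\<lambda>v. \<i> *s E' v)) (at y)"
    by (rule has_derivative_transform_within_open[OF bounded_linear.has_derivative[OF bounded_linear_i_scale E'(1)] Y y])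
       (simp add: Di)
  have EE: "\<i> *s E' (\<i> *s w) = - E' w" by (simp add: E'(2) i_scale_i_scale del: vector_smult_assoc)
  have k: "?k > 0" using pos[OF y] by simp
  have "levi_form (\<lambda>x. 1 / (c - \<tau> x \<bullet> \<tau> x)) y w =
    (2 * ?k^3 * (2 * (\<tau> y \<bullet> ?D y w))\<^sup>2 + 2 * ?k\<^sup>2 * ((norm (?D y w))\<^sup>2 + \<tau> y \<bullet> E' w)
     + (2 * ?k^3 * (2 * (\<tau> y \<bullet> ?D y (\<i> *s w)))\<^sup>2 + 2 * ?k\<^sup>2 * ((norm (?D y (\<i> *s w)))\<^sup>2 + \<tau> y \<bullet> (\<i> *s E' (\<i> *s w))))) / 4"
    using second_derivative_inverse_ball[OF \<tau> Y y pos E'(1)] second_derivative_inverse_ball[OF \<tau> Y y pos Ei]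
    unfolding levi_form_def by (simp only:)
  also have "\<dots> = (2 * ?k^3 * (2 * (\<tau> y \<bullet> ?D y w))\<^sup>2 + 2 * ?k^3 * (2 * (\<tau> y \<bullet> ?D y (\<i> *s w)))\<^sup>2
      + 4 * ?k\<^sup>2 * (norm (?D y w))\<^sup>2) / 4"
    unfolding EE Di[OF y] norm_i_scale by (simp add: algebra_simps)
  finally have eq: "levi_form (\<lambda>x. 1 / (c - \<tau> x \<bullet> \<tau> x)) y w = \<dots>" .
  have "4 * ?k\<^sup>2 * (norm (?D y w))\<^sup>2 > 0" using k w by simp
  moreover have "2 * ?k^3 * (2 * (\<tau> y \<bullet> ?D y w))\<^sup>2 \<ge> 0" "2 * ?k^3 * (2 * (\<tau> y \<bullet> ?D y (\<i> *s w)))\<^sup>2 \<ge> 0"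
    using k by (intro mult_nonneg_nonneg; simp)+
  ultimately show ?thesis unfolding eq by (intro divide_pos_pos add_nonneg_pos add_nonneg_nonneg) auto
qed

context complex_manifold
begin

lemma coordinate_ball_in_chart:
  assumes \<phi>: "\<phi> \<in> A" and \<psi>: "\<psi> \<in> A" and ball: "ball z0 R \<subseteq> snd \<phi> ` fst \<phi>"
  defines "U \<equiv> chart_inv \<phi> ` ball z0 R"
  shows "open (snd \<psi> ` (fst \<psi> \<inter> U))"
    and "holo_map_on (\<lambda>y. transition \<psi> \<phi> y - z0) (snd \<psi> ` (fst \<psi> \<inter> U))"
    and "\<And>y. y \<in> snd \<psi> ` (fst \<psi> \<inter> U) \<Longrightarrow> transition \<psi> \<phi> y - z0 \<in> ball 0 R"
proof -
  have U: "U = fst \<phi> \<inter> snd \<phi> -` ball z0 R" unfolding U_def by (rule chart_inv_image_eq[OF \<phi> ball])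
  show "open (snd \<psi> ` (fst \<psi> \<inter> U))"
    unfolding U_def by (intro open_chart_image open_chart_inv_image \<phi> \<psi> ball open_ball)
  have h: "holo_map_on (transition \<psi> \<phi>) (snd \<psi> ` (fst \<psi> \<inter> U))"
    by (rule holo_map_on_subset[OF transition_holo[OF \<psi> \<phi>]]) (auto simp: U)
  show "holo_map_on (\<lambda>y. transition \<psi> \<phi> y - z0) (snd \<psi> ` (fst \<psi> \<inter> U))"
    unfolding holo_map_on_def
  proof
    fix z assume "z \<in> snd \<psi> ` (fst \<psi> \<inter> U)"
    then obtain f' where f': "(transition \<psi> \<phi> has_derivative f') (at z)" "\<forall>c v. f' (c *s v) = c *s f' v"
      using h unfolding holo_map_on_def by meson
    then show "\<exists>f'. ((\<lambda>y. transition \<psi> \<phi> y - z0) has_derivative f') (at z) \<and> (\<forall>c v. f' (c *s v) = c *s f' v)"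
      using has_derivative_diff[OF f'(1) has_derivative_const] by (intro exI[of _ f']) auto
  qed
  show "transition \<psi> \<phi> y - z0 \<in> ball 0 R" if "y \<in> snd \<psi> ` (fst \<psi> \<inter> U)" for y
    using that \<psi> by (auto simp: U transition_chart dist_norm norm_minus_commute)
qed

lemma stein_coordinate_ball:
  assumes \<phi>: "\<phi> \<in> A" and ball: "ball z0 R \<subseteq> snd \<phi> ` fst \<phi>"
  shows "stein_on A (chart_inv \<phi> ` ball z0 R)"
proof -
  define U where "U = chart_inv \<phi> ` ball z0 R"
  have U: "U = fst \<phi> \<inter> snd \<phi> -` ball z0 R" unfolding U_def by (rule chart_inv_image_eq[OF \<phi> ball])
  \<comment> \<open>This blows up at the boundary sphere of the coordinate ball, which makes it an
    exhaustion function.\<close>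
  define \<rho> where "\<rho> q = 1 / (R\<^sup>2 - (snd \<phi> q - z0) \<bullet> (snd \<phi> q - z0))" for q
  have less: "x \<bullet> x < R\<^sup>2" if "x \<in> ball 0 R" for x :: "complex^'n"
  proof -
    have "(norm x)\<^sup>2 < R\<^sup>2" using that by (intro power_strict_mono) auto
    then show ?thesis by (simp add: power2_norm_eq_inner)
  qed
  have "smooth_strictly_psh_on A U \<rho>"
    unfolding smooth_strictly_psh_on_def smooth_fun_on_def smooth_on_def
  proof (intro conjI ballI allI impI)
    fix \<psi> assume \<psi>: "\<psi> \<in> A"
    let ?Y = "snd \<psi> ` (fst \<psi> \<inter> U)" and ?\<tau> = "\<lambda>y. transition \<psi> \<phi> y - z0"
    note Y = coordinate_ball_in_chart[OF \<phi> \<psi> ball, folded U_def]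
    have eq: "\<rho> \<circ> chart_inv \<psi> = (\<lambda>y. 1 / (R\<^sup>2 - ?\<tau> y \<bullet> ?\<tau> y))"
      by (simp add: fun_eq_iff \<rho>_def transition_def)
    have lt: "?\<tau> x \<bullet> ?\<tau> x < R\<^sup>2" if "x \<in> ?Y" for x using less[OF Y(3)[OF that]] .
    {
      fix k
      have C: "Ck_on k ?\<tau> ?Y" by (rule Ck_on_holo_map[OF Y(2,1)])
      have "Ck_on k (\<lambda>y. R\<^sup>2 + - (?\<tau> y \<bullet> ?\<tau> y)) ?Y"
        by (intro Ck_on_add[OF Y(1)] Ck_on_const Ck_on_linear_compose[OF bounded_linear_minus[OF bounded_linear_ident] Y(1)]
            Ck_on_bilinear[OF bounded_bilinear_inner Y(1)] C)
      then have "Ck_on k (\<lambda>y. 1 / (R\<^sup>2 + - (?\<tau> y \<bullet> ?\<tau> y))) ?Y"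
        by (rule Ck_on_inverse[OF Y(1), rotated]) (use lt in force)
      then show "Ck_on k (\<rho> \<circ> chart_inv \<psi>) ?Y" unfolding eq by simp
    }
    fix y w :: "complex^'n" assume y: "y \<in> ?Y" and w: "w \<noteq> 0"
    obtain q where q: "q \<in> fst \<psi>" "q \<in> fst \<phi>" "y = snd \<psi> q" using y unfolding U by blast
    have "(?\<tau> has_derivative dtrans \<psi> \<phi> q) (at y)"
      using has_derivative_diff[OF dtrans_has_derivative[OF \<psi> \<phi> q(1,2)] has_derivative_const[of z0]] q(3) by simp
    then have fd: "frechet_derivative ?\<tau> (at y) = dtrans \<psi> \<phi> q" using frechet_derivative_at by metis
    have "dtrans \<psi> \<phi> q w \<noteq> 0"
    proof
      assume "dtrans \<psi> \<phi> q w = 0"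
      then have "dtrans \<phi> \<psi> q 0 = w"
        using dtrans_cocycle[OF \<psi> \<phi> \<psi> q(1,2,1), of w] dtrans_same[OF \<psi> q(1)] by simp
      then show False using linear_0[OF dtrans_linear[OF \<phi> \<psi> q(2,1)]] w by simp
    qed
    then show "0 < levi_form (\<rho> \<circ> chart_inv \<psi>) y w"
      unfolding eq by (intro levi_form_inverse_ball_pos[OF Y(2,1) y lt]) (simp_all only: fd not_False_eq_True)
  qed
  moreover have "compact {q \<in> U. \<rho> q \<le> c}" for c
  proof -
    define Z where "Z = {z. norm (z - z0) < R \<and> 1 / (R\<^sup>2 - (z - z0) \<bullet> (z - z0)) \<le> c}"
    have "{q \<in> U. \<rho> q \<le> c} = chart_inv \<phi> ` Z"
    proof (intro equalityI subsetI)
      fix q assume "q \<in> {q \<in> U. \<rho> q \<le> c}"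
      then have "q \<in> fst \<phi>" "snd \<phi> q \<in> Z" by (auto simp: U Z_def \<rho>_def dist_norm norm_minus_commute)
      then show "q \<in> chart_inv \<phi> ` Z" using chart_inv_chart[OF \<phi>] by (metis image_eqI)
    next
      fix q assume "q \<in> chart_inv \<phi> ` Z"
      then obtain z where z: "z \<in> Z" "q = chart_inv \<phi> z" by blast
      then have zb: "z \<in> ball z0 R" by (simp add: Z_def dist_norm norm_minus_commute)
      then have "snd \<phi> q = z" using z ball chart_chart_inv[OF \<phi>] by auto
      then show "q \<in> {q \<in> U. \<rho> q \<le> c}" using z zb by (auto simp: U_def Z_def \<rho>_def)
    qed
    moreover have "compact Z"
    proof (cases "c \<le> 0")
      case True
      have "1 / (R\<^sup>2 - (z - z0) \<bullet> (z - z0)) > 0" if "norm (z - z0) < R" for z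
        using less[of "z - z0"] that by simp
      then have "\<not> 1 / (R\<^sup>2 - (z - z0) \<bullet> (z - z0)) \<le> c" if "norm (z - z0) < R" for z
        using True that by (meson not_le order_trans)
      then have "Z = {}" unfolding Z_def by blast
      then show ?thesis by simp
    next
      case False
      \<comment> \<open>A description by closed conditions: for c > 0 the first inequality already
        excludes norm R, so the closed ball may replace the open one.\<close>
      have "Z = {z. (norm (z - z0))\<^sup>2 \<le> R\<^sup>2 - 1 / c} \<inter> cball z0 R"
      proof (intro equalityI subsetI)
        fix z assume z: "z \<in> Z"
        then have "(z - z0) \<bullet> (z - z0) < R\<^sup>2" using less[of "z - z0"] by (simp add: Z_def)
        with z False have "1 / c \<le> R\<^sup>2 - (z - z0) \<bullet> (z - z0)" by (simp add: Z_def field_simps)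
        then show "z \<in> {z. (norm (z - z0))\<^sup>2 \<le> R\<^sup>2 - 1 / c} \<inter> cball z0 R"
          using z by (simp add: Z_def power2_norm_eq_inner dist_norm norm_minus_commute)
      next
        fix z assume z: "z \<in> {z. (norm (z - z0))\<^sup>2 \<le> R\<^sup>2 - 1 / c} \<inter> cball z0 R"
        have c: "1 / c > 0" using False by simp
        have "norm (z - z0) \<noteq> R" using z c by auto
        then have n: "norm (z - z0) < R" using z by (simp add: dist_norm norm_minus_commute)
        have "1 / c \<le> R\<^sup>2 - (z - z0) \<bullet> (z - z0)" using z by (simp add: power2_norm_eq_inner)
        then have "1 / (R\<^sup>2 - (z - z0) \<bullet> (z - z0)) \<le> c" using c False less[of "z - z0"] n by (simp add: field_simps)
        then show "z \<in> Z" using n by (simp add: Z_def)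
      qed
      moreover have "closed {z. (norm (z - z0))\<^sup>2 \<le> R\<^sup>2 - 1 / c}"
        by (intro closed_Collect_le continuous_intros)
      ultimately show ?thesis using closed_Int_compact[OF _ compact_cball] by simp
    qed
    moreover have "continuous_on Z (chart_inv \<phi>)"
      by (rule continuous_on_subset[OF continuous_on_chart_inv[OF \<phi>]])
         (use ball in \<open>auto simp: Z_def dist_norm norm_minus_commute subset_eq\<close>)
    ultimately show ?thesis using compact_continuous_image by simp
  qed
  moreover have "open U" unfolding U_def by (intro open_chart_inv_image \<phi> ball open_ball)
  ultimately show ?thesis unfolding stein_on_def U_def[symmetric] by blast
qed

lemma cont_psh_on_coordinate_ball:
  assumes \<phi>: "\<phi> \<in> A" and ball: "ball z0 R \<subseteq> snd \<phi> ` fst \<phi>" and u: "psh (ball 0 R) u"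
  shows "cont_psh_on A (chart_inv \<phi> ` ball z0 R) (\<lambda>q. u (snd \<phi> q - z0))"
  unfolding cont_psh_on_def
proof
  fix \<psi> assume \<psi>: "\<psi> \<in> A"
  note Y = coordinate_ball_in_chart[OF \<phi> \<psi> ball]
  have "(\<lambda>q. u (snd \<phi> q - z0)) \<circ> chart_inv \<psi> = (\<lambda>y. u (transition \<psi> \<phi> y - z0))"
    by (simp add: fun_eq_iff transition_def)
  moreover have "psh (snd \<psi> ` (fst \<psi> \<inter> chart_inv \<phi> ` ball z0 R)) (\<lambda>y. u (transition \<psi> \<phi> y - z0))"
    by (rule psh_compose_holo_map[OF u Y(2) _ Y(1)]) (use Y(3) in blast)
  ultimately show "cont_psh (snd \<psi> ` (fst \<psi> \<inter> chart_inv \<phi> ` ball z0 R)) ((\<lambda>q. u (snd \<phi> q - z0)) \<circ> chart_inv \<psi>)"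
    using psh_imp_cont_psh by simp
qed

end

section \<open>Riemannian balls\<close>

lemma partition_interval:
  fixes t :: "nat \<Rightarrow> real"
  assumes "t 0 \<le> x" "x < t m"
  shows "\<exists>i<m. t i \<le> x \<and> x < t (Suc i)"
  using assms(2)
proof (induction m)
  case 0
  then show ?case using assms(1) by simp
next
  case (Suc m)
  then show ?case by (cases "x < t m") (auto intro: less_SucI)
qed

context taming_form
begin

definition speed_sq :: "(real \<Rightarrow> 'm) \<Rightarrow> real \<Rightarrow> real" where
  "speed_sq \<gamma> t = riem_metric \<omega> (\<gamma> t) (velocity A \<gamma> t) (velocity A \<gamma> t)"

text \<open>Smoothness of the form concerns its coefficients on constant vectors, so both moving
  arguments are expanded in a real basis.\<close>

lemma continuous_on_form_at:
  assumes \<phi>: "\<phi> \<in> A" and z: "continuous_on S z" "z ` S \<subseteq> snd \<phi> ` fst \<phi>"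
    and v: "continuous_on S v" and w: "continuous_on S w"
  shows "continuous_on S (\<lambda>t. form_at \<phi> (chart_inv \<phi> (z t)) (v t) (w t))"
proof -
  have coeff: "continuous_on S (\<lambda>t. form_at \<phi> (chart_inv \<phi> (z t)) a b)" for a b
  proof -
    have "Ck_on 0 (form_coeff A \<omega> \<phi> a b) (snd \<phi> ` fst \<phi>)"
      using smooth_form \<phi> unfolding smooth_two_form_def smooth_on_def by blast
    then have "continuous_on (snd \<phi> ` fst \<phi>) (form_coeff A \<omega> \<phi> a b)" by simp
    from continuous_on_compose2[OF this z] show ?thesis by (simp add: form_coeff_eq)
  qed
  have eq: "form_at \<phi> (chart_inv \<phi> (z t)) (v t) (w t) =
      (\<Sum>a\<in>Basis. \<Sum>b\<in>Basis. (v t \<bullet> a) * ((w t \<bullet> b) * form_at \<phi> (chart_inv \<phi> (z t)) a b))" if "t \<in> S" for t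
  proof -
    have q: "chart_inv \<phi> (z t) \<in> fst \<phi>" using chart_inv_in[OF \<phi>] z(2) that by blast
    have l1: "linear (\<lambda>a. form_at \<phi> (chart_inv \<phi> (z t)) a c)" for c
      by (rule linearI) (auto simp: form_at_bilinear(1,2)[OF \<phi> q])
    have l2: "linear (form_at \<phi> (chart_inv \<phi> (z t)) c)" for c
      by (rule linearI) (auto simp: form_at_bilinear(4,5)[OF \<phi> q])
    have "form_at \<phi> (chart_inv \<phi> (z t)) (v t) (w t) = (\<Sum>a\<in>Basis. (v t \<bullet> a) *\<^sub>R form_at \<phi> (chart_inv \<phi> (z t)) a (w t))"
      by (rule linear_sum_Basis[OF l1])
    also have "\<dots> = (\<Sum>a\<in>Basis. (v t \<bullet> a) *\<^sub>R (\<Sum>b\<in>Basis. (w t \<bullet> b) *\<^sub>R form_at \<phi> (chart_inv \<phi> (z t)) a b))"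
      by (rule sum.cong[OF refl]) (simp only: linear_sum_Basis[OF l2, of _ "w t"])
    finally show ?thesis by (simp add: sum_distrib_left)
  qed
  have "continuous_on S (\<lambda>t. \<Sum>a\<in>Basis. \<Sum>b\<in>Basis. (v t \<bullet> a) * ((w t \<bullet> b) * form_at \<phi> (chart_inv \<phi> (z t)) a b))"
    by (intro continuous_intros coeff v w)
  then show ?thesis by (rule continuous_on_eq) (rule eq[symmetric])
qed

lemma smooth_curve_velocity:
  assumes sm: "smooth_curve_on A I \<gamma>" and t: "t \<in> I" and \<phi>: "\<phi> \<in> A" "\<gamma> t \<in> fst \<phi>"
  shows "((snd \<phi> \<circ> \<gamma>) has_vector_derivative frechet_derivative (snd \<phi> \<circ> \<gamma>) (at t) 1) (at t)"
    and "velocity A \<gamma> t = coord_vec A \<phi> (\<gamma> t) (frechet_derivative (snd \<phi> \<circ> \<gamma>) (at t) 1)"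
    and "speed_sq \<gamma> t = form_at \<phi> (\<gamma> t) (frechet_derivative (snd \<phi> \<circ> \<gamma>) (at t) 1)
           (\<i> *s frechet_derivative (snd \<phi> \<circ> \<gamma>) (at t) 1)"
proof -
  have I: "open I" "continuous_on I \<gamma>" and "smooth_on (snd \<phi> \<circ> \<gamma>) {t \<in> I. \<gamma> t \<in> fst \<phi>}"
    using sm \<phi> by (auto simp: smooth_curve_on_def)
  then have "Ck_on (Suc 0) (snd \<phi> \<circ> \<gamma>) {t \<in> I. \<gamma> t \<in> fst \<phi>}" unfolding smooth_on_def by blast
  from Ck_on_SucD(1)[OF this, of t] have d: "((snd \<phi> \<circ> \<gamma>) has_derivative frechet_derivative (snd \<phi> \<circ> \<gamma>) (at t)) (at t)"
    using t \<phi> by blast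
  show 1: "((snd \<phi> \<circ> \<gamma>) has_vector_derivative frechet_derivative (snd \<phi> \<circ> \<gamma>) (at t) 1) (at t)"
    unfolding has_vector_derivative_def
  proof (rule has_derivative_eq_rhs[OF d], rule ext)
    show "frechet_derivative (snd \<phi> \<circ> \<gamma>) (at t) r = r *\<^sub>R frechet_derivative (snd \<phi> \<circ> \<gamma>) (at t) 1" for r
      using linear_cmul[OF has_derivative_linear[OF d], of r 1] by (simp only: real_scaleR_def mult_1_right)
  qed
  show 2: "velocity A \<gamma> t = coord_vec A \<phi> (\<gamma> t) (frechet_derivative (snd \<phi> \<circ> \<gamma>) (at t) 1)"
    by (rule velocity_eq_coord_vec[OF \<phi> I(1) t I(2) 1])
  show "speed_sq \<gamma> t = form_at \<phi> (\<gamma> t) (frechet_derivative (snd \<phi> \<circ> \<gamma>) (at t) 1)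
           (\<i> *s frechet_derivative (snd \<phi> \<circ> \<gamma>) (at t) 1)"
    unfolding speed_sq_def 2 by (rule riem_metric_coord[OF \<phi>])
qed

lemma continuous_on_speed_sq:
  assumes sm: "smooth_curve_on A I \<gamma>"
  shows "continuous_on I (speed_sq \<gamma>)"
proof (rule continuous_at_imp_continuous_on, rule ballI)
  fix t assume t: "t \<in> I"
  obtain \<phi> where \<phi>: "\<phi> \<in> A" "\<gamma> t \<in> fst \<phi>" using chart_covers by blast
  have I: "open I" "continuous_on I \<gamma>" and s: "smooth_on (snd \<phi> \<circ> \<gamma>) {t \<in> I. \<gamma> t \<in> fst \<phi>}"
    using sm \<phi> by (auto simp: smooth_curve_on_def)
  define J where "J = {t \<in> I. \<gamma> t \<in> fst \<phi>}"
  have "J = I \<inter> \<gamma> -` fst \<phi>" by (auto simp: J_def)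
  then have oJ: "open J" using continuous_open_preimage[OF I(2,1) open_chart_dom[OF \<phi>(1)]] by simp
  have tJ: "t \<in> J" using t \<phi> by (simp add: J_def)
  have C1: "Ck_on (Suc 0) (snd \<phi> \<circ> \<gamma>) J" and C0: "Ck_on 0 (snd \<phi> \<circ> \<gamma>) J"
    using s unfolding smooth_on_def J_def by blast+
  let ?z' = "\<lambda>t. frechet_derivative (snd \<phi> \<circ> \<gamma>) (at t) 1"
  have cz': "continuous_on J ?z'" using Ck_on_SucD(2)[OF C1] by simp
  have ciz': "continuous_on J (\<lambda>t. \<i> *s ?z' t)"
    using continuous_on_compose2[OF linear_continuous_on[OF bounded_linear_i_scale, of UNIV] cz'] by simp
  have "continuous_on J (\<lambda>t. form_at \<phi> (chart_inv \<phi> ((snd \<phi> \<circ> \<gamma>) t)) (?z' t) (\<i> *s ?z' t))"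
    by (rule continuous_on_form_at[OF \<phi>(1) _ _ cz' ciz']) (use C0 in \<open>auto simp: J_def\<close>)
  then have "continuous_on J (speed_sq \<gamma>)"
  proof (rule continuous_on_eq)
    fix s assume "s \<in> J"
    then have s: "s \<in> I" "\<gamma> s \<in> fst \<phi>" by (auto simp: J_def)
    show "form_at \<phi> (chart_inv \<phi> ((snd \<phi> \<circ> \<gamma>) s)) (?z' s) (\<i> *s ?z' s) = speed_sq \<gamma> s"
      using smooth_curve_velocity(3)[OF sm s(1) \<phi>(1) s(2)] chart_inv_chart[OF \<phi>(1) s(2)] by simp
  qed
  then show "isCont (speed_sq \<gamma>) t" using oJ tJ by (simp add: continuous_on_eq_continuous_at)
qed

lemma velocity_cong:
  assumes "open I" "t \<in> I" "\<And>s. s \<in> I \<Longrightarrow> \<gamma> s = g s"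
  shows "velocity A \<gamma> t = velocity A g t"
proof -
  have "eventually (\<lambda>s. s \<in> I) (nhds t)" using assms(1,2) by (rule eventually_nhds_in_open)
  then have "vector_derivative (snd \<phi> \<circ> \<gamma>) (at t) = vector_derivative (snd \<phi> \<circ> g) (at t)" for \<phi> :: "('m, 'n) chart"
    by (intro vector_derivative_cong_eq refl) (auto elim!: eventually_mono simp: assms(3))
  then show ?thesis using assms(2,3) by (auto simp: velocity_def fun_eq_iff)
qed

lemma speed_sq_cong:
  assumes "open I" "t \<in> I" "\<And>s. s \<in> I \<Longrightarrow> \<gamma> s = g s"
  shows "speed_sq \<gamma> t = speed_sq g t"
  using velocity_cong[OF assms] assms(2,3) by (simp add: speed_sq_def)

lemma smooth_curve_on_cong:
  assumes g: "smooth_curve_on A I g" and J: "open J" "J \<subseteq> I" "\<And>s. s \<in> J \<Longrightarrow> \<gamma> s = g s"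
  shows "smooth_curve_on A J \<gamma>"
  unfolding smooth_curve_on_def smooth_on_def
proof (intro conjI ballI allI J(1))
  have cg: "continuous_on J g" using g J continuous_on_subset unfolding smooth_curve_on_def by blast
  then show c\<gamma>: "continuous_on J \<gamma>" using J(3) by (metis continuous_on_eq)
  fix \<phi> k assume \<phi>: "\<phi> \<in> A"
  let ?T = "{t \<in> J. \<gamma> t \<in> fst \<phi>}"
  have "?T = J \<inter> \<gamma> -` fst \<phi>" by auto
  then have oT: "open ?T" using continuous_open_preimage[OF c\<gamma> J(1) open_chart_dom[OF \<phi>]] by simp
  have "Ck_on k (snd \<phi> \<circ> g) {t \<in> I. g t \<in> fst \<phi>}"
    using g \<phi> unfolding smooth_curve_on_def smooth_on_def by blast
  then have "Ck_on k (snd \<phi> \<circ> g) ?T" by (rule Ck_on_subset) (use J in auto)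
  then show "Ck_on k (snd \<phi> \<circ> \<gamma>) ?T" by (rule Ck_on_cong[OF oT, rotated]) (use J in auto)
qed

text \<open>Since \<open>integral\<close> is 0 on functions that are not integrable, a length
  carries information only once its speed is known to be integrable. On each piece the speed agrees,
  except at the two ends, with the continuous speed of a smooth curve on a larger open set. The
  exceptional set S consists of the break points, where the two-sided derivative may fail.\<close>

lemma piecewise_smooth_curve_regular:
  assumes "piecewise_smooth_curve A \<gamma>"
  obtains S where "finite S" "{0, 1} \<subseteq> S"
    "\<And>x. x \<in> {0..1} - S \<Longrightarrow> \<exists>J. x \<in> J \<and> smooth_curve_on A J \<gamma>"
    "(\<lambda>t. sqrt (speed_sq \<gamma> t)) integrable_on {0..1}"
proof -
  obtain m t where t: "t (0::nat) = 0" "t m = 1"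
    and piece: "\<And>i. i < m \<Longrightarrow> t i < t (Suc i)"
      "\<And>i. i < m \<Longrightarrow> \<exists>I g. {t i..t (Suc i)} \<subseteq> I \<and> smooth_curve_on A I g \<and> (\<forall>s\<in>{t i..t (Suc i)}. \<gamma> s = g s)"
    using assms unfolding piecewise_smooth_curve_def by metis
  have reg: "smooth_curve_on A {t i<..<t (Suc i)} \<gamma>" if i: "i < m" for i
  proof -
    obtain I g where g: "{t i..t (Suc i)} \<subseteq> I" "smooth_curve_on A I g" "\<forall>s\<in>{t i..t (Suc i)}. \<gamma> s = g s"
      using piece(2)[OF i] by blast
    show ?thesis by (rule smooth_curve_on_cong[OF g(2)]) (use g(1,3) in auto)
  qed
  have int: "(\<lambda>s. sqrt (speed_sq \<gamma> s)) integrable_on {t i..t (Suc i)}" if i: "i < m" for i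
  proof -
    obtain I g where g: "{t i..t (Suc i)} \<subseteq> I" "smooth_curve_on A I g" "\<forall>s\<in>{t i..t (Suc i)}. \<gamma> s = g s"
      using piece(2)[OF i] by blast
    have "continuous_on {t i..t (Suc i)} (\<lambda>s. sqrt (speed_sq g s))"
      by (intro continuous_intros continuous_on_subset[OF continuous_on_speed_sq[OF g(2)] g(1)])
    then have "(\<lambda>s. sqrt (speed_sq g s)) integrable_on {t i..t (Suc i)}" by (rule integrable_continuous_real)
    then show ?thesis
    proof (rule integrable_spike_finite[of "{t i, t (Suc i)}", rotated 2])
      fix s assume s: "s \<in> {t i..t (Suc i)} - {t i, t (Suc i)}"
      have "speed_sq \<gamma> s = speed_sq g s"
        by (rule speed_sq_cong[of "{t i<..<t (Suc i)}"]) (use s g(3) in auto)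
      then show "sqrt (speed_sq \<gamma> s) = sqrt (speed_sq g s)" by simp
    qed simp
  qed
  have mono: "0 \<le> t i \<and> (\<lambda>s. sqrt (speed_sq \<gamma> s)) integrable_on {0..t i}" if "i \<le> m" for i
    using that
  proof (induction i)
    case 0
    then show ?case using t(1) integrable_on_refl[of _ "0::real"] by simp
  next
    case (Suc i)
    then have IH: "0 \<le> t i" "(\<lambda>s. sqrt (speed_sq \<gamma> s)) integrable_on {0..t i}" and i: "i < m" by auto
    have "t i \<le> t (Suc i)" using piece(1)[OF i] by simp
    then show ?case using Henstock_Kurzweil_Integration.integrable_combine[OF IH(1) _ IH(2) int[OF i]] IH(1) by simp
  qed
  show thesis
  proof (rule that[of "t ` {..m}"])
    show "{0, 1} \<subseteq> t ` {..m}" using t by (metis atMost_iff image_eqI insert_subset le_refl zero_le empty_subsetI)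
    fix x assume x: "x \<in> {0..1} - t ` {..m}"
    then have "x \<noteq> t m" by auto
    then obtain i where i: "i < m" "t i \<le> x" "x < t (Suc i)"
      using partition_interval[of t x m] x t by auto
    moreover have "x \<noteq> t i" using x i by auto
    ultimately show "\<exists>J. x \<in> J \<and> smooth_curve_on A J \<gamma>" using reg[OF i(1)] by (intro exI[of _ "{t i<..<t (Suc i)}"]) auto
  qed (use mono[of m] t in auto)
qed

text \<open>Taming makes the continuous function \<omega> (w, i w) positive on the compact product
  of the ball and the unit sphere; homogeneity of degree two does the rest. The constant is the
  square root of the minimum.\<close>

lemma form_lower_bound:
  assumes \<phi>: "\<phi> \<in> A" and ball: "cball z0 r \<subseteq> snd \<phi> ` fst \<phi>"
  obtains c where "c > 0" "\<And>z w. z \<in> cball z0 r \<Longrightarrow> (c * norm w)\<^sup>2 \<le> form_at \<phi> (chart_inv \<phi> z) w (\<i> *s w)"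
proof (cases "r < 0")
  case True
  then show thesis using that[of 1] by simp
next
  case False
  let ?S = "cball z0 r \<times> sphere (0::complex^'n) 1"
  have "continuous_on ?S (\<lambda>x. form_at \<phi> (chart_inv \<phi> (fst x)) (snd x) (\<i> *s snd x))"
  proof (rule continuous_on_form_at[OF \<phi>])
    show "continuous_on ?S (\<lambda>x. \<i> *s snd x)"
      using continuous_on_compose2[OF linear_continuous_on[OF bounded_linear_i_scale, of UNIV] continuous_on_snd[OF continuous_on_id]] by simp
  qed (use ball in \<open>auto intro!: continuous_intros\<close>)
  moreover have "compact ?S" by (intro compact_Times compact_cball compact_sphere)
  moreover have "sphere (0::complex^'n) 1 \<noteq> {}" by simp
  then have "?S \<noteq> {}" using False by auto
  ultimately obtain x0 where x0: "x0 \<in> ?S" "\<And>x. x \<in> ?S \<Longrightarrow>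
      form_at \<phi> (chart_inv \<phi> (fst x0)) (snd x0) (\<i> *s snd x0) \<le> form_at \<phi> (chart_inv \<phi> (fst x)) (snd x) (\<i> *s snd x)"
    using continuous_attains_inf[of ?S] by blast
  define m where "m = form_at \<phi> (chart_inv \<phi> (fst x0)) (snd x0) (\<i> *s snd x0)"
  have "snd x0 \<noteq> 0" using x0(1) by auto
  moreover have "chart_inv \<phi> (fst x0) \<in> fst \<phi>" using x0(1) ball chart_inv_in[OF \<phi>] by auto
  ultimately have m: "m > 0" unfolding m_def using form_at_tame[OF \<phi>] by blast
  show thesis
  proof (rule that[of "sqrt m"])
    fix z w :: "complex^'n" assume z: "z \<in> cball z0 r"
    have q: "chart_inv \<phi> z \<in> fst \<phi>" using z ball chart_inv_in[OF \<phi>] by auto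
    show "(sqrt m * norm w)\<^sup>2 \<le> form_at \<phi> (chart_inv \<phi> z) w (\<i> *s w)"
    proof (cases "w = 0")
      case True
      then show ?thesis using form_at_bilinear(2)[OF \<phi> q, of 0 0] by simp
    next
      case False
      define v where "v = (1 / norm w) *\<^sub>R w"
      have "norm v = 1" using False by (simp add: v_def)
      then have mv: "m \<le> form_at \<phi> (chart_inv \<phi> z) v (\<i> *s v)"
        using x0(2)[of "(z, v)"] z by (simp add: m_def)
      have w: "w = norm w *\<^sub>R v" using False by (simp add: v_def)
      have "\<i> *s w = norm w *\<^sub>R (\<i> *s v)" by (subst w) (simp add: vec_eq_iff)
      then have "form_at \<phi> (chart_inv \<phi> z) w (\<i> *s w) = (norm w)\<^sup>2 * form_at \<phi> (chart_inv \<phi> z) v (\<i> *s v)"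
        using form_at_bilinear(2,5)[OF \<phi> q] w by (metis (no_types, lifting) mult.assoc power2_eq_square)
      then show ?thesis using mult_left_mono[OF mv, of "(norm w)\<^sup>2"] m by (simp add: power_mult_distrib mult.commute)
    qed
  qed (use m in simp)
qed

lemma curve_length_eq: "curve_length A \<omega> \<gamma> = integral {0..1} (\<lambda>t. sqrt (speed_sq \<gamma> t))"
  by (simp add: curve_length_def speed_sq_def)

text \<open>Before its first exit from the coordinate ball the curve reaches coordinate distance
  r/2, and up to then its speed is at least c times its Euclidean coordinate speed.\<close>

lemma curve_length_lower_bound:
  assumes \<phi>: "\<phi> \<in> A" "p \<in> fst \<phi>" and ball: "cball (snd \<phi> p) r \<subseteq> snd \<phi> ` fst \<phi>" and r: "r > 0"
    and c: "c > 0" "\<And>z w. z \<in> cball (snd \<phi> p) r \<Longrightarrow> (c * norm w)\<^sup>2 \<le> form_at \<phi> (chart_inv \<phi> z) w (\<i> *s w)"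
    and \<gamma>: "piecewise_smooth_curve A \<gamma>" "\<gamma> 0 = p" "\<gamma> 1 \<notin> chart_inv \<phi> ` ball (snd \<phi> p) r"
  shows "c * (r / 2) \<le> curve_length A \<omega> \<gamma>"
proof -
  let ?z0 = "snd \<phi> p"
  define U where "U = chart_inv \<phi> ` ball ?z0 r"
  have bsub: "ball ?z0 r \<subseteq> snd \<phi> ` fst \<phi>" using ball by auto
  have U: "U = fst \<phi> \<inter> snd \<phi> -` ball ?z0 r" unfolding U_def by (rule chart_inv_image_eq[OF \<phi>(1) bsub])
  have oU: "open U" unfolding U_def by (intro open_chart_inv_image \<phi> bsub open_ball)
  have c\<gamma>: "continuous_on {0..1} \<gamma>" using \<gamma>(1) by (simp add: piecewise_smooth_curve_def)
  define T where "T = {0..1} \<inter> \<gamma> -` (- U)"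
  have "closed T" unfolding T_def
    by (rule continuous_closed_preimage[OF c\<gamma>]) (use oU in auto)
  moreover have "T \<subseteq> {0..1}" by (auto simp: T_def)
  ultimately have "compact T" using compact_Icc compact_Int_closed by (metis inf.absorb2)
  moreover have "1 \<in> T" using \<gamma>(3) by (simp add: T_def U_def)
  ultimately obtain t1 where t1: "t1 \<in> T" "\<And>s. s \<in> T \<Longrightarrow> t1 \<le> s"
    using compact_attains_inf[of T] by auto
  have t1p: "0 < t1"
  proof -
    have "\<gamma> 0 \<in> U" using \<gamma>(2) \<phi> r by (simp add: U)
    then have "t1 \<noteq> 0" using t1(1) by (auto simp: T_def)
    then show ?thesis using t1(1) by (auto simp: T_def)
  qed
  have t11: "t1 \<le> 1" using t1(1) by (simp add: T_def)
  have inU: "\<gamma> s \<in> U" if "0 \<le> s" "s < t1" for s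
    using t1(2)[of s] that t11 by (force simp: T_def)
  define z where "z = snd \<phi> \<circ> \<gamma>"
  \<comment> \<open>The chart describes the curve only before the exit time t1. If the curve stayed
    within radius r/2 until then, its limit at t1 would lie in the image of that smaller closed
    ball, which is compact and hence closed, and so still in U.\<close>
  have "\<exists>s. 0 < s \<and> s < t1 \<and> r / 2 \<le> norm (z s - ?z0)"
  proof (rule ccontr)
    assume "\<not> ?thesis"
    then have small: "norm (z s - ?z0) < r / 2" if "0 < s" "s < t1" for s using that by force
    let ?K = "chart_inv \<phi> ` cball ?z0 (r / 2)"
    have sub: "cball ?z0 (r / 2) \<subseteq> ball ?z0 r" using r by auto
    have "compact ?K"
      by (rule compact_continuous_image[OF continuous_on_subset[OF continuous_on_chart_inv[OF \<phi>(1)]] compact_cball])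
         (use sub bsub in blast)
    then have clK: "closed ?K" by (rule compact_imp_closed)
    have inK: "\<gamma> s \<in> ?K" if "0 < s" "s < t1" for s
    proof -
      have "z s \<in> cball ?z0 (r / 2)" using small[OF that] by (simp add: dist_norm norm_minus_commute)
      moreover have "chart_inv \<phi> (z s) = \<gamma> s" using inU[of s] that chart_inv_chart[OF \<phi>(1)] by (simp add: U z_def)
      ultimately show ?thesis by (metis image_eqI)
    qed
    have "(\<gamma> \<longlongrightarrow> \<gamma> t1) (at t1 within {0..1})"
      using c\<gamma> t1p t11 by (auto simp: continuous_on)
    then have "(\<gamma> \<longlongrightarrow> \<gamma> t1) (at t1 within {0<..<t1})"
      by (rule tendsto_within_subset) (use t11 in auto)
    moreover have "\<forall>\<^sub>F s in at t1 within {0<..<t1}. \<gamma> s \<in> ?K"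
      using inK by (auto simp: eventually_at_filter)
    moreover have "at t1 within {0<..<t1} \<noteq> bot"
      using t1p by (simp add: trivial_limit_within islimpt_greaterThanLessThan2)
    ultimately have "\<gamma> t1 \<in> ?K" using Lim_in_closed_set[OF clK] by blast
    then have "\<gamma> t1 \<in> U" using sub unfolding U_def by blast
    then show False using t1(1) by (simp add: T_def)
  qed
  then obtain s where s: "0 < s" "s < t1" "r / 2 \<le> norm (z s - ?z0)" by blast
  obtain S where S: "finite S" "{0, 1} \<subseteq> S" "\<And>x. x \<in> {0..1} - S \<Longrightarrow> \<exists>J. x \<in> J \<and> smooth_curve_on A J \<gamma>"
      and int: "(\<lambda>t. sqrt (speed_sq \<gamma> t)) integrable_on {0..1}"
    using piecewise_smooth_curve_regular[OF \<gamma>(1)] by blast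
  define z' where "z' x = (if x \<in> S then 0 else frechet_derivative z (at x) 1)" for x
  have sub01: "{0..s} \<subseteq> {0..1}" using s t11 by auto
  have cz: "continuous_on {0..s} z"
    unfolding z_def
    by (rule continuous_on_compose[OF continuous_on_subset[OF c\<gamma> sub01]], rule continuous_on_subset[OF continuous_on_chart[OF \<phi>(1)]])
       (use inU s in \<open>auto simp: U\<close>)
  have bound: "(z has_vector_derivative z' x) (at x)" "c * norm (z' x) \<le> sqrt (speed_sq \<gamma> x)"
    if x: "x \<in> {0..s} - S" for x
  proof -
    obtain J where J: "x \<in> J" "smooth_curve_on A J \<gamma>" using S(3)[of x] x sub01 by blast
    have xU: "\<gamma> x \<in> U" using inU[of x] x s by auto
    then have x\<phi>: "\<gamma> x \<in> fst \<phi>" by (simp add: U)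
    note v = smooth_curve_velocity[OF J(2,1) \<phi>(1) x\<phi>, folded z_def]
    have z'x: "z' x = frechet_derivative z (at x) 1" using x by (simp add: z'_def)
    show "(z has_vector_derivative z' x) (at x)" using v(1) z'x by simp
    have "z x \<in> cball ?z0 r" using xU by (simp add: U z_def)
    moreover have "chart_inv \<phi> (z x) = \<gamma> x" using chart_inv_chart[OF \<phi>(1) x\<phi>] by (simp add: z_def)
    ultimately have "(c * norm (z' x))\<^sup>2 \<le> speed_sq \<gamma> x"
      using c(2)[of "z x" "z' x"] v(3) z'x by simp
    then show "c * norm (z' x) \<le> sqrt (speed_sq \<gamma> x)" by (rule real_le_rsqrt)
  qed
  have zint: "(z' has_integral (z s - z 0)) {0..s}"
    by (rule fundamental_theorem_of_calculus_interior_strong[OF S(1) _ _ cz]) (use s bound(1) in auto)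
  \<comment> \<open>At break points \<open>velocity\<close> is an arbitrary value and the root need
    not be nonnegative; setting the integrand to 0 on this finite set leaves all integrals
    unchanged.\<close>
  define \<sigma> where "\<sigma> x = (if x \<in> S then 0 else sqrt (speed_sq \<gamma> x))" for x
  have \<sigma>int: "\<sigma> integrable_on {0..1}"
    by (rule integrable_spike_finite[OF S(1) _ int]) (simp add: \<sigma>_def)
  have len: "curve_length A \<omega> \<gamma> = integral {0..1} \<sigma>"
    unfolding curve_length_eq
    by (rule integral_spike[OF negligible_finite[OF S(1)]]) (simp add: \<sigma>_def)
  have \<sigma>0: "0 \<le> \<sigma> x" if x: "x \<in> {0..1}" for x
  proof (cases "x \<in> S")
    case False
    obtain J where J: "x \<in> J" "smooth_curve_on A J \<gamma>" using S(3)[of x] x False by blast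
    obtain \<psi> where \<psi>: "\<psi> \<in> A" "\<gamma> x \<in> fst \<psi>" using chart_covers by blast
    have "0 \<le> form_at \<psi> (\<gamma> x) w (\<i> *s w)" for w
      using form_at_tame[OF \<psi>, of w] form_at_bilinear(2)[OF \<psi>, of 0 0] by (cases "w = 0") auto
    then have "0 \<le> speed_sq \<gamma> x" using smooth_curve_velocity(3)[OF J(2,1) \<psi>] by simp
    then show ?thesis by (simp add: \<sigma>_def)
  qed (simp add: \<sigma>_def)
  have \<sigma>ints: "\<sigma> integrable_on {0..s}" by (rule integrable_on_subinterval[OF \<sigma>int sub01])
  have "norm (integral {0..s} z') \<le> integral {0..s} (\<lambda>x. (1 / c) * \<sigma> x)"
  proof (rule integral_norm_bound_integral)
    show "z' integrable_on {0..s}" using zint by blast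
    show "(\<lambda>x. (1 / c) * \<sigma> x) integrable_on {0..s}" using integrable_on_cmult_left[OF \<sigma>ints, of "1 / c"] by simp
    show "norm (z' x) \<le> (1 / c) * \<sigma> x" if "x \<in> {0..s}" for x
    proof (cases "x \<in> S")
      case False
      then show ?thesis using bound(2)[of x] that c(1) by (simp add: \<sigma>_def field_simps)
    qed (simp add: z'_def \<sigma>_def)
  qed
  then have "norm (z s - z 0) \<le> (1 / c) * integral {0..s} \<sigma>"
    using zint by (simp add: integral_unique)
  moreover have "integral {0..s} \<sigma> \<le> integral {0..1} \<sigma>"
    by (rule integral_subset_le[OF sub01 \<sigma>ints \<sigma>int]) (use \<sigma>0 in auto)
  moreover have "z 0 = ?z0" by (simp add: z_def \<gamma>(2))
  ultimately have "r / 2 \<le> (1 / c) * integral {0..1} \<sigma>"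
    using s(3) c(1) by (smt (verit) divide_pos_pos mult_left_mono)
  then show ?thesis unfolding len using c(1) by (simp add: field_simps)
qed

lemma riem_ball_subset_coordinate_ball:
  assumes \<phi>: "\<phi> \<in> A" "p \<in> fst \<phi>" and ball: "cball (snd \<phi> p) r \<subseteq> snd \<phi> ` fst \<phi>" and r: "r > 0"
  obtains \<epsilon>0 where "\<epsilon>0 > 0" "\<And>\<epsilon>. \<epsilon> \<le> \<epsilon>0 \<Longrightarrow> riem_ball A \<omega> p \<epsilon> \<subseteq> chart_inv \<phi> ` ball (snd \<phi> p) r"
proof -
  obtain c where c: "c > 0" "\<And>z w. z \<in> cball (snd \<phi> p) r \<Longrightarrow> (c * norm w)\<^sup>2 \<le> form_at \<phi> (chart_inv \<phi> z) w (\<i> *s w)"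
    using form_lower_bound[OF \<phi>(1) ball] by blast
  show thesis
  proof (rule that[of "c * (r / 2)"])
    fix \<epsilon> assume \<epsilon>: "\<epsilon> \<le> c * (r / 2)"
    show "riem_ball A \<omega> p \<epsilon> \<subseteq> chart_inv \<phi> ` ball (snd \<phi> p) r"
    proof
      fix q assume "q \<in> riem_ball A \<omega> p \<epsilon>"
      then have "riem_dist A \<omega> p q < ereal \<epsilon>" by (simp add: riem_ball_def)
      then obtain \<gamma> where \<gamma>: "piecewise_smooth_curve A \<gamma>" "\<gamma> 0 = p" "\<gamma> 1 = q" "curve_length A \<omega> \<gamma> < \<epsilon>"
        unfolding riem_dist_def INF_less_iff by auto
      show "q \<in> chart_inv \<phi> ` ball (snd \<phi> p) r"
      proof (rule ccontr)
        assume "q \<notin> chart_inv \<phi> ` ball (snd \<phi> p) r"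
        then have "c * (r / 2) \<le> curve_length A \<omega> \<gamma>"
          using curve_length_lower_bound[OF \<phi> ball r c \<gamma>(1,2)] \<gamma>(3) by simp
        then show False using \<gamma>(4) \<epsilon> by simp
      qed
    qed
  qed (use c r in simp)
qed

lemma centre_in_riem_ball:
  assumes "\<epsilon> > 0"
  shows "p \<in> riem_ball A \<omega> p \<epsilon>"
proof -
  have sm: "smooth_curve_on A UNIV (\<lambda>t. p)"
    unfolding smooth_curve_on_def smooth_on_def
    by (auto simp: o_def intro: Ck_on_const)
  have pw: "piecewise_smooth_curve A (\<lambda>t. p)"
    unfolding piecewise_smooth_curve_def
    using sm by (intro conjI exI[of _ "1::nat"] exI[of _ "\<lambda>i. real i"]) auto
  obtain \<phi> where \<phi>: "\<phi> \<in> A" "p \<in> fst \<phi>" using chart_covers by blast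
  have "velocity A (\<lambda>t. p) t = coord_vec A \<phi> p 0" for t
    using velocity_eq_coord_vec[of \<phi> "\<lambda>t. p" t UNIV 0] \<phi> by (simp add: o_def)
  then have "speed_sq (\<lambda>t. p) t = 0" for t
    unfolding speed_sq_def using riem_metric_coord[OF \<phi>, of 0] form_at_bilinear(2)[OF \<phi>, of 0 0] by simp
  then have "curve_length A \<omega> (\<lambda>t. p) = 0" by (simp add: curve_length_eq)
  moreover have "riem_dist A \<omega> p p \<le> ereal (curve_length A \<omega> (\<lambda>t. p))"
    unfolding riem_dist_def by (rule INF_lower) (use pw in auto)
  ultimately show ?thesis using assms
    by (auto simp: riem_ball_def intro: le_less_trans)
qed

end

section \<open>Transverse Lagrangian submanifolds\<close>

lemma lagrangian_pair_form:
  fixes \<Omega> :: "complex^'n::finite \<Rightarrow> complex^'n \<Rightarrow> real"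
  assumes \<Omega>: "bounded_bilinear \<Omega>" and alt: "\<And>a b. \<Omega> a b = - \<Omega> b a"
    and tame: "\<And>a. a \<noteq> 0 \<Longrightarrow> \<Omega> a (\<i> *s a) > 0"
    and T: "subspace T1" "subspace T2"
    and lag1: "\<And>a b. a \<in> T1 \<Longrightarrow> b \<in> T1 \<Longrightarrow> \<Omega> a b = 0"
    and lag2: "\<And>a b. a \<in> T2 \<Longrightarrow> b \<in> T2 \<Longrightarrow> \<Omega> a b = 0"
    and span: "\<And>v. \<exists>x\<in>T1. \<exists>y\<in>T2. v = x + y"
  obtains H :: "complex^'n \<Rightarrow> complex^'n \<Rightarrow> real"
  where "bounded_bilinear H" "\<And>v w. H v w = H w v" "\<And>v w. H (\<i> *s v) (\<i> *s w) = - H v w"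
    "\<And>v. v \<in> T1 \<Longrightarrow> v \<noteq> 0 \<Longrightarrow> H v v > 0" "\<And>v. v \<in> T2 \<Longrightarrow> v \<noteq> 0 \<Longrightarrow> H v v < 0"
proof -
  interpret \<Omega>: bounded_bilinear \<Omega> by fact
  interpret J: bounded_linear "\<lambda>v::complex^'n. \<i> *s v" by (rule bounded_linear_i_scale)
  \<comment> \<open>A common vector is orthogonal for \<Omega> to T1 + T2, which is everything, and
    in particular to i a; this contradicts taming.\<close>
  have inter: "a = 0" if "a \<in> T1" "a \<in> T2" for a
  proof (rule ccontr)
    assume "a \<noteq> 0"
    obtain x y where "x \<in> T1" "y \<in> T2" "\<i> *s a = x + y" using span by blast
    then have "\<Omega> a (\<i> *s a) = 0" using lag1 lag2 that by (simp add: \<Omega>.add_right)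
    then show False using tame[OF \<open>a \<noteq> 0\<close>] by simp
  qed
  have "\<forall>v. \<exists>s. \<exists>x\<in>T1. \<exists>y\<in>T2. v = x + y \<and> s = x - y" using span by blast
  then obtain \<sigma> where \<sigma>: "\<And>v. \<exists>x\<in>T1. \<exists>y\<in>T2. v = x + y \<and> \<sigma> v = x - y" by metis
  have \<sigma>u: "\<sigma> (x + y) = x - y" if xy: "x \<in> T1" "y \<in> T2" for x y
  proof -
    obtain x' y' where *: "x' \<in> T1" "y' \<in> T2" "x + y = x' + y'" "\<sigma> (x + y) = x' - y'" using \<sigma> by blast
    have e: "x - x' = y' - y" using *(3) by (simp add: algebra_simps)
    moreover have "x - x' \<in> T1" "y' - y \<in> T2" using T xy * by (auto intro: subspace_diff)
    ultimately have "x - x' = 0" using inter by metis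
    then show ?thesis using e * by simp
  qed
  have lin: "linear \<sigma>"
  proof (rule linearI)
    fix v w
    obtain x y where v: "x \<in> T1" "y \<in> T2" "v = x + y" using span by blast
    obtain x' y' where w: "x' \<in> T1" "y' \<in> T2" "w = x' + y'" using span by blast
    have vw: "v + w = (x + x') + (y + y')" using v w by simp
    have "\<sigma> (v + w) = (x + x') - (y + y')"
      unfolding vw using v w T by (intro \<sigma>u subspace_add)
    then show "\<sigma> (v + w) = \<sigma> v + \<sigma> w" using \<sigma>u v w by simp
  next
    fix r v
    obtain x y where v: "x \<in> T1" "y \<in> T2" "v = x + y" using span by blast
    have "\<sigma> (r *\<^sub>R v) = r *\<^sub>R x - r *\<^sub>R y"
      using \<sigma>u[of "r *\<^sub>R x" "r *\<^sub>R y"] v T by (simp add: subspace_scale scaleR_add_right)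
    then show "\<sigma> (r *\<^sub>R v) = r *\<^sub>R \<sigma> v" using \<sigma>u v by (simp add: scaleR_diff_right)
  qed
  then interpret \<sigma>: bounded_linear \<sigma> by (simp add: linear_conv_bounded_linear)
  \<comment> \<open>Only the mixed terms between T1 and T2 survive, and \<sigma> gives the two
    arguments of such a term opposite signs.\<close>
  have skew: "\<Omega> (\<sigma> v) w = - \<Omega> v (\<sigma> w)" for v w
  proof -
    obtain x y where v: "x \<in> T1" "y \<in> T2" "v = x + y" using span by blast
    obtain x' y' where w: "x' \<in> T1" "y' \<in> T2" "w = x' + y'" using span by blast
    show ?thesis using \<sigma>u v w lag1 lag2
      by (simp add: \<Omega>.add_left \<Omega>.add_right \<Omega>.diff_left \<Omega>.diff_right)
  qed
  \<comment> \<open>The polarisation of v \<mapsto> \<Omega> (\<sigma> v) (i v), which is \<Omega> v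
    (i v) on T1 and its negative on T2.\<close>
  define H where "H v w = (\<Omega> (\<sigma> v) (\<i> *s w) + \<Omega> (\<sigma> w) (\<i> *s v)) / 2" for v w
  have "linear (H x)" for x
    by (rule linearI)
       (simp_all add: H_def J.add J.scaleR \<sigma>.add \<sigma>.scaleR \<Omega>.add_left \<Omega>.add_right \<Omega>.scaleR_left \<Omega>.scaleR_right field_simps)
  moreover have "linear (\<lambda>x. H x y)" for y
    by (rule linearI)
       (simp_all add: H_def J.add J.scaleR \<sigma>.add \<sigma>.scaleR \<Omega>.add_left \<Omega>.add_right \<Omega>.scaleR_left \<Omega>.scaleR_right field_simps)
  ultimately have Hb: "bounded_bilinear H"
    by (intro bilinear_conv_bounded_bilinear[THEN iffD1]) (simp add: bilinear_def)
  have HJ: "H (\<i> *s v) (\<i> *s w) = - H v w" for v w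
  proof -
    \<comment> \<open>So replacing both arguments of H by their multiples with i exchanges its two
      summands and changes their sign.\<close>
    have "\<Omega> (\<sigma> (\<i> *s v)) (\<i> *s (\<i> *s w)) = - \<Omega> (\<sigma> w) (\<i> *s v)" for v w
      unfolding i_scale_i_scale using skew[of "\<i> *s v" w] alt[of "\<i> *s v" "\<sigma> w"] by (simp add: \<Omega>.minus_right)
    then show ?thesis unfolding H_def by (simp add: field_simps)
  qed
  show thesis
  proof (rule that[OF Hb _ HJ])
    show "H v w = H w v" for v w by (simp add: H_def)
    fix v :: "complex^'n" assume v: "v \<noteq> 0"
    show "H v v > 0" if "v \<in> T1"
      using \<sigma>u[of v 0] that T tame[OF v] by (simp add: H_def subspace_0)
    show "H v v < 0" if "v \<in> T2"
      using \<sigma>u[of 0 v] that T tame[OF v] by (simp add: H_def subspace_0 \<Omega>.minus_left)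
  qed
qed

text \<open>On the unit sphere H v v and |A v| are never both nonpositive, so their maximum has a
  positive minimum m. At a zero z of G differentiability gives |A z| \<le> (m/2) |z|, too little to
  account for m, so H must supply the bound.\<close>

lemma quadratic_positive_near_kernel:
  fixes H :: "complex^'n::finite \<Rightarrow> complex^'n \<Rightarrow> real"
  assumes H: "bounded_bilinear H" and G: "(G has_derivative A) (at 0)" "G 0 = 0"
    and pos: "\<And>v. A v = 0 \<Longrightarrow> v \<noteq> 0 \<Longrightarrow> H v v > 0"
  obtains \<delta> m where "\<delta> > 0" "m > 0" "\<And>z. norm z < \<delta> \<Longrightarrow> G z = 0 \<Longrightarrow> m * (norm z)\<^sup>2 \<le> H z z"
proof -
  interpret H: bounded_bilinear H by fact
  interpret A: bounded_linear A by (rule has_derivative_bounded_linear[OF G(1)])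
  let ?f = "\<lambda>z. max (H z z) (norm (A z))"
  have "continuous_on (sphere 0 1) ?f"
    by (intro continuous_on_max H.continuous_on continuous_on_norm linear_continuous_on A.bounded_linear_axioms continuous_on_id)
  moreover have "sphere (0::complex^'n) 1 \<noteq> {}" by simp
  ultimately obtain v0 where v0: "v0 \<in> sphere 0 1" "\<And>v. v \<in> sphere 0 1 \<Longrightarrow> ?f v0 \<le> ?f v"
    using continuous_attains_inf[OF compact_sphere] by blast
  define m where "m = ?f v0"
  have "v0 \<noteq> 0" using v0(1) by auto
  then have m: "m > 0" unfolding m_def using pos[of v0] by (cases "A v0 = 0") (auto simp: less_max_iff_disj)
  have key: "m * (norm z)\<^sup>2 \<le> H z z" if "norm (A z) < m * norm z" for z
  proof -
    have z0: "z \<noteq> 0" using that by auto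
    define v where "v = (1 / norm z) *\<^sub>R z"
    have "v \<in> sphere 0 1" using z0 by (simp add: v_def)
    then have "m \<le> ?f v" using v0(2) by (simp add: m_def)
    moreover have "norm (A v) < m" using that z0 by (simp add: v_def A.scaleR field_simps)
    ultimately have "m \<le> H v v" by (auto simp: max_def split: if_splits)
    moreover have "H v v = H z z / (norm z)\<^sup>2"
      by (simp add: v_def H.scaleR_left H.scaleR_right power2_eq_square)
    ultimately show ?thesis using z0 by (simp add: field_simps)
  qed
  obtain \<delta> where \<delta>: "\<delta> > 0" "\<And>y. norm (y - 0) < \<delta> \<Longrightarrow> norm (G y - G 0 - A (y - 0)) \<le> m / 2 * norm (y - 0)"
    using G(1) m unfolding has_derivative_at_alt by (meson half_gt_zero)
  show thesis
  proof (rule that[OF \<delta>(1) m])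
    fix z assume z: "norm z < \<delta>" "G z = 0"
    then have 1: "norm (A z) \<le> m / 2 * norm z" using \<delta>(2)[of z] G(2) by simp
    show "m * (norm z)\<^sup>2 \<le> H z z"
    proof (cases "z = 0")
      case True then show ?thesis by (simp add: H.zero_left)
    next
      case False
      then have "m / 2 * norm z < m * norm z" using m by simp
      then show ?thesis using 1 by (intro key) linarith
    qed
  qed
qed

lemma cmod_complexify_bound:
  fixes H :: "complex^'n::finite \<Rightarrow> complex^'n \<Rightarrow> real"
  assumes "bounded_bilinear H"
  obtains M where "M > 0" "\<And>z. cmod (complexify H z) \<le> M * (norm z)\<^sup>2"
proof -
  interpret H: bounded_bilinear H by fact
  obtain B where B: "B > 0" "\<And>a b. norm (H a b) \<le> norm a * norm b * B" using H.pos_bounded by blast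
  have "cmod (complexify H z) \<le> (2 * B) * (norm z)\<^sup>2" for z
  proof -
    have "cmod (complexify H z) \<le> \<bar>Re (complexify H z)\<bar> + \<bar>Im (complexify H z)\<bar>" by (rule cmod_le)
    also have "\<dots> \<le> norm z * norm z * B + norm z * norm z * B"
      using B(2)[of z z] B(2)[of z "\<i> *s z"] by (intro add_mono) (auto simp: complexify_def norm_i_scale)
    finally show ?thesis by (simp add: power2_eq_square algebra_simps)
  qed
  then show thesis using that[of "2 * B"] B(1) by simp
qed

section \<open>Transfer to the manifold and assembly of the proof\<close>

context taming_form
begin

text \<open>An embedded submanifold need not be closed, but inside the chart it is the zero set of a
  continuous map, and that gives closedness within the compact set C.\<close>

lemma compact_in_submanifold:
  assumes \<phi>: "\<phi> \<in> A" and C: "compact C" "C \<subseteq> fst \<phi>" "snd \<phi> ` C \<subseteq> N"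
    and G: "continuous_on N G" "\<And>z. z \<in> N \<Longrightarrow> chart_inv \<phi> z \<in> L \<longleftrightarrow> G z = (0::complex^'n)"
  shows "compact (L \<inter> C)"
proof -
  define Z where "Z = {z \<in> snd \<phi> ` C. G z = 0}"
  have cC: "compact (snd \<phi> ` C)"
    by (rule compact_continuous_image[OF continuous_on_subset[OF continuous_on_chart[OF \<phi>] C(2)] C(1)])
  have "closed Z" unfolding Z_def
    by (rule continuous_closed_preimage_constant[OF continuous_on_subset[OF G(1) C(3)] compact_imp_closed[OF cC]])
  moreover have Zs: "Z \<subseteq> snd \<phi> ` C" by (auto simp: Z_def)
  ultimately have "compact Z" using compact_Int_closed[OF cC] by (metis inf.absorb2)
  moreover have "continuous_on Z (chart_inv \<phi>)"
    by (rule continuous_on_subset[OF continuous_on_chart_inv[OF \<phi>]]) (use Zs C(2) in blast)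
  ultimately have "compact (chart_inv \<phi> ` Z)" using compact_continuous_image by blast
  moreover have "chart_inv \<phi> ` Z = L \<inter> C"
  proof (intro equalityI subsetI)
    fix q assume "q \<in> chart_inv \<phi> ` Z"
    then obtain x where x: "x \<in> C" "G (snd \<phi> x) = 0" "q = chart_inv \<phi> (snd \<phi> x)" by (auto simp: Z_def)
    then have "q = x" using chart_inv_chart[OF \<phi>] C(2) by auto
    then show "q \<in> L \<inter> C" using x G(2)[of "snd \<phi> x"] C(3) by auto
  next
    fix q assume q: "q \<in> L \<inter> C"
    then have e: "chart_inv \<phi> (snd \<phi> q) = q" using chart_inv_chart[OF \<phi>] C(2) by auto
    then have "snd \<phi> q \<in> Z" using q G(2)[of "snd \<phi> q"] C(3) by (auto simp: Z_def)
    then show "q \<in> chart_inv \<phi> ` Z" using e by (metis image_eqI)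
  qed
  ultimately show ?thesis by simp
qed

text \<open>Every separating function on the model ball pulls back to a continuous p.s.h. function
  on U, so the hull in U is controlled by \<open>hull_in\<close>. That K lies in its own hull uses
  boundedness of continuous p.s.h. functions on compact K, without which the real supremum says
  nothing.\<close>

lemma psh_convex_in_coordinate_ball:
  assumes \<phi>: "\<phi> \<in> A" and ball: "ball z0 R \<subseteq> snd \<phi> ` fst \<phi>"
    and K: "compact K" "K \<noteq> {}" "K \<subseteq> chart_inv \<phi> ` ball z0 R"
    and hull: "hull_in (ball 0 R) ((\<lambda>q. snd \<phi> q - z0) ` K) \<subseteq> (\<lambda>q. snd \<phi> q - z0) ` K"
  shows "psh_convex_in A (chart_inv \<phi> ` ball z0 R) K"
proof -
  let ?U = "chart_inv \<phi> ` ball z0 R" and ?c = "\<lambda>q. snd \<phi> q - z0"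
  have U: "?U = fst \<phi> \<inter> snd \<phi> -` ball z0 R" by (rule chart_inv_image_eq[OF \<phi> ball])
  have cont: "continuous_on K u" if u: "cont_psh_on A ?U u" for u
  proof -
    have "continuous_on (snd \<phi> ` (fst \<phi> \<inter> ?U)) (u \<circ> chart_inv \<phi>)"
      using u \<phi> unfolding cont_psh_on_def cont_psh_def by blast
    moreover have "continuous_on K (snd \<phi>)"
      by (rule continuous_on_subset[OF continuous_on_chart[OF \<phi>]]) (use K(3) U in auto)
    moreover have "snd \<phi> ` K \<subseteq> snd \<phi> ` (fst \<phi> \<inter> ?U)" using K(3) U by blast
    ultimately have "continuous_on K (\<lambda>q. (u \<circ> chart_inv \<phi>) (snd \<phi> q))" by (rule continuous_on_compose2)
    then show ?thesis
      by (rule continuous_on_eq) (use K(3) U chart_inv_chart[OF \<phi>] in auto)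
  qed
  have "psh_hull A ?U K = K"
  proof (intro equalityI subsetI)
    fix q assume q: "q \<in> K"
    show "q \<in> psh_hull A ?U K" unfolding psh_hull_def
    proof (intro CollectI conjI allI impI)
      show "q \<in> ?U" using q K(3) by blast
      fix u assume "cont_psh_on A ?U u"
      then have "compact (u ` K)" by (intro compact_continuous_image cont K(1))
      then have "bdd_above (u ` K)" by (rule bounded_imp_bdd_above[OF compact_imp_bounded])
      then show "u q \<le> (SUP x\<in>K. u x)" using q by (rule cSUP_upper[rotated])
    qed
  next
    fix q assume q: "q \<in> psh_hull A ?U K"
    then have qU: "q \<in> ?U" by (simp add: psh_hull_def)
    have "?c q \<in> ?c ` K"
    proof (rule ccontr)
      assume "?c q \<notin> ?c ` K"
      then have "?c q \<notin> hull_in (ball 0 R) (?c ` K)" using hull by blast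
      moreover have "?c q \<in> ball 0 R" using qU unfolding U by (simp add: dist_norm norm_minus_commute)
      ultimately obtain u where u: "psh (ball 0 R) u" "\<And>x. x \<in> K \<Longrightarrow> u (?c x) < u (?c q)"
        unfolding hull_in_def by force
      have cu: "cont_psh_on A ?U (\<lambda>q. u (?c q))" by (rule cont_psh_on_coordinate_ball[OF \<phi> ball u(1)])
      obtain x where x: "x \<in> K" "\<And>y. y \<in> K \<Longrightarrow> u (?c y) \<le> u (?c x)"
        using continuous_attains_sup[OF K(1,2) cont[OF cu]] by blast
      have "(SUP x\<in>K. u (?c x)) \<le> u (?c x)" using K(2) x(2) by (rule cSUP_least)
      moreover have "u (?c q) \<le> (SUP x\<in>K. u (?c x))" using q cu unfolding psh_hull_def by blast
      ultimately show False using u(2)[OF x(1)] by simp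
    qed
    then obtain x where x: "x \<in> K" "snd \<phi> q = snd \<phi> x" by auto
    then have "q = x" using qU K(3) chart_inv_chart[OF \<phi>] unfolding U by (metis IntD1 subsetD)
    then show "q \<in> K" using x by simp
  qed
  then show ?thesis unfolding psh_convex_in_def using K by blast
qed

text \<open>The defining map is translated so that p becomes the origin. Its kernel vectors are
  tangent to L, so the Lagrangian condition makes the kernel isotropic.\<close>

lemma lagrangian_defining_map:
  assumes L: "lagrangian_submanifold A \<omega> L" "p \<in> L" and \<phi>: "\<phi> \<in> A" "p \<in> fst \<phi>"
  obtains N and g :: "complex^'n \<Rightarrow> complex^'n"
  where "open N" "0 \<in> N" "Ck_on 2 g N" "g 0 = 0"
    "\<And>z. z \<in> N \<Longrightarrow> chart_inv \<phi> (z + snd \<phi> p) \<in> L \<longleftrightarrow> g z = 0"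
    "\<And>v w. frechet_derivative g (at 0) v = 0 \<Longrightarrow> frechet_derivative g (at 0) w = 0 \<Longrightarrow> form_at \<phi> p v w = 0"
    "\<And>u. u \<in> submanifold_tangent_space A L p \<Longrightarrow> frechet_derivative g (at 0) (u \<phi>) = 0"
proof -
  let ?z0 = "snd \<phi> p"
  have emb: "embedded_submanifold A CARD('n) L"
    and lag: "\<And>u v. u \<in> submanifold_tangent_space A L p \<Longrightarrow> v \<in> submanifold_tangent_space A L p \<Longrightarrow> \<omega> p u v = 0"
    using L unfolding lagrangian_submanifold_def by auto
  obtain N and G :: "complex^'n \<Rightarrow> complex^'n"
    where N: "open N" "?z0 \<in> N" "N \<subseteq> snd \<phi> ` fst \<phi>" and G: "\<And>k. Ck_on k G N"
      "\<And>z. z \<in> N \<Longrightarrow> chart_inv \<phi> z \<in> L \<longleftrightarrow> G z = 0"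
    and ker: "\<And>w. frechet_derivative G (at ?z0) w = 0 \<Longrightarrow> coord_vec A \<phi> p w \<in> submanifold_tangent_space A L p"
    and tan: "\<And>u. u \<in> submanifold_tangent_space A L p \<Longrightarrow>
       frechet_derivative G (at ?z0) (u \<phi>) = 0 \<and> u = coord_vec A \<phi> p (u \<phi>)"
    using submanifold_defining_map[OF emb L(2) \<phi>] by blast
  define M where "M = (\<lambda>z. z + ?z0) -` N"
  have tr: "continuous_on UNIV (\<lambda>z. z + ?z0)" by (intro continuous_intros)
  have oM: "open M" unfolding M_def by (rule open_vimage[OF N(1) tr])
  have Ctr: "Ck_on k (\<lambda>z. z + ?z0) M" for k
    by (intro Ck_on_add[OF oM] Ck_on_const Ck_on_linear[OF bounded_linear_ident oM])
  define g where "g = (\<lambda>z. G (z + ?z0))"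
  have Cg: "Ck_on k g M" for k unfolding g_def
    by (rule Ck_on_compose[OF oM N(1) _ Ctr G(1)]) (auto simp: M_def)
  have "((\<lambda>z. z + ?z0) has_derivative (\<lambda>v. v)) (at 0)" by (auto intro!: derivative_eq_intros)
  moreover have "(G has_derivative frechet_derivative G (at ?z0)) (at (0 + ?z0))"
    using Ck_on_SucD(1)[OF G(1) N(2)] by simp
  ultimately have "(g has_derivative frechet_derivative G (at ?z0)) (at 0)"
    unfolding g_def by (rule has_derivative_compose)
  then have fd: "frechet_derivative g (at 0) = frechet_derivative G (at ?z0)"
    using frechet_derivative_at by metis
  show thesis
  proof (rule that[OF oM _ Cg])
    show "0 \<in> M" using N by (simp add: M_def)
    show "g 0 = 0" using G(2)[OF N(2)] chart_inv_chart[OF \<phi>] L(2) by (simp add: g_def)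
    show "chart_inv \<phi> (z + ?z0) \<in> L \<longleftrightarrow> g z = 0" if "z \<in> M" for z
      using G(2)[of "z + ?z0"] that by (simp add: M_def g_def)
    show "form_at \<phi> p v w = 0" if "frechet_derivative g (at 0) v = 0" "frechet_derivative g (at 0) w = 0" for v w
      unfolding form_at_def by (rule lag; rule ker) (use that fd in simp_all)
    show "frechet_derivative g (at 0) (u \<phi>) = 0" if "u \<in> submanifold_tangent_space A L p" for u
      using tan[OF that] fd by simp
  qed
qed

lemma union_locally_psh_convex:
  assumes L1: "lagrangian_submanifold A \<omega> L1" and L2: "lagrangian_submanifold A \<omega> L2"
    and trans: "transverse_at A L1 L2 p"
  shows "locally_psh_convex A \<omega> (L1 \<union> L2) p"
proof -
  have p: "p \<in> L1" "p \<in> L2" using trans by (auto simp: transverse_at_def)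
  obtain \<phi> where \<phi>: "\<phi> \<in> A" "p \<in> fst \<phi>" using chart_covers by blast
  define z0 where "z0 = snd \<phi> p"
  obtain N1 g1 where g1: "open N1" "0 \<in> N1" "Ck_on 2 g1 N1" "g1 0 = (0::complex^'n)"
    "\<And>z. z \<in> N1 \<Longrightarrow> chart_inv \<phi> (z + z0) \<in> L1 \<longleftrightarrow> g1 z = 0"
    "\<And>v w. frechet_derivative g1 (at 0) v = 0 \<Longrightarrow> frechet_derivative g1 (at 0) w = 0 \<Longrightarrow> form_at \<phi> p v w = 0"
    "\<And>u. u \<in> submanifold_tangent_space A L1 p \<Longrightarrow> frechet_derivative g1 (at 0) (u \<phi>) = 0"
    unfolding z0_def using lagrangian_defining_map[OF L1 p(1) \<phi>] by metis
  obtain N2 g2 where g2: "open N2" "0 \<in> N2" "Ck_on 2 g2 N2" "g2 0 = (0::complex^'n)"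
    "\<And>z. z \<in> N2 \<Longrightarrow> chart_inv \<phi> (z + z0) \<in> L2 \<longleftrightarrow> g2 z = 0"
    "\<And>v w. frechet_derivative g2 (at 0) v = 0 \<Longrightarrow> frechet_derivative g2 (at 0) w = 0 \<Longrightarrow> form_at \<phi> p v w = 0"
    "\<And>u. u \<in> submanifold_tangent_space A L2 p \<Longrightarrow> frechet_derivative g2 (at 0) (u \<phi>) = 0"
    unfolding z0_def using lagrangian_defining_map[OF L2 p(2) \<phi>] by metis
  define A1 where "A1 = frechet_derivative g1 (at 0)"
  define A2 where "A2 = frechet_derivative g2 (at 0)"
  have D1: "(g1 has_derivative A1) (at 0)" and D2: "(g2 has_derivative A2) (at 0)"
    unfolding A1_def A2_def using Ck_on_SucD(1)[of 1 g1 N1 0] Ck_on_SucD(1)[of 1 g2 N2 0] g1 g2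
    by (auto simp: numeral_2_eq_2)
  \<comment> \<open>This yields total reality: if v and i v both lie in an isotropic kernel, the
    form vanishes on this pair, which taming allows only for v = 0.\<close>
  have real: "v = 0" if "form_at \<phi> p v (\<i> *s v) = 0" for v
    using form_at_tame[OF \<phi>, of v] that by (cases "v = 0") auto
  have span: "\<exists>x\<in>{v. A1 v = 0}. \<exists>y\<in>{v. A2 v = 0}. v = x + y" for v
  proof -
    have "coord_vec A \<phi> p v \<in> tangent_space A p" by (rule coord_vec_tangent[OF \<phi>])
    then obtain u w where uw: "u \<in> submanifold_tangent_space A L1 p" "w \<in> submanifold_tangent_space A L2 p"
        "coord_vec A \<phi> p v = tv_add u w"
      using trans unfolding transverse_at_def by auto
    have "v = u \<phi> + w \<phi>" using coord_vec_self[OF \<phi>, of v] uw(3) by (simp add: tv_add_def)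
    then show ?thesis using g1(7)[OF uw(1)] g2(7)[OF uw(2)] unfolding A1_def A2_def by blast
  qed
  obtain H :: "complex^'n \<Rightarrow> complex^'n \<Rightarrow> real" where H: "bounded_bilinear H" "\<And>v w. H v w = H w v" "\<And>v w. H (\<i> *s v) (\<i> *s w) = - H v w"
    and H1: "\<And>v. A1 v = 0 \<Longrightarrow> v \<noteq> 0 \<Longrightarrow> H v v > 0" and H2: "\<And>v. A2 v = 0 \<Longrightarrow> v \<noteq> 0 \<Longrightarrow> H v v < 0"
  proof (rule lagrangian_pair_form[OF bounded_bilinear_form_at[OF \<phi>] form_at_bilinear(3)[OF \<phi>] form_at_tame[OF \<phi>] _ _ _ _ span])
    show "subspace {v. A1 v = 0}" "subspace {v. A2 v = 0}"
      using linear_subspace_kernel[OF has_derivative_linear[OF D1]] linear_subspace_kernel[OF has_derivative_linear[OF D2]] .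
    show "form_at \<phi> p a b = 0" if "a \<in> {v. A1 v = 0}" "b \<in> {v. A1 v = 0}" for a b
      using g1(6) that by (simp add: A1_def)
    show "form_at \<phi> p a b = 0" if "a \<in> {v. A2 v = 0}" "b \<in> {v. A2 v = 0}" for a b
      using g2(6) that by (simp add: A2_def)
  qed auto
  interpret H: bounded_bilinear H by (rule H(1))
  obtain \<delta>1 m1 where m1: "\<delta>1 > 0" "m1 > 0" "\<And>z. norm z < \<delta>1 \<Longrightarrow> g1 z = 0 \<Longrightarrow> m1 * (norm z)\<^sup>2 \<le> H z z"
    using quadratic_positive_near_kernel[OF H(1) D1 g1(4) H1] by blast
  \<comment> \<open>Since H (-v) w = - H v w, this is the negative of H, to which the positivity
    lemma applies along L2.\<close>
  have Hm: "bounded_bilinear (\<lambda>v. H (- v))"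
    by (rule H.comp1[OF bounded_linear_minus[OF bounded_linear_ident]])
  obtain \<delta>2 m2 where m2: "\<delta>2 > 0" "m2 > 0" "\<And>z. norm z < \<delta>2 \<Longrightarrow> g2 z = 0 \<Longrightarrow> m2 * (norm z)\<^sup>2 \<le> - H z z"
    using quadratic_positive_near_kernel[OF Hm D2 g2(4)] H2 unfolding H.minus_left by (metis neg_0_less_iff_less)
  obtain M where M: "M > 0" "\<And>z. cmod (complexify H z) \<le> M * (norm z)\<^sup>2"
    using cmod_complexify_bound[OF H(1)] by blast
  obtain r1 \<kappa>1 where r1: "r1 > 0" "\<kappa>1 > 0" "ball 0 r1 \<subseteq> N1"
    "\<And>q. psh (ball 0 r1) (\<lambda>z. (norm (g1 z))\<^sup>2 - \<kappa>1 * (norm (z - q))\<^sup>2)"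
  proof (rule psh_near_totally_real_zero[OF g1(3,1,2,4)])
    show "v = 0" if "frechet_derivative g1 (at 0) v = 0" "frechet_derivative g1 (at 0) (\<i> *s v) = 0" for v
      by (rule real, rule g1(6)[OF that])
  qed (rule that)
  obtain r2 \<kappa>2 where r2: "r2 > 0" "\<kappa>2 > 0" "ball 0 r2 \<subseteq> N2"
    "\<And>q. psh (ball 0 r2) (\<lambda>z. (norm (g2 z))\<^sup>2 - \<kappa>2 * (norm (z - q))\<^sup>2)"
  proof (rule psh_near_totally_real_zero[OF g2(3,1,2,4)])
    show "v = 0" if "frechet_derivative g2 (at 0) v = 0" "frechet_derivative g2 (at 0) (\<i> *s v) = 0" for v
      by (rule real, rule g2(6)[OF that])
  qed (rule that)
  have "z0 \<in> snd \<phi> ` fst \<phi>" using \<phi> by (simp add: z0_def)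
  then obtain R0 where R0: "R0 > 0" "cball z0 R0 \<subseteq> snd \<phi> ` fst \<phi>"
    using open_chart_range[OF \<phi>(1)] open_contains_cball by blast
  define R where "R = Min {R0, r1, r2, \<delta>1, \<delta>2}"
  have R: "R > 0" "R \<le> R0" "R \<le> r1" "R \<le> r2" "R \<le> \<delta>1" "R \<le> \<delta>2"
    using R0 r1 r2 m1 m2 by (auto simp: R_def)
  define \<kappa> where "\<kappa> = min \<kappa>1 \<kappa>2"
  \<comment> \<open>On L1 and L2 the real part has absolute value at least m1 |z|^2 or m2 |z|^2,
    while the modulus is at most M |z|^2; the ratio is the opening constant of the sectors.\<close>
  define c where "c = min 1 (min m1 m2 / M)"
  have \<kappa>: "\<kappa> > 0" using r1 r2 by (simp add: \<kappa>_def)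
  have c: "c > 0" "c \<le> 1" "c * M \<le> m1" "c * M \<le> m2"
  proof -
    have "c \<le> min m1 m2 / M" by (simp add: c_def)
    then have "c * M \<le> min m1 m2" using M(1) by (simp add: pos_le_divide_eq)
    then show "c * M \<le> m1" "c * M \<le> m2" by auto
  qed (use M(1) m1 m2 in \<open>auto simp: c_def\<close>)
  \<comment> \<open>Lowering \<kappa>' to \<kappa> means adding a nonnegative multiple of the p.s.h.
    function |z - q|^2, so one constant serves both submanifolds.\<close>
  have shrink: "psh (ball 0 R) (\<lambda>z. \<rho> z - \<kappa> * (norm (z - q))\<^sup>2)"
    if "psh (ball 0 r) (\<lambda>z. \<rho> z - \<kappa>' * (norm (z - q))\<^sup>2)" "R \<le> r" "\<kappa> \<le> \<kappa>'" for \<rho> r \<kappa>' and q :: "complex^'n"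
  proof -
    have "psh (ball 0 R) (\<lambda>z. (\<rho> z - \<kappa>' * (norm (z - q))\<^sup>2) + (\<kappa>' - \<kappa>) * (norm (z - q))\<^sup>2)"
      by (intro psh_add psh_cmult psh_norm_sq psh_subset[OF that(1)]) (use that in auto)
    then show ?thesis by (simp add: algebra_simps)
  qed
  have sector1: "c * cmod (complexify H z) \<le> Re (complexify H z) \<and> 0 < Re (complexify H z)"
    if "norm z < R" "g1 z = 0" "z \<noteq> 0" for z
  proof -
    have h: "m1 * (norm z)\<^sup>2 \<le> H z z" using m1(3)[of z] that R(5) by simp
    have "c * cmod (complexify H z) \<le> c * (M * (norm z)\<^sup>2)" using M(2) c(1) by simp
    also have "\<dots> \<le> m1 * (norm z)\<^sup>2" using mult_right_mono[OF c(3), of "(norm z)\<^sup>2"] by (simp add: mult.assoc)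
    finally have "c * cmod (complexify H z) \<le> H z z" using h by linarith
    moreover have "0 < m1 * (norm z)\<^sup>2" using m1 that by simp
    ultimately show ?thesis using h by (simp add: complexify_def)
  qed
  have sector2: "c * cmod (complexify H z) \<le> - Re (complexify H z) \<and> Re (complexify H z) < 0"
    if "norm z < R" "g2 z = 0" "z \<noteq> 0" for z
  proof -
    have h: "m2 * (norm z)\<^sup>2 \<le> - H z z" using m2(3)[of z] that R(6) by simp
    have "c * cmod (complexify H z) \<le> c * (M * (norm z)\<^sup>2)" using M(2) c(1) by simp
    also have "\<dots> \<le> m2 * (norm z)\<^sup>2" using mult_right_mono[OF c(4), of "(norm z)\<^sup>2"] by (simp add: mult.assoc)
    finally have "c * cmod (complexify H z) \<le> - H z z" using h by linarith
    moreover have "0 < m2 * (norm z)\<^sup>2" using m2 that by simp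
    ultimately show ?thesis using h by (simp add: complexify_def)
  qed
  define U where "U = chart_inv \<phi> ` ball z0 R"
  have ball: "ball z0 R \<subseteq> snd \<phi> ` fst \<phi>" using R0(2) R(2) by auto
  have U: "U = fst \<phi> \<inter> snd \<phi> -` ball z0 R" unfolding U_def by (rule chart_inv_image_eq[OF \<phi>(1) ball])
  \<comment> \<open>Half the radius leaves room for the closure: the Riemannian ball lies in the
    compact image of this closed ball, and therefore its closure lies there as well, still inside
    U.\<close>
  have cb2: "cball z0 (R/2) \<subseteq> ball z0 R" using R(1) by auto
  then have cb2': "cball (snd \<phi> p) (R/2) \<subseteq> snd \<phi> ` fst \<phi>" using ball by (auto simp: z0_def)
  obtain \<epsilon>0 where \<epsilon>0: "\<epsilon>0 > 0" "\<And>\<epsilon>. \<epsilon> \<le> \<epsilon>0 \<Longrightarrow> riem_ball A \<omega> p \<epsilon> \<subseteq> chart_inv \<phi> ` ball z0 (R/2)"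
    unfolding z0_def using riem_ball_subset_coordinate_ball[OF \<phi> cb2'] R(1) by (metis half_gt_zero)
  have "psh_convex_in A U ((L1 \<union> L2) \<inter> closure (riem_ball A \<omega> p \<epsilon>))" if \<epsilon>: "0 < \<epsilon>" "\<epsilon> < \<epsilon>0" for \<epsilon>
  proof -
    define C where "C = closure (riem_ball A \<omega> p \<epsilon>)"
    define K where "K = (L1 \<union> L2) \<inter> C"
    have cC2: "compact (chart_inv \<phi> ` cball z0 (R/2))"
      by (rule compact_continuous_image[OF continuous_on_subset[OF continuous_on_chart_inv[OF \<phi>(1)]] compact_cball])
         (use cb2 ball in blast)
    have "riem_ball A \<omega> p \<epsilon> \<subseteq> chart_inv \<phi> ` cball z0 (R/2)"
      using \<epsilon>0(2)[of \<epsilon>] \<epsilon> ball_subset_cball[of z0 "R/2"] by (meson image_mono less_imp_le subset_trans)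
    then have CC2: "C \<subseteq> chart_inv \<phi> ` cball z0 (R/2)"
      unfolding C_def by (rule closure_minimal[OF _ compact_imp_closed[OF cC2]])
    then have cC: "compact C" using compact_Int_closed[OF cC2, of C] by (simp add: C_def inf.absorb2)
    have CU: "C \<subseteq> U" using CC2 cb2 unfolding U_def by blast
    have near: "snd \<phi> q - z0 \<in> ball 0 R" "chart_inv \<phi> (snd \<phi> q - z0 + z0) = q" if "q \<in> C" for q
      using that CU chart_inv_chart[OF \<phi>(1)] by (auto simp: U dist_norm norm_minus_commute)
    have cL: "compact (L \<inter> C)"
      if "open N" "Ck_on 2 g N" "ball 0 R \<subseteq> N" "\<And>z. z \<in> N \<Longrightarrow> chart_inv \<phi> (z + z0) \<in> L \<longleftrightarrow> g z = (0::complex^'n)" for L N g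
    proof (rule compact_in_submanifold[OF \<phi>(1) cC, of "ball z0 R" "\<lambda>z. g (z - z0)"])
      have "continuous_on N g" using Ck_on_le[OF that(2), of 0] by simp
      then show "continuous_on (ball z0 R) (\<lambda>z. g (z - z0))"
        by (rule continuous_on_compose2) (use that(3) in \<open>auto intro!: continuous_intros simp: subset_eq dist_norm norm_minus_commute\<close>)
      show "chart_inv \<phi> z \<in> L \<longleftrightarrow> g (z - z0) = 0" if "z \<in> ball z0 R" for z
      proof -
        have "z - z0 \<in> N" using that \<open>ball 0 R \<subseteq> N\<close> by (auto simp: dist_norm norm_minus_commute)
        from \<open>\<And>z. z \<in> N \<Longrightarrow> chart_inv \<phi> (z + z0) \<in> L \<longleftrightarrow> g z = 0\<close>[OF this] show ?thesis by simp
      qed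
    qed (use CU in \<open>auto simp: U\<close>)
    have b1: "ball 0 R \<subseteq> N1" and b2: "ball 0 R \<subseteq> N2" using r1(3) r2(3) R(3,4) by auto
    have "compact K" unfolding K_def Int_Un_distrib2
      by (intro compact_Un cL[OF g1(1,3) b1 g1(5)] cL[OF g2(1,3) b2 g2(5)])
    moreover have pK: "p \<in> K" unfolding K_def C_def
      using p centre_in_riem_ball[OF \<epsilon>(1)] closure_subset by blast
    moreover have KU: "K \<subseteq> U" using CU by (auto simp: K_def)
    moreover have "hull_in (ball 0 R) ((\<lambda>q. snd \<phi> q - z0) ` K) \<subseteq> (\<lambda>q. snd \<phi> q - z0) ` K"
    proof (rule hull_in_two_sectors[of _ R "complexify H" c \<kappa> "\<lambda>z. (norm (g1 z))\<^sup>2" "\<lambda>z. (norm (g2 z))\<^sup>2"])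
      show "compact ((\<lambda>q. snd \<phi> q - z0) ` K)"
        by (intro compact_continuous_image \<open>compact K\<close> continuous_on_diff continuous_on_const
            continuous_on_subset[OF continuous_on_chart[OF \<phi>(1)]]) (use KU U in auto)
      show "0 \<in> (\<lambda>q. snd \<phi> q - z0) ` K" using pK by (force simp: z0_def)
      show "(\<lambda>q. snd \<phi> q - z0) ` K \<subseteq> ball 0 R" using near(1) by (auto simp: K_def)
      show "holo_fun_on (complexify H) (ball 0 R)" by (rule holo_fun_on_complexify[OF H])
      show "complexify H 0 = 0" by (simp add: complexify_def H.zero_left complex_eq_iff)
      show "psh (ball 0 R) (\<lambda>z. (norm (g1 z))\<^sup>2 - \<kappa> * (norm (z - q))\<^sup>2)" for q
        by (rule shrink[OF r1(4) R(3)]) (simp add: \<kappa>_def)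
      show "psh (ball 0 R) (\<lambda>z. (norm (g2 z))\<^sup>2 - \<kappa> * (norm (z - q))\<^sup>2)" for q
        by (rule shrink[OF r2(4) R(4)]) (simp add: \<kappa>_def)
      fix x assume x: "x \<in> (\<lambda>q. snd \<phi> q - z0) ` K" "x \<noteq> 0"
      then obtain q where q: "q \<in> C" "q \<in> L1 \<or> q \<in> L2" "x = snd \<phi> q - z0" by (auto simp: K_def)
      have xR: "x \<in> ball 0 R" and xq: "chart_inv \<phi> (x + z0) = q" using near[OF q(1)] q(3) by auto
      have "g1 x = 0 \<or> g2 x = 0" using g1(5)[of x] g2(5)[of x] xR b1 b2 xq q(2) by blast
      then show "c * cmod (complexify H x) \<le> Re (complexify H x) \<and> 0 < Re (complexify H x) \<and> (norm (g1 x))\<^sup>2 = 0 \<or>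
          c * cmod (complexify H x) \<le> - Re (complexify H x) \<and> Re (complexify H x) < 0 \<and> (norm (g2 x))\<^sup>2 = 0"
        using sector1[of x] sector2[of x] x(2) xR by auto
    qed (use c \<kappa> g1(4) g2(4) in auto)
    ultimately show ?thesis
      unfolding K_def[symmetric] C_def[symmetric] U_def
      by (intro psh_convex_in_coordinate_ball[OF \<phi>(1) ball]) auto
  qed
  moreover have "stein_on A U" unfolding U_def by (rule stein_coordinate_ball[OF \<phi>(1) ball])
  moreover have "p \<in> U" using \<phi> R(1) by (simp add: U z0_def)
  ultimately show ?thesis unfolding locally_psh_convex_def using \<epsilon>0(1) by blast
qed

end

theorem proposition3p2:
  fixes A :: "('m::{t2_space, second_countable_topology}, 'n::finite) chart set"
    and \<omega> :: "('m, 'n) two_form"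
    and L1 L2 :: "'m set"
    and p :: 'm
  assumes "complex_atlas A"
    and "stein_on A UNIV"
    and "symplectic_form A \<omega>"
    and "tames_J A \<omega>"
    and "lagrangian_submanifold A \<omega> L1"
    and "lagrangian_submanifold A \<omega> L2"
    and "transverse_at A L1 L2 p"
  shows "locally_psh_convex A \<omega> (L1 \<union> L2) p"
proof -
  interpret taming_form A \<omega>
    by unfold_locales (use assms in \<open>auto simp: symplectic_form_def\<close>)
  show ?thesis by (rule union_locally_psh_convex[OF assms(5-7)])
qed

end
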